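(* Let $(\Omega,\Sigma,P)$ be a probability space, $\Theta:\Omega\to\mathbb{R}^d$ a random vector, $D\in\mathfrak{B}(\mathbb{R}^d)$ with $\Theta(\Omega)\subseteq D$, and $\{P_\theta\}_{\theta\in D}$ a disintegration of $P$ over $P_\Theta$ consistent with $\Theta$. Let $h:D\to\mathbb{R}^k$ ($k\in\mathbb{N}$) be a Borel measurable function for which there is a $P_\Theta$-null set $L_0\in\mathfrak{B}(D)$ such that $h\upharpoonright D\setminus L_0$ is injective. Let $N=\{N_t\}_{t\in\mathbb{R}_+}$ be a counting process on $(\Omega,\Sigma,P)$ with interarrival process $\{W_n\}_{n\in\mathbb{N}}$, and suppose that $N$ is a $P$-eMRP$(\mathbf{K}(h(\Theta)))$, with $(P_\theta)_{W_n}=\mathbf{K}(h(\theta))$ for all $n\in\mathbb{N}$ and $\theta\in D$. Put $F_{h(\theta)}(t):=P_\theta(\{W_n\le t\})$ for $\theta\in D$, $t\ge 0$ (this does not depend on $n$). Assume that there exist a $P_\Theta$-null set $L_h\in\mathfrak{B}(D)$ and a function $C\in\mathcal{L}^1(P_{h(\Theta)})$ such that for every $\theta\in D\setminus L_h$ the function $F_{h(\theta)}$ is continuously differentiable on $(0,\infty)$ with $0<F'_{h(\theta)}(t)<C(h(\theta))$ for each $t>0$, and such that the function $p_h:D\setminus L_h\to\mathbb{R}$, $p_h(\theta):=\lim_{t\to 0}F'_{h(\theta)}(t)$, is (well defined,) positive and injective. Put $O_h:=L_0\cup L_h$, let $\widehat\Theta(\omega):=p_h(\Theta(\omega))$ for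 $\omega\in\Theta^{-1}(D\setminus O_h)$, and denote again by $\widehat\Theta$ any measurable extension of this function to a real-valued random variable on $\Omega$. For $\widehat\theta\in\mathbb{R}$ and $A\in\Sigma$ put $$Q_{\widehat\theta}(A):=\begin{cases}P_{p_h^{-1}(\widehat\theta)}(A)&\text{if }\widehat\theta\in p_h(D\setminus O_h),\\ P(A)&\text{otherwise,}\end{cases}$$ where $p_h^{-1}$ is the inverse of $p_h$ restricted to $D\setminus O_h$. Then $\{Q_{\widehat\theta}\}_{\widehat\theta\in\mathbb{R}}$ is a disintegration of $P$ over $P_{\widehat\Theta}$ consistent with $\widehat\Theta$, and the following are equivalent: (i) $N$ has the Markov property with respect to $P$; (ii) $N$ has the Markov property with respect to $Q_{\widehat\theta}$ for $P_{\widehat\Theta}$-almost all $\widehat\theta\in\mathbb{R}$; (iii) $N$ has the multinomial property with respect to $Q_{\widehat\theta}$ for $P_{\widehat\Theta}$-almost all $\widehat\theta\in\mathbb{R}$.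
   Context: Notation: $\mathfrak{B}(E)$ is the Borel $\sigma$-algebra of $E$; $P_X$ is the law of $X$ under $P$, and $(P_\theta)_X$ the law of $X$ under $P_\theta$; $\mathcal{L}^1(Q)$ is the set of real-valued $Q$-integrable functions; $\sigma(\Theta)$ is the $\sigma$-algebra generated by $\Theta$; $f\upharpoonright A$ is the restriction of $f$ to $A$; $h(\Theta):=h\circ\Theta$. Disintegration: for a random vector $X$ with values in a Borel set $E\subseteq\mathbb{R}^m$, a family $\{R_x\}_{x\in E}$ of probability measures on $\Sigma$ is a disintegration of $P$ over $P_X$ if $x\mapsto R_x(A)$ is $\mathfrak{B}(E)$-measurable and $\int_E R_x(A)\,P_X(dx)=P(A)$ for every $A\in\Sigma$. It is consistent with $X$ if for each $B\in\mathfrak{B}(E)$ one has $R_x(X^{-1}(B))=1$ for $P_X$-almost every $x\in B$. Counting process: a family $N=\{N_t\}_{t\ge0}$ of random variables with values in $\mathbb{N}_0\cup\{\infty\}$ whose paths are right-continuous, have jumps of size at most one, vanish at $t=0$ and increase to infinity (these path properties are assumed to hold for every $\omega\in\Omega$). Arrival process: $T_0:=0$, $T_n:=\inf\{t\ge0:N_t=n\}$. Interarrival process: $W_n:=T_n-T_{n-1}$, $n\in\mathbb{N}$. Conditional distribution of a real random variable $X$ over $\Theta$: a map $P_{X|\Theta}:\mathfrak{B}(\mathbb{R})\times\Omega\to[0,1]$ such that $P_{X|\Theta}(\cdot,\omega)$ is a probability measure for each $\omega$, and for each $B$, $P_{X|\Theta}(B,\cdot)$ is $\sigma(\Theta)$-measurable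 and a version of $P(X^{-1}(B)\mid\sigma(\Theta))$. $\mathbf{K}$ denotes a family of probability measures $\mathbf{K}(y)$, $y\in\mathbb{R}^k$, on $\mathfrak{B}(\mathbb{R})$ with $y\mapsto\mathbf{K}(y)(B)$ Borel measurable for each $B$; $\mathbf{K}(h(\Theta))$ is the map $(B,\omega)\mapsto\mathbf{K}(h(\Theta(\omega)))(B)$. $N$ is an extended mixed renewal process, written $P$-eMRP$(\mathbf{K}(h(\Theta)))$, if $W=\{W_n\}_{n\in\mathbb{N}}$ is $P$-conditionally independent given $\sigma(\Theta)$ and for every $n$, $P_{W_n|\Theta}=\mathbf{K}(h(\Theta))$ $P\upharpoonright\sigma(\Theta)$-a.s. (equality of measures on $\mathfrak{B}(\mathbb{R})$ for all $\omega$ off a $P$-null set in $\sigma(\Theta)$). Markov property with respect to a probability measure $R$ on $\Sigma$: $R(N_{t_{m+1}}=n_{m+1}\mid\bigcap_{j=1}^m\{N_{t_j}=n_j\})=R(N_{t_{m+1}}=n_{m+1}\mid N_{t_m}=n_m)$ for all $m\in\mathbb{N}$, $0<t_1<\dots<t_{m+1}$ and $n_1,\dots,n_{m+1}\in\mathbb{N}_0$ with $R(\bigcap_{j=1}^m\{N_{t_j}=n_j\})>0$. Multinomial property with respect to $R$: for all $m\in\mathbb{N}$, $0=t_0<t_1<\dots<t_m$ and $k_1,\dots,k_m\in\mathbb{N}_0$ with $n:=\sum_{j=1}^m k_j$, $R(\bigcap_{j=1}^m\{N_{t_j}-N_{t_{j-1}}=k_j\})=\frac{n!}{\prod_{j=1}^m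 k_j!}\prod_{j=1}^m\bigl(\frac{t_j-t_{j-1}}{t_m}\bigr)^{k_j}R(N_{t_m}=n)$. *)

theory Defs
  imports "HOL-Probability.Probability"
begin

text \<open>
  The disintegrating family \<open>R\<close> is only constrained on \<open>E\<close>; the law \<open>P\<^sub>X\<close> is taken on the Borel
  \<open>\<sigma>\<close>-algebra of the subspace \<open>E\<close>.
\<close>

definition disintegration ::
  "'a measure \<Rightarrow> 'b::topological_space set \<Rightarrow> ('a \<Rightarrow> 'b) \<Rightarrow> ('b \<Rightarrow> 'a measure) \<Rightarrow> bool" where
  "disintegration P E X R \<longleftrightarrow>
     (\<forall>x\<in>E. prob_space (R x) \<and> sets (R x) = sets P) \<and>
     (\<forall>A\<in>sets P.
        (\<lambda>x. emeasure (R x) A) \<in> borel_measurable (restrict_space borel E) \<and>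
        (\<integral>\<^sup>+x. emeasure (R x) A \<partial>distr P (restrict_space borel E) X) = emeasure P A)"

definition consistent_with ::
  "'a measure \<Rightarrow> 'b::topological_space set \<Rightarrow> ('a \<Rightarrow> 'b) \<Rightarrow> ('b \<Rightarrow> 'a measure) \<Rightarrow> bool" where
  "consistent_with P E X R \<longleftrightarrow>
     (\<forall>B\<in>sets (restrict_space borel E).
        AE x in distr P (restrict_space borel E) X.
          x \<in> B \<longrightarrow> emeasure (R x) (X -` B \<inter> space P) = 1)"

definition reparam_disintegration ::
  "'a measure \<Rightarrow> ('b \<Rightarrow> 'a measure) \<Rightarrow> ('b \<Rightarrow> real) \<Rightarrow> 'b set \<Rightarrow> real \<Rightarrow> 'a measure" where
  "reparam_disintegration P R p S x = (if x \<in> p ` S then R (the_inv_into S p x) else P)"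

text \<open>
  Only times \<open>t \<ge> 0\<close> matter. The value \<open>\<infinity>\<close> is allowed, so a path may explode in finite time.
  The supremum is the left limit of the (nondecreasing) path at \<open>t\<close>.
\<close>

definition counting_process :: "'a measure \<Rightarrow> (real \<Rightarrow> 'a \<Rightarrow> enat) \<Rightarrow> bool" where
  "counting_process P N \<longleftrightarrow>
     (\<forall>t\<ge>0. N t \<in> measurable P (count_space UNIV)) \<and>
     (\<forall>\<omega>\<in>space P.
        N 0 \<omega> = 0 \<and>
        mono_on {0..} (\<lambda>t. N t \<omega>) \<and>
        (\<forall>t\<ge>0. continuous (at_right t) (\<lambda>s. N s \<omega>)) \<and>
        (\<forall>t>0. N t \<omega> \<le> (SUP s\<in>{0..<t}. N s \<omega>) + 1) \<and>
        ((\<lambda>t. N t \<omega>) \<longlongrightarrow> \<infinity>) at_top)"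

definition arrival :: "(real \<Rightarrow> 'a \<Rightarrow> enat) \<Rightarrow> nat \<Rightarrow> 'a \<Rightarrow> real" where
  "arrival N n \<omega> = (if n = 0 then 0 else Inf {t. 0 \<le> t \<and> N t \<omega> = enat n})"

text \<open>Meaningful for \<open>n \<ge> 1\<close> only.\<close>

definition interarrival :: "(real \<Rightarrow> 'a \<Rightarrow> enat) \<Rightarrow> nat \<Rightarrow> 'a \<Rightarrow> real" where
  "interarrival N n \<omega> = arrival N n \<omega> - arrival N (n - 1) \<omega>"

abbreviation generated_algebra :: "'a measure \<Rightarrow> ('a \<Rightarrow> 'b::topological_space) \<Rightarrow> 'a measure" where
  "generated_algebra P X \<equiv> vimage_algebra (space P) X borel"

definition cond_distribution ::
  "'a measure \<Rightarrow> 'a measure \<Rightarrow> ('a \<Rightarrow> real) \<Rightarrow> ('a \<Rightarrow> real measure) \<Rightarrow> bool" where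
  "cond_distribution P F X \<kappa> \<longleftrightarrow>
     (\<forall>\<omega>\<in>space P. prob_space (\<kappa> \<omega>) \<and> sets (\<kappa> \<omega>) = sets borel) \<and>
     (\<forall>B\<in>sets borel.
        (\<lambda>\<omega>. measure (\<kappa> \<omega>) B) \<in> borel_measurable F \<and>
        (AE \<omega> in P. measure (\<kappa> \<omega>) B = real_cond_exp P F (indicator (X -` B \<inter> space P)) \<omega>))"

definition cond_indep_vars ::
  "'a measure \<Rightarrow> 'a measure \<Rightarrow> ('i \<Rightarrow> 'b measure) \<Rightarrow> ('i \<Rightarrow> 'a \<Rightarrow> 'b) \<Rightarrow> 'i set \<Rightarrow> bool" where
  "cond_indep_vars P F S X I \<longleftrightarrow>
     (\<forall>i\<in>I. X i \<in> measurable P (S i)) \<and>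
     (\<forall>J\<subseteq>I. finite J \<longrightarrow> J \<noteq> {} \<longrightarrow>
        (\<forall>B. (\<forall>j\<in>J. B j \<in> sets (S j)) \<longrightarrow>
           (AE \<omega> in P.
              real_cond_exp P F (indicator (\<Inter>j\<in>J. X j -` B j \<inter> space P)) \<omega> =
              (\<Prod>j\<in>J. real_cond_exp P F (indicator (X j -` B j \<inter> space P)) \<omega>))))"

text \<open>
  Conditional distributions are only determined up to null sets (uniquely so, as the \<open>W\<^sub>n\<close> are
  real-valued), hence the quantifier over versions. The conditioning is on \<open>\<sigma>(\<Theta>)\<close>, not on
  \<open>\<sigma>(h(\<Theta>))\<close>, and the exceptional null set lies in \<open>\<sigma>(\<Theta>)\<close>.
\<close>

definition eMRP ::
  "'a measure \<Rightarrow> (real \<Rightarrow> 'a \<Rightarrow> enat) \<Rightarrow> ('a \<Rightarrow> 'b::topological_space) \<Rightarrow> ('c \<Rightarrow> real measure) \<Rightarrow>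
     ('b \<Rightarrow> 'c) \<Rightarrow> bool" where
  "eMRP P N \<Theta> K h \<longleftrightarrow>
     cond_indep_vars P (generated_algebra P \<Theta>) (\<lambda>_. borel) (interarrival N) {1..} \<and>
     (\<forall>n\<ge>1. \<exists>\<kappa>. cond_distribution P (generated_algebra P \<Theta>) (interarrival N n) \<kappa> \<and>
        (AE \<omega> in restr_to_subalg P (generated_algebra P \<Theta>). \<kappa> \<omega> = K (h (\<Theta> \<omega>))))"

definition markov_property :: "'a measure \<Rightarrow> (real \<Rightarrow> 'a \<Rightarrow> enat) \<Rightarrow> bool" where
  "markov_property R N \<longleftrightarrow>
     (\<forall>m\<ge>1. \<forall>(t :: nat \<Rightarrow> real) (n :: nat \<Rightarrow> nat).
        0 < t 1 \<longrightarrow> (\<forall>j\<in>{1..m}. t j < t (Suc j)) \<longrightarrow>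
        \<P>(\<omega> in R. \<forall>j\<in>{1..m}. N (t j) \<omega> = enat (n j)) > 0 \<longrightarrow>
        \<P>(\<omega> in R. N (t (Suc m)) \<omega> = enat (n (Suc m)) \<bar> \<forall>j\<in>{1..m}. N (t j) \<omega> = enat (n j)) =
        \<P>(\<omega> in R. N (t (Suc m)) \<omega> = enat (n (Suc m)) \<bar> N (t m) \<omega> = enat (n m)))"

text \<open>
  In \<^typ>\<open>enat\<close> one has \<open>\<infinity> - x = \<infinity>\<close>, also for \<open>x = \<infinity>\<close>, so that increments out of \<open>\<infinity>\<close> never equal a
  natural number.
\<close>

definition multinomial_property :: "'a measure \<Rightarrow> (real \<Rightarrow> 'a \<Rightarrow> enat) \<Rightarrow> bool" where
  "multinomial_property R N \<longleftrightarrow>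
     (\<forall>m\<ge>1. \<forall>(t :: nat \<Rightarrow> real) (k :: nat \<Rightarrow> nat).
        t 0 = 0 \<longrightarrow> (\<forall>j<m. t j < t (Suc j)) \<longrightarrow>
        (let n = (\<Sum>j=1..m. k j) in
          \<P>(\<omega> in R. \<forall>j\<in>{1..m}. N (t j) \<omega> - N (t (j - 1)) \<omega> = enat (k j)) =
          fact n / (\<Prod>j=1..m. fact (k j)) *
          (\<Prod>j=1..m. ((t j - t (j - 1)) / t m) ^ k j) *
          \<P>(\<omega> in R. N (t m) \<omega> = enat n)))"

end

theory Submission
  imports Defs
begin

text \<open>
  Under almost every \<open>P\<^sub>\<theta>\<close> the process is a renewal process, with survival function \<open>H\<^sub>\<theta> = 1 - F\<^sub>h\<^sub>(\<^sub>\<theta>\<^sub>)\<close>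
  and density \<open>f\<^sub>\<theta>\<close>. If the mixture is Markov, then given \<open>N\<^sub>t = 1\<close> the first arrival is independent of
  everything after \<open>t\<close>, so for \<open>X = H\<^sub>\<theta>(a) H\<^sub>\<theta>(b)\<close> (the event that the third and fourth gaps exceed \<open>a\<close> and
  \<open>b\<close>) the function \<open>E[X f\<^sub>\<theta>(w) H\<^sub>\<theta>(v)]\<close> factors as \<open>\<alpha>(w) \<beta>(w + v)\<close> for \<open>w < t \<le> w + v\<close>. Comparing the
  increments of the symmetric function \<open>E[X H\<^sub>\<theta>(w) H\<^sub>\<theta>(v)]\<close> over small rectangles forces \<open>\<alpha>(w) = \<alpha>(v)\<close>, and hence
  \<open>E[X H\<^sub>\<theta>(w) H\<^sub>\<theta>(v)]\<close> depends on \<open>w\<close>, \<open>v\<close> only through \<open>w + v\<close>. Taking \<open>X\<close> among the products themselves gives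
  \<open>E[(H\<^sub>\<theta>(w) H\<^sub>\<theta>(v) - H\<^sub>\<theta>(w') H\<^sub>\<theta>(v'))\<^sup>2] = 0\<close> whenever \<open>w + v = w' + v'\<close>: almost every \<open>H\<^sub>\<theta>\<close> is exponential and
  almost every \<open>P\<^sub>\<theta>\<close> makes the process Poisson, hence multinomial. The same argument with a one-point mixture
  handles the Markov property under a single \<open>P\<^sub>\<theta>\<close>. Conversely, the multinomial property is linear in the measure
  and implies the Markov property by cancelling factors.

  Passing from \<open>\<theta>\<close> to \<open>p\<^sub>h \<theta>\<close> needs the Borel measurability of the inverse of \<open>p\<^sub>h\<close>
  and of its range, that is, the Lusin--Souslin theorem.
\<close>

section \<open>Injective Borel images\<close>

text \<open>The Markov property is not linear in the measure: a mixture of Markov laws need not be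
  Markov, so it can be neither integrated nor disintegrated directly. Every consequence of it is
  therefore drawn through explicit exponential survival functions. Two obstacles shape the analysis.
  The survival functions are only once continuously differentiable, so the factorisation cannot be
  differentiated again to compare the two variables; increments over squares replace mixed second
  derivatives. And an identity between expectations of \<open>H \<theta> w * H \<theta> v\<close>
  says nothing about an individual \<theta>. Two further gaps are carried along as a weight because
  the square of a difference of two-fold products expands into four-fold products; this is why
  exactly four gaps enter. Identities that hold almost surely do so off a null set depending on the
  chosen times, so independence and the functional equation are first obtained for rational
  arguments. The exponential rate is recovered as the limit of the density at 0, which is what makes
  \<open>p\<^sub>h\<close> the natural new parameter.\<close>

definition proj_closed :: "'a::topological_space set \<Rightarrow> bool" where
  "proj_closed A \<longleftrightarrow> (\<exists>G :: ('a \<times> (nat \<Rightarrow> real)) set. closed G \<and> A = fst ` G)"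

lemma proj_closed_closed: "closed A \<Longrightarrow> proj_closed A"
  unfolding proj_closed_def by (rule exI[of _ "A \<times> UNIV"]) (auto intro: closed_Times)

text \<open>Selecting coordinates of a sequence is continuous in the product topology. With
  \<open>r\<close> a shift or a pairing, one auxiliary sequence can carry an index or countably many
  sequences.\<close>

lemma closed_vimage_prod_fun:
  fixes G :: "('a::topological_space \<times> (nat \<Rightarrow> real)) set"
  assumes "closed G"
  shows "closed {z. (fst z, \<lambda>k. snd z (r k)) \<in> G}"
proof -
  have "continuous_on UNIV (\<lambda>z. (fst z, \<lambda>k. snd z (r k)) :: 'a \<times> (nat \<Rightarrow> real))"
    by (intro continuous_on_Pair continuous_on_fst continuous_on_id
      continuous_on_coordinatewise_then_product
      continuous_on_compose2[OF continuous_on_product_coordinates continuous_on_snd]) auto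
  from closed_vimage[OF assms this] show ?thesis by (simp add: vimage_def)
qed

lemma proj_closed_UN:
  fixes A :: "nat \<Rightarrow> 'a::topological_space set"
  assumes "\<And>n. proj_closed (A n)"
  shows "proj_closed (\<Union>n. A n)"
proof -
  from assms obtain G :: "nat \<Rightarrow> ('a \<times> (nat \<Rightarrow> real)) set"
    where G: "\<And>n. closed (G n)" "\<And>n. A n = fst ` G n"
    unfolding proj_closed_def by metis
  \<comment> \<open>Coordinate 0 names the index of the union, the later ones carry the witness. An
    implication from equality with \<open>n\<close> would not be visibly closed; its failure is
    written as distance at least 1/2, which is equivalent for natural values.\<close>
  define H where "H = {z :: 'a \<times> (nat \<Rightarrow> real). snd z 0 \<in> \<nat>} \<inter>
     (\<Inter>n. {z. \<bar>snd z 0 - real n\<bar> \<ge> 1/2} \<union> {z. (fst z, \<lambda>k. snd z (Suc k)) \<in> G n})"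
  have c0: "continuous_on UNIV (\<lambda>z :: 'a \<times> (nat \<Rightarrow> real). snd z 0)"
    by (intro continuous_on_compose2[OF continuous_on_product_coordinates continuous_on_snd]) auto
  have "closed H" unfolding H_def
    by (intro closed_Int closed_INT ballI closed_Un closed_vimage_prod_fun G
        closed_Collect_le continuous_intros c0 
        closed_vimage[OF closed_Nats c0, unfolded vimage_def])
  moreover have "(\<Union>n. A n) = fst ` H"
  proof (intro equalityI subsetI)
    fix x assume "x \<in> (\<Union>n. A n)"
    then obtain n y where y: "(x, y) \<in> G n" by (auto simp: G)
    define y' where "y' = (\<lambda>k. case k of 0 \<Rightarrow> real n | Suc j \<Rightarrow> y j)"
    have "(x, y) \<notin> G m \<Longrightarrow> \<bar>real n - real m\<bar> \<ge> 1/2" for m using y by (cases m n rule: linorder_cases) auto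
    then have "(x, y') \<in> H" using y unfolding H_def y'_def by (auto simp: disj_commute)
    then show "x \<in> fst ` H" by force
  next
    fix x assume "x \<in> fst ` H"
    then obtain y where y: "(x, y) \<in> H" by auto
    then obtain n where "y 0 = real n" by (auto simp: H_def elim: Nats_cases)
    with y have "(x, \<lambda>k. y (Suc k)) \<in> G n" by (auto simp: H_def dest: spec[of _ n])
    then show "x \<in> (\<Union>n. A n)" by (force simp: G)
  qed
  ultimately show ?thesis unfolding proj_closed_def by blast
qed

lemma proj_closed_INT:
  fixes A :: "nat \<Rightarrow> 'a::topological_space set"
  assumes "\<And>n. proj_closed (A n)"
  shows "proj_closed (\<Inter>n. A n)"
proof -
  from assms obtain G :: "nat \<Rightarrow> ('a \<times> (nat \<Rightarrow> real)) set"
    where G: "\<And>n. closed (G n)" "\<And>n. A n = fst ` G n"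
    unfolding proj_closed_def by metis
  \<comment> \<open>\<open>prod_encode\<close> interleaves the witnesses for all \<open>A n\<close>
    in one sequence.\<close>
  define H where "H = (\<Inter>n. {z. (fst z, \<lambda>k. snd z (prod_encode (n, k))) \<in> G n})"
  have "closed H" unfolding H_def by (intro closed_INT ballI closed_vimage_prod_fun G)
  moreover have "(\<Inter>n. A n) = fst ` H"
  proof (intro equalityI subsetI)
    fix x assume "x \<in> (\<Inter>n. A n)"
    then have "\<forall>n. \<exists>y. (x, y) \<in> G n" by (force simp: G)
    then obtain y where y: "\<And>n. (x, y n) \<in> G n" by metis
    have "(x, \<lambda>i. case prod_decode i of (n, k) \<Rightarrow> y n k) \<in> H"
      using y by (simp add: H_def)
    then show "x \<in> fst ` H" by force
  next
    fix x assume "x \<in> fst ` H"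
    then show "x \<in> (\<Inter>n. A n)" by (force simp: G H_def)
  qed
  ultimately show ?thesis unfolding proj_closed_def by blast
qed

text \<open>Open sets of a metric space are countable unions of closed sets, here the points at
  distance at least 1/(n+1) from the complement.\<close>

lemma proj_closed_open:
  fixes A :: "'a::metric_space set"
  assumes "open A" shows "proj_closed A"
\<comment> \<open>The distance to an empty complement is 0 by convention, so the whole space is
  treated apart.\<close>
proof (cases "A = UNIV")
  case True then show ?thesis by (simp add: proj_closed_closed)
next
  case False
  then have ne: "- A \<noteq> {}" by auto
  have "A = (\<Union>n. {x. infdist x (- A) \<ge> 1 / real (Suc n)})"
  proof (intro equalityI subsetI)
    fix x assume "x \<in> A"
    with assms ne have "infdist x (- A) > 0"
      by (metis ComplD closed_Compl double_complement in_closed_iff_infdist_zero infdist_nonneg order_less_le)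
    then obtain n where "1 / real (Suc n) < infdist x (- A)"
      using nat_approx_posE by blast
    then show "x \<in> (\<Union>n. {x. infdist x (- A) \<ge> 1 / real (Suc n)})" by (auto intro: less_imp_le)
  next
    fix x assume "x \<in> (\<Union>n. {x. infdist x (- A) \<ge> 1 / real (Suc n)})"
    then obtain n where n: "infdist x (- A) \<ge> 1 / real (Suc n)" by auto
    have "0 < 1 / real (Suc n)" by simp
    with n have "infdist x (- A) \<noteq> 0" by linarith
    then show "x \<in> A" by (metis ComplI infdist_zero)
  qed
  also have "proj_closed \<dots>"
    by (intro proj_closed_UN proj_closed_closed closed_Collect_le continuous_intros)
  finally show ?thesis .
qed

text \<open>Projections of closed sets need not be closed under complement, so the induction carries
  \<open>A\<close> and its complement together; countable unions and intersections then exchange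
  roles. Real sequences serve as the fibre because they form a complete separable space.\<close>

lemma proj_closed_borel:
  fixes A :: "'a::metric_space set"
  assumes "A \<in> sets borel" shows "proj_closed A"
proof -
  have "A \<in> sigma_sets UNIV {S. open S}" using assms by (simp add: borel_def)
  then have "proj_closed A \<and> proj_closed (- A)"
  proof induction
    case (Basic a) then show ?case by (auto intro: proj_closed_open proj_closed_closed)
  next
    case Empty then show ?case by (auto intro: proj_closed_closed)
  next
    case (Compl a) then show ?case by (simp add: Compl_eq_Diff_UNIV[symmetric])
  next
    case (Union a) then show ?case by (auto intro!: proj_closed_UN proj_closed_INT simp: Compl_UN)
  qed
  then show ?thesis ..
qed

section \<open>Separation of disjoint images by Borel sets\<close>

definition borel_separated :: "'a::topological_space set \<Rightarrow> 'a set \<Rightarrow> bool" where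
  "borel_separated A B \<longleftrightarrow> (\<exists>E\<in>sets borel. A \<subseteq> E \<and> B \<inter> E = {})"

text \<open>The separator is the union over \<open>i\<close> of the intersections over
  \<open>j\<close> of the pairwise separators.\<close>

lemma borel_separated_UN:
  assumes "countable I" "countable J" "\<And>i j. i \<in> I \<Longrightarrow> j \<in> J \<Longrightarrow> borel_separated (A i) (B j)"
  shows "borel_separated (\<Union>i\<in>I. A i) (\<Union>j\<in>J. B j)"
proof -
  define E where "E = (\<lambda>i j. SOME E. E \<in> sets borel \<and> A i \<subseteq> E \<and> B j \<inter> E = {})"
  have E: "E i j \<in> sets borel \<and> A i \<subseteq> E i j \<and> B j \<inter> E i j = {}" if "i \<in> I" "j \<in> J" for i j
    using assms(3)[OF that] unfolding borel_separated_def E_def Bex_def by (rule someI_ex)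
  show ?thesis
  proof (cases "J = {}")
    case True then show ?thesis unfolding borel_separated_def by (auto intro!: bexI[of _ UNIV])
  next
    case False
    have "(\<Inter>j\<in>J. E i j) \<in> sets borel" if "i \<in> I" for i
      using E that assms by (intro sets.countable_INT'') auto
    then have "(\<Union>i\<in>I. \<Inter>j\<in>J. E i j) \<in> sets borel"
      using assms by (intro sets.countable_UN') auto
    moreover have "(\<Union>i\<in>I. A i) \<subseteq> (\<Union>i\<in>I. \<Inter>j\<in>J. E i j)" using E by blast
    moreover have "(\<Union>j\<in>J. B j) \<inter> (\<Union>i\<in>I. \<Inter>j\<in>J. E i j) = {}" using E by blast
    ultimately show ?thesis unfolding borel_separated_def by blast
  qed
qed

text \<open>Countably many balls of radius \<open>e\<close> cover the space; if all pairs of pieces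
  were separated, \<open>borel_separated_UN\<close> would separate the wholes.\<close>

lemma not_borel_separated_cball:
  fixes P P' :: "'a::{metric_space,second_countable_topology} set"
  assumes "\<not> borel_separated (f ` P) (f ` P')" "e > 0"
  shows "\<exists>z z'. \<not> borel_separated (f ` (P \<inter> cball z e)) (f ` (P' \<inter> cball z' e))"
proof (rule ccontr)
  assume *: "\<not> ?thesis"
  obtain D :: "'a set" where D: "countable D" "\<And>X. open X \<Longrightarrow> X \<noteq> {} \<Longrightarrow> \<exists>d\<in>D. d \<in> X"
    using countable_dense_setE by metis
  have cover: "\<exists>d\<in>D. x \<in> cball d e" for x
    using D(2)[of "ball x e"] assms(2) by (auto simp: dist_commute intro: less_imp_le)
  have "borel_separated (\<Union>z\<in>D. f ` (P \<inter> cball z e)) (\<Union>z\<in>D. f ` (P' \<inter> cball z e))"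
    using * by (intro borel_separated_UN D) auto
  moreover have "(\<Union>z\<in>D. f ` (Q \<inter> cball z e)) = f ` Q" for Q
    using cover by (auto simp del: mem_cball) blast
  ultimately show False using assms(1) by simp
qed

text \<open>Lusin's argument: an inseparable pair contains inseparable closed pairs of shrinking
  diameter. By completeness each side shrinks to a point; the two image points differ, and disjoint
  neighbourhoods of them separate the images at a late stage.\<close>

lemma borel_separated_image_closed:
  fixes G G' :: "'a::{complete_space,second_countable_topology} set" and f :: "'a \<Rightarrow> 'b::metric_space"
  assumes cl: "closed G" "closed G'" and f: "continuous_on UNIV f" and disj: "f ` G \<inter> f ` G' = {}"
  shows "borel_separated (f ` G) (f ` G')"
proof (rule ccontr)
  assume not_sep: "\<not> ?thesis"
  define bad where "bad = (\<lambda>R :: 'a set \<times> 'a set. closed (fst R) \<and> closed (snd R) \<and>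
     \<not> borel_separated (f ` fst R) (f ` snd R))"
  define small where "small = (\<lambda>(n::nat) (R :: 'a set \<times> 'a set) (R' :: 'a set \<times> 'a set). fst R' \<subseteq> fst R \<and> snd R' \<subseteq> snd R \<and>
     (\<exists>z z'. fst R' \<subseteq> cball z ((1/2)^n) \<and> snd R' \<subseteq> cball z' ((1/2)^n)))"
  have "\<exists>R. (\<forall>n. bad (R n)) \<and> (R 0 = (G, G')) \<and> (\<forall>n. small n (R n) (R (Suc n)))"
  proof -
    \<comment> \<open>Dependent choice prescribes only a property of each stage, so the clause at
      \<open>n = 0\<close> fixes the starting pair.\<close>
    have "\<exists>R. (\<forall>n. (bad (R n) \<and> (n = 0 \<longrightarrow> R n = (G, G'))) \<and> small n (R n) (R (Suc n)))"
    proof (intro dependent_nat_choice)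
      show "\<exists>R. bad R \<and> ((0::nat) = 0 \<longrightarrow> R = (G, G'))" using cl not_sep by (auto simp: bad_def)
    next
      fix R and n :: nat assume "bad R \<and> (n = 0 \<longrightarrow> R = (G, G'))"
      then have R: "bad R" by simp
      then obtain z z' where z: "\<not> borel_separated (f ` (fst R \<inter> cball z ((1/2)^n))) (f ` (snd R \<inter> cball z' ((1/2)^n)))"
        using not_borel_separated_cball[of f "fst R" "snd R" "(1/2)^n"] by (auto simp: bad_def)
      show "\<exists>R'. (bad R' \<and> (Suc n = 0 \<longrightarrow> R' = (G, G'))) \<and> small n R R'"
        by (rule exI[of _ "(fst R \<inter> cball z ((1/2)^n), snd R \<inter> cball z' ((1/2)^n))"])
          (use R z in \<open>auto simp: bad_def small_def simp del: mem_cball intro: closed_Int\<close>)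
    qed
    then show ?thesis by blast
  qed
  then obtain R where R: "\<And>n. bad (R n)" "R 0 = (G, G')" "\<And>n. small n (R n) (R (Suc n))" by blast
  have anti1: "fst (R n) \<subseteq> fst (R m)" and anti2: "snd (R n) \<subseteq> snd (R m)" if "m \<le> n" for m n
    using lift_Suc_antimono_le[of "\<lambda>n. fst (R n)" m n] lift_Suc_antimono_le[of "\<lambda>n. snd (R n)" m n] R(3) that
    by (auto simp: small_def)
  have diam: "\<exists>n. (\<forall>x\<in>fst (R n). \<forall>y\<in>fst (R n). dist x y < e) \<and> (\<forall>x\<in>snd (R n). \<forall>y\<in>snd (R n). dist x y < e)"
    if "e > 0" for e
  proof -
    obtain n where n: "(1/2)^n < e / 2" using real_arch_pow_inv[of "e/2" "1/2"] \<open>e > 0\<close> by auto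
    have "dist x y < e" if "x \<in> cball z ((1/2)^n)" "y \<in> cball z ((1/2)^n)" for x y z :: 'a
      using that dist_triangle[of x y z] n by (simp add: dist_commute)
    then show ?thesis using R(3)[of n] unfolding small_def
      by (intro exI[of _ "Suc n"]) (meson subsetD)
  qed
  \<comment> \<open>An empty left piece is separated by the empty set, an empty right piece by the
    whole space.\<close>
  have ne: "fst (R n) \<noteq> {}" "snd (R n) \<noteq> {}" for n
    using R(1)[of n] unfolding bad_def borel_separated_def
    by (auto intro!: bexI[of _ "{}::'b set"] dest: bspec[of _ _ "UNIV::'b set"])
  obtain x where x: "\<And>n. x \<in> fst (R n)"
    by (rule decreasing_closed_nest[of "\<lambda>n. fst (R n)"]) (use R(1) ne anti1 diam in \<open>(simp add: bad_def; fail | blast)+\<close>)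
  obtain x' where x': "\<And>n. x' \<in> snd (R n)"
    by (rule decreasing_closed_nest[of "\<lambda>n. snd (R n)"]) (use R(1) ne anti2 diam in \<open>(simp add: bad_def; fail | blast)+\<close>)
  have "f x \<noteq> f x'" using disj x[of 0] x'[of 0] R(2) by auto
  then obtain U V where UV: "open U" "open V" "f x \<in> U" "f x' \<in> V" "U \<inter> V = {}"
    using hausdorff by metis
  have "open (f -` U)" "open (f -` V)"
    using f UV by (auto intro: open_vimage)
  then obtain e e' where e: "e > 0" "ball x e \<subseteq> f -` U" "e' > 0" "ball x' e' \<subseteq> f -` V"
    using UV by (meson openE vimageI)
  obtain n where n: "\<And>y. y \<in> fst (R n) \<Longrightarrow> dist x y < min e e'" "\<And>y. y \<in> snd (R n) \<Longrightarrow> dist x' y < min e e'"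
    using diam[of "min e e'"] e x x' by (metis min_less_iff_conj)
  have "f ` fst (R n) \<subseteq> U" "f ` snd (R n) \<subseteq> V"
    using n e by fastforce+
  then have "borel_separated (f ` fst (R n)) (f ` snd (R n))"
    unfolding borel_separated_def using UV by (intro bexI[of _ U]) auto
  then show False using R(1)[of n] by (simp add: bad_def)
qed

text \<open>A Borel set is the projection of a closed set in a larger complete space, and
  \<open>f\<close> composed with that projection is still continuous.\<close>

lemma borel_separated_image_borel:
  fixes A B :: "'a::{complete_space,second_countable_topology} set" and f :: "'a \<Rightarrow> 'b::metric_space"
  assumes "A \<in> sets borel" "B \<in> sets borel" "continuous_on UNIV f" "f ` A \<inter> f ` B = {}"
  shows "borel_separated (f ` A) (f ` B)"
proof -
  from proj_closed_borel[OF assms(1)] obtain G :: "('a \<times> (nat \<Rightarrow> real)) set"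
    where G: "closed G" "A = fst ` G" unfolding proj_closed_def by blast
  from proj_closed_borel[OF assms(2)] obtain G' :: "('a \<times> (nat \<Rightarrow> real)) set"
    where G': "closed G'" "B = fst ` G'" unfolding proj_closed_def by blast
  have "continuous_on UNIV (\<lambda>z :: 'a \<times> (nat \<Rightarrow> real). f (fst z))"
    by (intro continuous_on_compose2[OF assms(3)] continuous_intros) auto
  then have "borel_separated ((\<lambda>z. f (fst z)) ` G) ((\<lambda>z. f (fst z)) ` G')"
    using assms(4) by (intro borel_separated_image_closed[OF G(1) G'(1)]) (auto simp: G(2) G'(2))
  then show ?thesis by (simp add: G G' image_image)
qed

text \<open>For a merely measurable \<open>p\<close>, the graph over a Borel set is Borel, and the
  image under \<open>p\<close> is the image of the graph under the continuous second
  projection.\<close>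

lemma borel_separated_image_measurable:
  fixes p :: "'a::euclidean_space \<Rightarrow> real"
  assumes S: "S \<in> sets borel" and p: "p \<in> borel_measurable (restrict_space borel S)"
    and A: "A \<in> sets borel" "A \<subseteq> S" and B: "B \<in> sets borel" "B \<subseteq> S" and "p ` A \<inter> p ` B = {}"
  shows "borel_separated (p ` A) (p ` B)"
proof -
  have graph: "{(x, p x) | x. x \<in> C} \<in> sets borel" if C: "C \<in> sets borel" "C \<subseteq> S" for C
  proof -
    define p' where "p' = (\<lambda>x. if x \<in> S then p x else 0)"
    have "p' \<in> borel_measurable borel" unfolding p'_def
      using p S by (subst (asm) measurable_restrict_space_iff[where c=0]) auto
    note [measurable] = this C(1)
    have "{z \<in> space (borel \<Otimes>\<^sub>M borel :: ('a \<times> real) measure). fst z \<in> C \<and> p' (fst z) = snd z}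
        \<in> sets (borel \<Otimes>\<^sub>M borel)"
      by measurable
    also have "sets (borel \<Otimes>\<^sub>M borel :: ('a \<times> real) measure) = sets borel" by (simp only: borel_prod)
    also have "{z \<in> space (borel \<Otimes>\<^sub>M borel :: ('a \<times> real) measure). fst z \<in> C \<and> p' (fst z) = snd z} = {(x, p x) | x. x \<in> C}"
      using C by (auto simp: p'_def space_pair_measure)
    finally show ?thesis .
  qed
  have im: "snd ` {(x, p x) | x. x \<in> C} = p ` C" for C by force
  show ?thesis
    using borel_separated_image_borel[OF graph[OF A] graph[OF B], of snd] assms
    by (simp add: im continuous_on_snd)
qed

text \<open>
  By separation, the sets \<open>p ` {x \<in> S. x \<bullet> b \<le> r}\<close> are traces of Borel sets on \<open>p ` S\<close>. The coordinates of
  the inverse are infima over rational \<open>r\<close> and so extend to Borel functions on the whole line; \<open>p ` S\<close> is then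
  the set of all \<open>y\<close> with \<open>q y \<in> S\<close> and \<open>p (q y) = y\<close>.
\<close>

lemma borel_inverse_of_injective:
  fixes p :: "'a::euclidean_space \<Rightarrow> real"
  assumes S: "S \<in> sets borel" and p: "p \<in> borel_measurable (restrict_space borel S)"
    and inj: "inj_on p S"
  obtains q where "q \<in> borel_measurable borel" "\<And>x. x \<in> S \<Longrightarrow> q (p x) = x" "p ` S \<in> sets borel"
proof -
  have "\<exists>E\<in>sets borel. \<forall>x\<in>S. p x \<in> E \<longleftrightarrow> x \<bullet> b \<le> r" for b r
  proof -
    define A where "A = S \<inter> {x. x \<bullet> b \<le> r}"
    define B where "B = S \<inter> {x. \<not> x \<bullet> b \<le> r}"
    have "A \<in> sets borel" "B \<in> sets borel" using S by (auto simp: A_def B_def)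
    moreover have "p ` A \<inter> p ` B = {}" using inj by (auto simp: A_def B_def inj_on_def)
    ultimately have "borel_separated (p ` A) (p ` B)"
      by (intro borel_separated_image_measurable[OF S p]) (auto simp: A_def B_def)
    then show ?thesis unfolding borel_separated_def A_def B_def by (elim bexE) (rule bexI, auto)
  qed
  then obtain E where E: "\<And>b r. E b r \<in> sets borel" "\<And>b r x. x \<in> S \<Longrightarrow> p x \<in> E b r \<longleftrightarrow> x \<bullet> b \<le> r"
    by metis
  define q' where "q' = (\<lambda>b y. real_of_ereal (INF r\<in>\<rat>. if y \<in> E b r then ereal r else \<infinity>))"
  have q': "q' b (p x) = x \<bullet> b" if "x \<in> S" for b x
  proof -
    have "(INF r\<in>\<rat>. if p x \<in> E b r then ereal r else \<infinity>) = ereal (x \<bullet> b)"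
    proof (rule antisym)
      show "ereal (x \<bullet> b) \<le> (INF r\<in>\<rat>. if p x \<in> E b r then ereal r else \<infinity>)"
        using that by (intro INF_greatest) (auto simp: E)
      show "(INF r\<in>\<rat>. if p x \<in> E b r then ereal r else \<infinity>) \<le> ereal (x \<bullet> b)"
      proof (rule ereal_le_epsilon2)
        fix e :: real assume "e > 0"
        then obtain r where r: "r \<in> \<rat>" "x \<bullet> b < r" "r < x \<bullet> b + e"
          using Rats_dense_in_real[of "x \<bullet> b" "x \<bullet> b + e"] by auto
        then show "(INF r\<in>\<rat>. if p x \<in> E b r then ereal r else \<infinity>) \<le> ereal (x \<bullet> b) + ereal e"
          using that by (intro INF_lower2[of r]) (auto simp: E)
      qed
    qed
    then show ?thesis by (simp add: q'_def)
  qed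
  have [measurable]: "q' b \<in> borel_measurable borel" for b
    unfolding q'_def using E(1)
    by (intro borel_measurable_real_of_ereal borel_measurable_INF countable_rat measurable_If_set) auto
  define q where "q = (\<lambda>y. \<Sum>b\<in>Basis. q' b y *\<^sub>R b)"
  have q_meas[measurable]: "q \<in> borel_measurable borel" unfolding q_def by measurable
  have q: "q (p x) = x" if "x \<in> S" for x
    unfolding q_def using that by (simp add: q' euclidean_representation)
  define p' where "p' = (\<lambda>x. if x \<in> S then p x else 0)"
  have "p' \<in> borel_measurable borel" unfolding p'_def
    using p S by (subst (asm) measurable_restrict_space_iff[where c=0]) auto
  note [measurable] = this S
  have "{y. q y \<in> S \<and> p' (q y) = y} \<in> sets borel" by measurable
  also have "{y. q y \<in> S \<and> p' (q y) = y} = p ` S" using q by (force simp: p'_def)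
  finally show ?thesis using that q q_meas by blast
qed

section \<open>Paths of counting processes and the multinomial property\<close>

lemma nat_interval_mono:
  fixes t :: "nat \<Rightarrow> 'b::preorder"
  assumes "i \<le> j" "\<And>k. i \<le> k \<Longrightarrow> k < j \<Longrightarrow> t k \<le> t (Suc k)"
  shows "t i \<le> t j"
  using assms by (induction j rule: nat_induct_at_least) (auto intro: order_trans)

section \<open>Arrival times along one path\<close>

context
  fixes P :: "'a measure" and N :: "real \<Rightarrow> 'a \<Rightarrow> enat" and \<omega> :: 'a
  assumes N: "counting_process P N" and \<omega>: "\<omega> \<in> space P"
begin

lemma counting_mono: "0 \<le> s \<Longrightarrow> s \<le> t \<Longrightarrow> N s \<omega> \<le> N t \<omega>"
  using N \<omega> by (auto simp: counting_process_def mono_on_def)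

lemma counting_0: "N 0 \<omega> = 0"
  using N \<omega> by (auto simp: counting_process_def)

text \<open>The infimum in \<open>arrival\<close> ranges over times with count equal to
  \<open>n\<close>, so it must be excluded that \<open>n\<close> is skipped. The first time \<tau>
  with count at least \<open>n\<close> exists because paths tend to infinity; right-continuity gives
  count at least \<open>n\<close> at \<tau> itself, and the jump bound prevents an
  overshoot.\<close>

lemma arrival_hit:
  assumes "n \<ge> 1"
  shows "0 < arrival N n \<omega>" "N (arrival N n \<omega>) \<omega> = enat n"
    "\<And>t. 0 \<le> t \<Longrightarrow> t < arrival N n \<omega> \<Longrightarrow> N t \<omega> < enat n"
proof -
  define A where "A = {t. 0 \<le> t \<and> enat n \<le> N t \<omega>}"
  define \<tau> where "\<tau> = Inf A"
  have lim: "((\<lambda>t. N t \<omega>) \<longlongrightarrow> \<infinity>) at_top" using N \<omega> by (auto simp: counting_process_def)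
  then have "\<forall>\<^sub>F t in at_top. N t \<omega> > enat n" by (rule order_tendstoD) auto
  then obtain t0 where "\<And>t. t \<ge> t0 \<Longrightarrow> N t \<omega> > enat n" by (auto simp: eventually_at_top_linorder)
  then have "max 0 t0 \<in> A" by (auto simp: A_def intro: less_imp_le)
  then have ne: "A \<noteq> {}" by auto
  have bdd: "bdd_below A" by (auto simp: A_def bdd_below_def)
  have "\<tau> \<ge> 0" unfolding \<tau>_def using ne by (intro cInf_greatest) (auto simp: A_def)
  have before: "N t \<omega> < enat n" if "0 \<le> t" "t < \<tau>" for t
    using that cInf_lower[OF _ bdd, of t] by (force simp: A_def \<tau>_def not_le[symmetric])
  have hit: "enat n \<le> N \<tau> \<omega>"
  proof (rule ccontr)
    assume "\<not> ?thesis"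
    moreover have "((\<lambda>s. N s \<omega>) \<longlongrightarrow> N \<tau> \<omega>) (at_right \<tau>)"
      using N \<omega> \<open>\<tau> \<ge> 0\<close> by (auto simp: counting_process_def continuous_within)
    ultimately have "\<forall>\<^sub>F s in at_right \<tau>. N s \<omega> < enat n" by (intro order_tendstoD(2)) auto
    then obtain b where b: "b > \<tau>" "\<And>s. \<tau> < s \<Longrightarrow> s < b \<Longrightarrow> N s \<omega> < enat n"
      by (auto simp: eventually_at_right_field)
    have "s \<ge> b" if "s \<in> A" for s
    proof (rule ccontr)
      assume "\<not> s \<ge> b"
      moreover have "\<tau> \<le> s" using cInf_lower[OF that bdd] by (simp add: \<tau>_def)
      ultimately show False using b(2)[of s] that \<open>\<not> enat n \<le> N \<tau> \<omega>\<close>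
        by (cases "s = \<tau>") (auto simp: A_def)
    qed
    then have "b \<le> \<tau>" unfolding \<tau>_def using ne by (intro cInf_greatest)
    then show False using b(1) by simp
  qed
  have "\<tau> \<noteq> 0" using hit counting_0 assms by (auto simp: zero_enat_def)
  then have "\<tau> > 0" using \<open>\<tau> \<ge> 0\<close> by simp
  \<comment> \<open>Before \<tau> the count is at most \<open>n - 1\<close>, hence so is the left
    limit.\<close>
  have "(SUP s\<in>{0..<\<tau>}. N s \<omega>) \<le> enat (n - 1)"
    using before assms by (intro SUP_least) (force simp: less_enat_def split: enat.splits)
  moreover have "N \<tau> \<omega> \<le> (SUP s\<in>{0..<\<tau>}. N s \<omega>) + 1"
    using N \<omega> \<open>\<tau> > 0\<close> by (auto simp: counting_process_def)
  ultimately have "N \<tau> \<omega> \<le> enat (n - 1) + 1" by (meson add_right_mono order_trans)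
  then have eq: "N \<tau> \<omega> = enat n" using hit assms by (auto simp: one_enat_def)
  have "arrival N n \<omega> = Inf {t. 0 \<le> t \<and> N t \<omega> = enat n}" using assms by (simp add: arrival_def)
  also have "\<dots> = \<tau>"
  proof (intro cInf_eq_minimum)
    show "\<tau> \<in> {t. 0 \<le> t \<and> N t \<omega> = enat n}" using eq \<open>\<tau> \<ge> 0\<close> by simp
    show "\<tau> \<le> t" if "t \<in> {t. 0 \<le> t \<and> N t \<omega> = enat n}" for t
      using before[of t] that by force
  qed
  finally have "arrival N n \<omega> = \<tau>" .
  then show "0 < arrival N n \<omega>" "N (arrival N n \<omega>) \<omega> = enat n"
    "\<And>t. 0 \<le> t \<Longrightarrow> t < arrival N n \<omega> \<Longrightarrow> N t \<omega> < enat n"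
    using \<open>\<tau> > 0\<close> eq before by auto
qed

lemma arrival_nonneg: "0 \<le> arrival N n \<omega>"
  using arrival_hit(1)[of n] by (cases "n = 0") (auto simp: arrival_def)

lemma arrival_le_iff:
  assumes "0 \<le> t" shows "arrival N n \<omega> \<le> t \<longleftrightarrow> enat n \<le> N t \<omega>"
proof (cases "n = 0")
  case True then show ?thesis using assms by (simp add: arrival_def zero_enat_def[symmetric])
next
  case False
  then have n: "n \<ge> 1" by simp
  show ?thesis
    using arrival_hit[OF n] counting_mono[of "arrival N n \<omega>" t] assms
    by (metis less_imp_le not_le)
qed

lemma counting_eq_iff:
  assumes "0 \<le> t"
  shows "N t \<omega> = enat n \<longleftrightarrow> arrival N n \<omega> \<le> t \<and> t < arrival N (Suc n) \<omega>"
proof -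
  have "N t \<omega> = enat n \<longleftrightarrow> enat n \<le> N t \<omega> \<and> \<not> enat (Suc n) \<le> N t \<omega>"
    by (cases "N t \<omega>") auto
  then show ?thesis
    using arrival_le_iff[OF assms, of n] arrival_le_iff[OF assms, of "Suc n"] by (simp add: not_le[symmetric])
qed

lemma arrival_less_Suc: "arrival N n \<omega> < arrival N (Suc n) \<omega>"
proof (cases "n = 0")
  case True then show ?thesis using arrival_hit(1)[of 1] by (simp add: arrival_def)
next
  case False
  then have "N (arrival N n \<omega>) \<omega> = enat n" using arrival_hit(2)[of n] by simp
  then show ?thesis using counting_eq_iff[OF arrival_nonneg] by blast
qed

lemma interarrival_pos: "n \<ge> 1 \<Longrightarrow> 0 < interarrival N n \<omega>"
  using arrival_less_Suc[of "n - 1"] by (simp add: interarrival_def)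

lemma arrival_eq_sum: "arrival N n \<omega> = (\<Sum>i=1..n. interarrival N i \<omega>)"
  by (induction n) (auto simp: arrival_def[of N 0] interarrival_def)

lemma arrival_mono: "m \<le> n \<Longrightarrow> arrival N m \<omega> \<le> arrival N n \<omega>"
  by (rule lift_Suc_mono_le[of "\<lambda>n. arrival N n \<omega>"]) (auto intro: less_imp_le arrival_less_Suc)

text \<open>Starting from count 0, the earlier states are known to be finite and the path is
  monotone, so subtraction in \<open>enat\<close> loses no information at the next step.\<close>

lemma increments_eq_iff:
  assumes "t 0 = 0" "\<And>j. j < m \<Longrightarrow> t j \<le> t (Suc j)" "n 0 = 0" "\<And>j. j < m \<Longrightarrow> n j \<le> n (Suc j)"
  shows "(\<forall>j\<in>{1..m}. N (t j) \<omega> - N (t (j - 1)) \<omega> = enat (n j - n (j - 1)))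
     \<longleftrightarrow> (\<forall>j\<in>{1..m}. N (t j) \<omega> = enat (n j))"
  using assms(2,4)
proof (induction m)
  case (Suc m)
  have IH: "(\<forall>j\<in>{1..m}. N (t j) \<omega> - N (t (j - 1)) \<omega> = enat (n j - n (j - 1)))
     \<longleftrightarrow> (\<forall>j\<in>{1..m}. N (t j) \<omega> = enat (n j))" using Suc by simp
  have "N (t (Suc m)) \<omega> - N (t m) \<omega> = enat (n (Suc m) - n m) \<longleftrightarrow> N (t (Suc m)) \<omega> = enat (n (Suc m))"
    if *: "\<forall>j\<in>{1..m}. N (t j) \<omega> = enat (n j)"
  proof -
    have t: "t j \<ge> 0" if "j \<le> m" for j
      using that by (induction j) (use assms(1) Suc.prems(1) in \<open>auto intro: order_trans\<close>)
    have eq: "N (t m) \<omega> = enat (n m)"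
      using * assms(1,3) counting_0 by (cases "m = 0") (auto simp: zero_enat_def)
    have "N (t m) \<omega> \<le> N (t (Suc m)) \<omega>" using t[of m] Suc.prems(1)[of m] by (intro counting_mono) auto
    then show ?thesis using eq Suc.prems(2)[of m] by (cases "N (t (Suc m)) \<omega>") auto
  qed
  then show ?case using IH by (auto simp: atLeastAtMostSuc_conv)
qed simp

end

lemma counting_process_measurable:
  "counting_process P N \<Longrightarrow> 0 \<le> t \<Longrightarrow> N t \<in> measurable P (count_space UNIV)"
  by (auto simp: counting_process_def)

lemma counting_event_measurable:
  assumes "counting_process P N" "\<And>j. j \<in> J \<Longrightarrow> 0 \<le> t j" "finite J"
  shows "{\<omega>\<in>space P. \<forall>j\<in>J. N (t j) \<omega> = n j} \<in> sets P"
proof -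
  have "{\<omega>\<in>space P. N (t j) \<omega> = n j} \<in> sets P" if "j \<in> J" for j
  proof -
    have "N (t j) -` {n j} \<inter> space P \<in> sets P"
      using counting_process_measurable[OF assms(1) assms(2)[OF that]] by (rule measurable_sets) auto
    also have "N (t j) -` {n j} \<inter> space P = {\<omega>\<in>space P. N (t j) \<omega> = n j}" by auto
    finally show ?thesis .
  qed
  then show ?thesis using assms(3) by (intro sets.sets_Collect_finite_All) auto
qed

lemma borel_measurable_arrival:
  assumes "counting_process P N"
  shows "arrival N n \<in> borel_measurable P"
proof (rule borel_measurable_iff_le[THEN iffD2], rule allI)
  fix t :: real
  show "{\<omega> \<in> space P. arrival N n \<omega> \<le> t} \<in> sets P"
  proof (cases "t \<ge> 0")
    case True
    have "N t -` {enat n..} \<inter> space P \<in> sets P"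
      using counting_process_measurable[OF assms True] by (rule measurable_sets) auto
    also have "N t -` {enat n..} \<inter> space P = {\<omega> \<in> space P. arrival N n \<omega> \<le> t}"
      using arrival_le_iff[OF assms _ True] by auto
    finally show ?thesis .
  next
    case False
    then have "{\<omega> \<in> space P. arrival N n \<omega> \<le> t} = {}"
      using order_trans[OF arrival_nonneg[OF assms]] by blast
    then show ?thesis by (simp only: sets.empty_sets)
  qed
qed

lemma borel_measurable_interarrival:
  assumes "counting_process P N"
  shows "interarrival N n \<in> borel_measurable P"
  unfolding interarrival_def[abs_def]
  using borel_measurable_arrival[OF assms] by (intro borel_measurable_diff)

lemma counting_process_cong_sets:
  assumes "counting_process P N" "sets Q = sets P"
  shows "counting_process Q N"
  using assms(1) unfolding counting_process_def measurable_cong_sets[OF assms(2) refl]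
    sets_eq_imp_space_eq[OF assms(2)] .

section \<open>From the multinomial to the Markov property\<close>

lemma multinomial_propertyD:
  fixes t :: "nat \<Rightarrow> real" and n :: "nat \<Rightarrow> nat"
  assumes "multinomial_property R N" "counting_process R N" "m \<ge> 1"
    and t: "t 0 = 0" "\<And>j. j < m \<Longrightarrow> t j < t (Suc j)"
    and n: "n 0 = 0" "\<And>j. j < m \<Longrightarrow> n j \<le> n (Suc j)"
  shows "measure R {\<omega>\<in>space R. \<forall>j\<in>{1..m}. N (t j) \<omega> = enat (n j)} =
    fact (n m) / (\<Prod>j=1..m. fact (n j - n (j - 1))) *
      ((\<Prod>j=1..m. (t j - t (j - 1)) ^ (n j - n (j - 1))) / t m ^ n m) *
      measure R {\<omega>\<in>space R. N (t m) \<omega> = enat (n m)}"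
proof -
  have sum: "(\<Sum>j=1..k. n j - n (j - 1)) = n k" if "k \<le> m" for k
    using that by (induction k) (use n in \<open>auto simp: \<close>)
  have ev: "{\<omega>\<in>space R. \<forall>j\<in>{1..m}. N (t j) \<omega> - N (t (j - 1)) \<omega> = enat (n j - n (j - 1))}
     = {\<omega>\<in>space R. \<forall>j\<in>{1..m}. N (t j) \<omega> = enat (n j)}"
    using increments_eq_iff[OF assms(2), of _ t m n] t n by (auto intro: less_imp_le)
  have "(\<Prod>j=1..m. ((t j - t (j - 1)) / t m) ^ (n j - n (j - 1))) =
     (\<Prod>j=1..m. (t j - t (j - 1)) ^ (n j - n (j - 1))) / t m ^ n m"
    using sum[of m] by (simp add: power_divide prod_dividef power_sum[symmetric] del: One_nat_def)
  then show ?thesis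
    using assms(1)[unfolded multinomial_property_def, rule_format, of m t "\<lambda>j. n j - n (j - 1)"] assms(3) t
    by (simp only: ev sum Let_def order_refl)
qed

text \<open>For fixed present state, the multinomial weight factors into a term of the past and a
  term of the last step. In the cross-multiplied Markov identity all these terms cancel.\<close>

lemma multinomial_imp_markov:
  assumes "prob_space R" and mult: "multinomial_property R N" and N: "counting_process R N"
  shows "markov_property R N"
  unfolding markov_property_def
proof (intro allI impI)
  fix m :: nat and t :: "nat \<Rightarrow> real" and n :: "nat \<Rightarrow> nat"
  assume m: "1 \<le> m" and t1: "0 < t 1" and tS: "\<forall>j\<in>{1..m}. t j < t (Suc j)"
    and pos: "0 < measure R {\<omega>\<in>space R. \<forall>j\<in>{1..m}. N (t j) \<omega> = enat (n j)}"
  interpret prob_space R by fact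
  define past where "past = {\<omega>\<in>space R. \<forall>j\<in>{1..m}. N (t j) \<omega> = enat (n j)}"
  define now where "now = {\<omega>\<in>space R. N (t m) \<omega> = enat (n m)}"
  define nxt where "nxt = {\<omega>\<in>space R. N (t (Suc m)) \<omega> = enat (n (Suc m))}"
  have tpos: "0 < t j" if "1 \<le> j" "j \<le> Suc m" for j
    by (rule less_le_trans[OF t1 nat_interval_mono[of 1 j t]]) (use that tS in \<open>auto intro: less_imp_le\<close>)
  \<comment> \<open>Positive probability supplies a path through all prescribed states, which are
    therefore nondecreasing.\<close>
  obtain \<omega>0 where \<omega>0: "\<omega>0 \<in> past" using pos unfolding past_def[symmetric] by (metis all_not_in_conv less_irrefl measure_empty)
  have nmono: "n j \<le> n (Suc j)" if "1 \<le> j" "j < m" for j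
  proof -
    have "N (t j) \<omega>0 \<le> N (t (Suc j)) \<omega>0"
      using \<omega>0 that tpos[of j] tS by (intro counting_mono[OF N]) (auto simp: past_def intro: less_imp_le)
    then show ?thesis using \<omega>0 that by (auto simp: past_def)
  qed
  have sub: "past \<subseteq> now" using m by (auto simp: past_def now_def)
  have now_sets: "now \<in> sets R"
    using counting_event_measurable[OF N, of "{m}" t "\<lambda>j. enat (n j)"] tpos[of m] m by (auto simp: now_def intro: less_imp_le)
  have "prob past > 0" using pos by (simp add: past_def)
  moreover have "prob past \<le> prob now" using sub now_sets by (rule finite_measure_mono)
  ultimately have now_pos: "prob now > 0" by linarith
  have "prob (past \<inter> nxt) * prob now = prob past * prob (now \<inter> nxt)"
  \<comment> \<open>A next state below the present one makes both joint events empty.\<close>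
  proof (cases "n m \<le> n (Suc m)")
    case False
    have "now \<inter> nxt = {}"
    proof (rule equals0I)
      fix \<omega> assume \<omega>: "\<omega> \<in> now \<inter> nxt"
      then have "N (t m) \<omega> \<le> N (t (Suc m)) \<omega>"
        using tpos[of m] tS m by (intro counting_mono[OF N]) (auto simp: now_def intro: less_imp_le)
      then show False using False \<omega> by (auto simp: now_def nxt_def)
    qed
    moreover then have "past \<inter> nxt = {}" using sub by auto
    ultimately show ?thesis by (simp only: measure_empty mult_zero_left mult_zero_right)
  next
    case nS: True
    \<comment> \<open>The Markov property leaves index 0 free, while the multinomial property starts
      at time 0 with count 0.\<close>
    define t' where "t' = t(0 := 0)"
    define n' where "n' = n(0 := 0)"
    \<comment> \<open>The two-step scheme \<open>0 < t m < t (Suc m)\<close> expresses the joint law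
      of present and next state.\<close>
    define u where "u = (\<lambda>j::nat. if j = 0 then 0 else if j = 1 then t m else t (Suc m))"
    define l where "l = (\<lambda>j::nat. if j = 0 then 0 else if j = 1 then n m else n (Suc m))"
    have t': "t' 0 = 0" "\<And>j. j < Suc m \<Longrightarrow> t' j < t' (Suc j)" using t1 tS by (auto simp: t'_def)
    have n': "n' 0 = 0" "\<And>j. j < Suc m \<Longrightarrow> n' j \<le> n' (Suc j)" using nmono nS m
      by (auto simp: n'_def less_Suc_eq)
    have u: "u 0 = 0" "\<And>j. j < 2 \<Longrightarrow> u j < u (Suc j)" using tS tpos[of m] m
      by (auto simp: u_def less_2_cases_iff)
    have l: "l 0 = 0" "\<And>j. j < 2 \<Longrightarrow> l j \<le> l (Suc j)" using nS
      by (auto simp: l_def less_2_cases_iff)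
    have past: "past = {\<omega>\<in>space R. \<forall>j\<in>{1..m}. N (t' j) \<omega> = enat (n' j)}"
      by (auto simp: past_def t'_def n'_def)
    have past_nxt: "past \<inter> nxt = {\<omega>\<in>space R. \<forall>j\<in>{1..Suc m}. N (t' j) \<omega> = enat (n' j)}"
      by (auto simp: past_def nxt_def t'_def n'_def atLeastAtMostSuc_conv)
    have now_nxt: "now \<inter> nxt = {\<omega>\<in>space R. \<forall>j\<in>{1..2}. N (u j) \<omega> = enat (l j)}"
      by (auto simp: now_def nxt_def u_def l_def numeral_2_eq_2 atLeastAtMostSuc_conv)
    define F where "F = (\<Prod>j=1..m. fact (n' j - n' (j - 1)) :: real)"
    define G where "G = (\<Prod>j=1..m. (t' j - t' (j - 1)) ^ (n' j - n' (j - 1)))"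
    have now': "{\<omega>\<in>space R. N (t' m) \<omega> = enat (n' m)} = now" using m by (auto simp: now_def t'_def n'_def)
    have nxt': "{\<omega>\<in>space R. N (t' (Suc m)) \<omega> = enat (n' (Suc m))} = nxt"
       "{\<omega>\<in>space R. N (u 2) \<omega> = enat (l 2)} = nxt"
      by (auto simp: nxt_def t'_def n'_def u_def l_def)
    have Fpos: "F \<noteq> 0" unfolding F_def by (simp add: prod_zero_iff)
    have 1: "prob past = fact (n m) / F * (G / t m ^ n m) * prob now"
      using multinomial_propertyD[OF mult N, of m t' n', folded past F_def G_def] t' n' m
      by (simp add: now') (simp add: t'_def n'_def)
    have pF: "(\<Prod>j=1..Suc m. fact (n' j - n' (j - 1)) :: real) = F * fact (n (Suc m) - n m)"
      using m by (simp add: F_def n'_def)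
    have pG: "(\<Prod>j=1..Suc m. (t' j - t' (j - 1)) ^ (n' j - n' (j - 1))) =
        G * (t (Suc m) - t m) ^ (n (Suc m) - n m)"
      using m by (simp add: G_def n'_def t'_def)
    have t'S: "t' (Suc m) = t (Suc m)" "n' (Suc m) = n (Suc m)" by (auto simp: t'_def n'_def)
    have 2: "prob (past \<inter> nxt) = fact (n (Suc m)) / (F * fact (n (Suc m) - n m)) *
        (G * (t (Suc m) - t m) ^ (n (Suc m) - n m) / t (Suc m) ^ n (Suc m)) * prob nxt"
      using multinomial_propertyD[OF mult N, of "Suc m" t' n', folded past_nxt, OF _ t' n']
      unfolding pF pG t'S nxt_def[symmetric] by simp
    have 3: "prob (now \<inter> nxt) = fact (n (Suc m)) / (fact (n m) * fact (n (Suc m) - n m)) *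
        (t m ^ n m * (t (Suc m) - t m) ^ (n (Suc m) - n m) / t (Suc m) ^ n (Suc m)) * prob nxt"
      using multinomial_propertyD[OF mult N, of 2 u l, folded now_nxt] u l
      by (simp add: nxt') (simp add: u_def l_def numeral_2_eq_2 atLeastAtMostSuc_conv mult_ac)
    show ?thesis unfolding 1 2 3 using Fpos tpos[of m] m by (simp add: field_simps)
  qed
  then have "prob (past \<inter> nxt) / prob past = prob (now \<inter> nxt) / prob now"
    using \<open>prob past > 0\<close> now_pos by (simp add: field_simps)
  moreover have "past \<inter> nxt = {\<omega>\<in>space R. N (t (Suc m)) \<omega> = enat (n (Suc m)) \<and> (\<forall>j\<in>{1..m}. N (t j) \<omega> = enat (n j))}"
    "now \<inter> nxt = {\<omega>\<in>space R. N (t (Suc m)) \<omega> = enat (n (Suc m)) \<and> N (t m) \<omega> = enat (n m)}"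
    by (auto simp: past_def now_def nxt_def)
  ultimately show "\<P>(\<omega> in R. N (t (Suc m)) \<omega> = enat (n (Suc m)) \<bar> \<forall>j\<in>{1..m}. N (t j) \<omega> = enat (n j)) =
        \<P>(\<omega> in R. N (t (Suc m)) \<omega> = enat (n (Suc m)) \<bar> N (t m) \<omega> = enat (n m))"
    unfolding cond_prob_def by (simp only: past_def now_def)
qed

section \<open>Exponential interarrival times\<close>

context prob_space
begin

lemma indep_var_emeasure:
  assumes "indep_var S X T Y" "E \<in> sets (S \<Otimes>\<^sub>M T)"
  shows "emeasure M {\<omega>\<in>space M. (X \<omega>, Y \<omega>) \<in> E} =
    (\<integral>\<^sup>+x. emeasure M {\<omega>\<in>space M. (x, Y \<omega>) \<in> E} \<partial>distr M S X)"
proof -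
  have rv: "X \<in> measurable M S" "Y \<in> measurable M T"
    and eq: "distr M S X \<Otimes>\<^sub>M distr M T Y = distr M (S \<Otimes>\<^sub>M T) (\<lambda>x. (X x, Y x))"
    using assms(1) by (auto simp: indep_var_distribution_eq)
  interpret Y: prob_space "distr M T Y" using rv by (intro prob_space_distr)
  have "emeasure M {\<omega>\<in>space M. (X \<omega>, Y \<omega>) \<in> E} = emeasure (distr M (S \<Otimes>\<^sub>M T) (\<lambda>x. (X x, Y x))) E"
    using assms(2) rv by (subst emeasure_distr) (auto intro!: arg_cong[where f="emeasure M"])
  also have "\<dots> = (\<integral>\<^sup>+x. emeasure (distr M T Y) (Pair x -` E) \<partial>distr M S X)"
    using assms(2) unfolding eq[symmetric] by (intro Y.emeasure_pair_measure_alt) simp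
  also have "\<dots> = (\<integral>\<^sup>+x. emeasure M {\<omega>\<in>space M. (x, Y \<omega>) \<in> E} \<partial>distr M S X)"
    using assms(2) rv
    by (intro nn_integral_cong) (auto simp: emeasure_distr sets_Pair1 intro!: arg_cong[where f="emeasure M"])
  finally show ?thesis .
qed

lemma indep_var_nn_integral_mult:
  fixes u v :: "_ \<Rightarrow> ennreal"
  assumes "indep_var S X T Y" and [measurable]: "u \<in> borel_measurable S" "v \<in> borel_measurable T"
  shows "(\<integral>\<^sup>+z. u (fst z) * v (snd z) \<partial>distr M (S \<Otimes>\<^sub>M T) (\<lambda>x. (X x, Y x))) =
    (\<integral>\<^sup>+x. u x \<partial>distr M S X) * (\<integral>\<^sup>+y. v y \<partial>distr M T Y)"
proof -
  have rv: "X \<in> measurable M S" "Y \<in> measurable M T"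
    and eq: "distr M S X \<Otimes>\<^sub>M distr M T Y = distr M (S \<Otimes>\<^sub>M T) (\<lambda>x. (X x, Y x))"
    using assms(1) by (auto simp: indep_var_distribution_eq)
  interpret Y: prob_space "distr M T Y" using rv by (intro prob_space_distr)
  have "(\<integral>\<^sup>+z. u (fst z) * v (snd z) \<partial>(distr M S X \<Otimes>\<^sub>M distr M T Y)) =
    (\<integral>\<^sup>+x. \<integral>\<^sup>+y. u x * v y \<partial>distr M T Y \<partial>distr M S X)"
    by (subst Y.nn_integral_fst[symmetric]) auto
  also have "\<dots> = (\<integral>\<^sup>+x. u x * (\<integral>\<^sup>+y. v y \<partial>distr M T Y) \<partial>distr M S X)"
    by (intro nn_integral_cong nn_integral_cmult) simp
  also have "\<dots> = (\<integral>\<^sup>+x. u x \<partial>distr M S X) * (\<integral>\<^sup>+y. v y \<partial>distr M T Y)"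
    by (rule nn_integral_multc) simp
  finally show ?thesis unfolding eq .
qed

text \<open>
  Negative values of \<open>A\<close> encode that the conditioning event fails. The constant \<open>0\<close> pads \<open>Y\<close> to a pair because
  \<^const>\<open>indep_var\<close> requires both variables to have the same type.
\<close>

lemma memoryless_delay:
  fixes A Z Y :: "'a \<Rightarrow> real"
  assumes AZ_Y: "indep_var (borel \<Otimes>\<^sub>M borel) (\<lambda>x. (A x, Z x)) (borel \<Otimes>\<^sub>M borel) (\<lambda>x. (Y x, 0 :: real))"
    and AZ: "indep_var borel A borel Z"
    and D: "distributed M lborel Y (exponential_density l)" and l: "0 < l"
  shows "prob {\<omega>\<in>space M. 0 \<le> A \<omega> \<and> A \<omega> < Y \<omega> \<and> Y \<omega> + Z \<omega> \<le> A \<omega> + s} =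
    prob {\<omega>\<in>space M. 0 \<le> A \<omega> \<and> A \<omega> < Y \<omega>} * prob {\<omega>\<in>space M. Y \<omega> + Z \<omega> \<le> s}"
proof -
  have [measurable]: "A \<in> borel_measurable M" "Z \<in> borel_measurable M" "Y \<in> borel_measurable M"
    using indep_var_rv1[OF AZ] indep_var_rv2[OF AZ] measurable_compose[OF indep_var_rv2[OF AZ_Y] measurable_fst] by auto
  have A_Y: "indep_var borel A borel Y" and Z_Y: "indep_var borel Z borel Y"
    using indep_var_compose[OF AZ_Y, of fst borel fst borel] indep_var_compose[OF AZ_Y, of snd borel fst borel]
    by (auto simp: comp_def)
  \<comment> \<open>\<open>u a\<close> is the probability of \<open>Y > a\<close>, set to 0 for the
    failure code \<open>a < 0\<close>; \<open>v z\<close> is the probability of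
    \<open>Y \<le> s - z\<close>.\<close>
  define u where "u = (\<lambda>a. ennreal (if 0 \<le> a then exp (- a * l) else 0))"
  define v where "v = (\<lambda>z. ennreal (if 0 \<le> s - z then 1 - exp (- (s - z) * l) else 0))"
  have [measurable]: "u \<in> borel_measurable borel" "v \<in> borel_measurable borel"
    unfolding u_def v_def by measurable
  have le: "prob {\<omega>\<in>space M. Y \<omega> \<le> c} = (if 0 \<le> c then 1 - exp (- c * l) else 0)" for c
  proof (cases "0 \<le> c")
    case True then show ?thesis using exponential_distributedD_le[OF D True l] by simp
  next
    case False
    have "prob {\<omega>\<in>space M. Y \<omega> \<le> c} \<le> prob {\<omega>\<in>space M. Y \<omega> \<le> 0}"
      using False by (intro finite_measure_mono) auto
    also have "\<dots> = 0" using exponential_distributedD_le[OF D order_refl l] by simp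
    finally show ?thesis using False by (simp add: measure_le_0_iff)
  qed
  \<comment> \<open>Memorylessness: the probability of \<open>a < Y \<le> a + (s - z)\<close> is a
    function of \<open>a\<close> times a function of \<open>z\<close>.\<close>
  have sec: "emeasure M {\<omega>\<in>space M. 0 \<le> a \<and> a < Y \<omega> \<and> Y \<omega> + z \<le> a + s} = u a * v z" for a z
  proof (cases "0 \<le> a \<and> 0 \<le> s - z")
    case True
    have "prob {\<omega>\<in>space M. a < Y \<omega> \<and> Y \<omega> \<le> a + (s - z)} =
      prob ({\<omega>\<in>space M. Y \<omega> \<le> a + (s - z)} - {\<omega>\<in>space M. Y \<omega> \<le> a})"
      by (intro arg_cong[where f=prob]) auto
    also have "\<dots> = prob {\<omega>\<in>space M. Y \<omega> \<le> a + (s - z)} - prob {\<omega>\<in>space M. Y \<omega> \<le> a}"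
      using True by (intro finite_measure_Diff) auto
    also have "\<dots> = exp (- a * l) * (1 - exp (- (s - z) * l))"
      unfolding le using True by (simp add: algebra_simps flip: exp_add)
    finally have "prob {\<omega>\<in>space M. 0 \<le> a \<and> a < Y \<omega> \<and> Y \<omega> + z \<le> a + s} = exp (- a * l) * (1 - exp (- (s - z) * l))"
      using True by (simp add: algebra_simps)
    then show ?thesis using True l by (simp add: emeasure_eq_measure u_def v_def ennreal_mult')
  next
    case False
    then have empty: "{\<omega>\<in>space M. 0 \<le> a \<and> a < Y \<omega> \<and> Y \<omega> + z \<le> a + s} = {}" by auto
    show ?thesis unfolding empty using False by (auto simp: u_def v_def)
  qed
  have meas[measurable]: "{w. 0 \<le> fst (fst w) \<and> fst (fst w) < fst (snd w) \<and> fst (snd w) + snd (fst w) \<le> fst (fst w) + s}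
      \<in> sets ((borel \<Otimes>\<^sub>M borel) \<Otimes>\<^sub>M borel \<Otimes>\<^sub>M borel :: ((real \<times> real) \<times> real \<times> real) measure)"
  proof -
    have "{w \<in> space ((borel \<Otimes>\<^sub>M borel) \<Otimes>\<^sub>M borel \<Otimes>\<^sub>M borel :: ((real \<times> real) \<times> real \<times> real) measure).
        0 \<le> fst (fst w) \<and> fst (fst w) < fst (snd w) \<and> fst (snd w) + snd (fst w) \<le> fst (fst w) + s}
      \<in> sets ((borel \<Otimes>\<^sub>M borel) \<Otimes>\<^sub>M borel \<Otimes>\<^sub>M borel)" by measurable
    then show ?thesis by (simp add: space_pair_measure)
  qed
  have "emeasure M {\<omega>\<in>space M. 0 \<le> A \<omega> \<and> A \<omega> < Y \<omega> \<and> Y \<omega> + Z \<omega> \<le> A \<omega> + s} =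
     (\<integral>\<^sup>+w. u (fst w) * v (snd w) \<partial>distr M (borel \<Otimes>\<^sub>M borel) (\<lambda>x. (A x, Z x)))"
    using indep_var_emeasure[OF AZ_Y meas] by (simp add: sec)
  also have "\<dots> = (\<integral>\<^sup>+a. u a \<partial>distr M borel A) * (\<integral>\<^sup>+z. v z \<partial>distr M borel Z)"
    by (rule indep_var_nn_integral_mult[OF AZ]) auto
  also have "(\<integral>\<^sup>+a. u a \<partial>distr M borel A) = emeasure M {\<omega>\<in>space M. 0 \<le> A \<omega> \<and> A \<omega> < Y \<omega>}"
  proof -
    have E: "{w. 0 \<le> fst w \<and> fst w < snd w} \<in> sets (borel \<Otimes>\<^sub>M borel :: (real \<times> real) measure)"
    proof -
      have "{w \<in> space (borel \<Otimes>\<^sub>M borel :: (real \<times> real) measure). 0 \<le> fst w \<and> fst w < snd w} \<in> sets (borel \<Otimes>\<^sub>M borel)"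
        by measurable
      then show ?thesis by (simp add: space_pair_measure)
    qed
    have "emeasure M {\<omega>\<in>space M. 0 \<le> a \<and> a < Y \<omega>} = u a" for a
      using exponential_distributedD_gt[OF D _ l, of a]
      by (cases "0 \<le> a") (simp_all add: u_def emeasure_eq_measure)
    then show ?thesis using indep_var_emeasure[OF A_Y E] by simp
  qed
  also have "(\<integral>\<^sup>+z. v z \<partial>distr M borel Z) = emeasure M {\<omega>\<in>space M. Y \<omega> + Z \<omega> \<le> s}"
  proof -
    have E: "{w. snd w + fst w \<le> s} \<in> sets (borel \<Otimes>\<^sub>M borel :: (real \<times> real) measure)"
    proof -
      have "{w \<in> space (borel \<Otimes>\<^sub>M borel :: (real \<times> real) measure). snd w + fst w \<le> s} \<in> sets (borel \<Otimes>\<^sub>M borel)"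
        by measurable
      then show ?thesis by (simp add: space_pair_measure)
    qed
    have "emeasure M {\<omega>\<in>space M. Y \<omega> + z \<le> s} = v z" for z
      using le[of "s - z"] by (simp add: v_def emeasure_eq_measure algebra_simps)
    then show ?thesis using indep_var_emeasure[OF Z_Y E] by simp
  qed
  finally show ?thesis
    by (simp add: emeasure_eq_measure flip: ennreal_mult)
qed

end

section \<open>Exponential gaps give a Poisson process\<close>

locale poisson_arrivals = prob_space R for R :: "'a measure" +
  fixes N :: "real \<Rightarrow> 'a \<Rightarrow> enat" and l :: real
  assumes N: "counting_process R N" and l: "0 < l"
    and indep: "indep_vars (\<lambda>_. borel) (interarrival N) {1..}"
    and expo: "\<And>n. n \<ge> 1 \<Longrightarrow> distributed R lborel (interarrival N n) (exponential_density l)"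
begin

lemma arrival_meas[measurable]: "arrival N n \<in> borel_measurable R"
  by (rule borel_measurable_arrival[OF N])

lemma interarrival_meas[measurable]: "interarrival N n \<in> borel_measurable R"
  by (rule borel_measurable_interarrival[OF N])

lemma prob_sum_le:
  assumes "k \<ge> 1" "0 \<le> s"
  shows "prob {\<omega>\<in>space R. (\<Sum>i=Suc n..n+k. interarrival N i \<omega>) \<le> s} = erlang_CDF (k - 1) l s"
proof -
  \<comment> \<open>\<open>erlang_density\<close> counts its shape from 0, so a sum of
    \<open>k\<close> gaps has index \<open>k - 1\<close>.\<close>
  have "distributed R lborel (\<lambda>\<omega>. \<Sum>i=Suc n..n+k. interarrival N i \<omega>) (erlang_density (card {Suc n..n+k} - 1) l)"
    using assms by (intro exponential_distributed_sum expo l indep_vars_subset[OF indep]) auto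
  from erlang_distributed_le[OF this l assms(2)] show ?thesis by simp
qed

lemma prob_arrival_le:
  assumes "k \<ge> 1" "0 \<le> s"
  shows "prob {\<omega>\<in>space R. arrival N k \<omega> \<le> s} = erlang_CDF (k - 1) l s"
  using prob_sum_le[OF assms, of 0] by (simp add: arrival_eq_sum[OF N] cong: conj_cong)

lemma counting_event:
  "0 \<le> s \<Longrightarrow> {\<omega>\<in>space R. N s \<omega> = enat k} = {\<omega>\<in>space R. arrival N k \<omega> \<le> s} - {\<omega>\<in>space R. arrival N (Suc k) \<omega> \<le> s}"
  using counting_eq_iff[OF N] by auto

lemma prob_counting:
  assumes "0 \<le> s"
  shows "prob {\<omega>\<in>space R. N s \<omega> = enat k} =
     prob {\<omega>\<in>space R. arrival N k \<omega> \<le> s} - prob {\<omega>\<in>space R. arrival N (Suc k) \<omega> \<le> s}"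
  unfolding counting_event[OF assms] using arrival_mono[OF N, of _ k "Suc k"]
  by (intro finite_measure_Diff) (auto intro: order_trans)

lemma poisson_counting:
  assumes "0 \<le> s"
  shows "prob {\<omega>\<in>space R. N s \<omega> = enat k} = exp (- l * s) * (l * s) ^ k / fact k"
proof (cases "k = 0")
  case True
  have "{\<omega>\<in>space R. arrival N 0 \<omega> \<le> s} = space R" using assms by (auto simp: arrival_def)
  then show ?thesis unfolding prob_counting[OF assms] using True assms prob_space
    by (simp add: prob_arrival_le erlang_CDF_def)
next
  case False
  then obtain j where "k = Suc j" by (cases k) auto
  then show ?thesis unfolding prob_counting[OF assms] using assms
    by (simp add: prob_arrival_le erlang_CDF_def mult_ac)
qed

text \<open>Renewal at the fixed time \<tau>: the conditioning event says that the first \<nu> gaps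
  meet certain constraints and that the next gap exceeds the age, the time since the last arrival.
  By \<open>memoryless_delay\<close> the wait for \<open>k\<close> further arrivals then has the
  same law as from time 0.\<close>

lemma prob_next_arrivals:
  fixes m :: nat and t :: "nat \<Rightarrow> real" and n :: "nat \<Rightarrow> nat"
  assumes t: "\<And>j. j \<in> {1..m} \<Longrightarrow> 0 \<le> t j \<and> t j \<le> \<tau>" and n: "\<And>j. j \<in> {1..m} \<Longrightarrow> n j \<le> \<nu>"
    and \<tau>: "0 \<le> \<tau>" "0 \<le> s" and k: "k \<ge> 1"
  shows "prob {\<omega>\<in>space R. (\<forall>j\<in>{1..m}. N (t j) \<omega> = enat (n j)) \<and> N \<tau> \<omega> = enat \<nu> \<and> arrival N (\<nu> + k) \<omega> \<le> \<tau> + s} =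
    prob {\<omega>\<in>space R. (\<forall>j\<in>{1..m}. N (t j) \<omega> = enat (n j)) \<and> N \<tau> \<omega> = enat \<nu>} *
    prob {\<omega>\<in>space R. arrival N k \<omega> \<le> s}"
proof -
  define S where "S = (\<lambda>(r::nat) w. \<Sum>i=1..r. w i :: real)"
  \<comment> \<open>For \<open>n j = \<nu>\<close> the upper constraint would involve the gap
    \<open>Suc \<nu>\<close>. It follows from \<open>\<tau> < arrival N (Suc \<nu>)\<close> and is
    left out, so that \<open>B\<close> depends on the first \<nu> gaps only.\<close>
  define B where "B = (\<lambda>w. S \<nu> w \<le> \<tau> \<and> (\<forall>j\<in>{1..m}. S (n j) w \<le> t j \<and> (n j < \<nu> \<longrightarrow> t j < S (Suc (n j)) w)))"
  define \<alpha> where "\<alpha> = (\<lambda>w. if B w then \<tau> - S \<nu> w else -1)"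
  define \<zeta> where "\<zeta> = (\<lambda>w. \<Sum>i=Suc (Suc \<nu>)..\<nu>+k. w i :: real)"
  define W where "W = interarrival N"
  define A where "A = (\<lambda>\<omega>. \<alpha> (\<lambda>i. W i \<omega>))"
  define Z where "Z = (\<lambda>\<omega>. \<zeta> (\<lambda>i. W i \<omega>))"
  \<comment> \<open>The gap \<open>Suc \<nu>\<close> belongs to neither block: it is the exponential
    delay.\<close>
  define I1 where "I1 = {1..\<nu>}"
  define I2 where "I2 = {Suc (Suc \<nu>)..\<nu>+k}"
  have S_arr: "S r (\<lambda>i. W i \<omega>) = arrival N r \<omega>" if "\<omega> \<in> space R" for r \<omega>
    using arrival_eq_sum[OF N that] by (simp add: S_def W_def)
  have S_meas: "S r \<in> borel_measurable (PiM I (\<lambda>_. borel))" if "{1..r} \<subseteq> I" for r I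
    unfolding S_def using that by (intro borel_measurable_sum measurable_component_singleton) auto
  \<comment> \<open>The index set is arbitrary because \<alpha> is needed both on \<open>I1\<close>
    alone and on \<open>I1 \<union> I2\<close>.\<close>
  have \<alpha>_meas: "\<alpha> \<in> borel_measurable (PiM I (\<lambda>_. borel))" if "I1 \<subseteq> I" for I
  proof -
    have [measurable]: "S \<nu> \<in> borel_measurable (PiM I (\<lambda>_. borel))"
      using that by (intro S_meas) (auto simp: I1_def)
    have "Measurable.pred (PiM I (\<lambda>_. borel)) (\<lambda>w. S (n j) w \<le> t j \<and> (n j < \<nu> \<longrightarrow> t j < S (Suc (n j)) w))"
      if j: "j \<in> {1..m}" for j
    proof (cases "n j < \<nu>")
      case True
      have [measurable]: "S (n j) \<in> borel_measurable (PiM I (\<lambda>_. borel))" "S (Suc (n j)) \<in> borel_measurable (PiM I (\<lambda>_. borel))"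
        using True \<open>I1 \<subseteq> I\<close> by (intro S_meas; auto simp: I1_def)+
      show ?thesis using True by simp
    next
      case False
      then have "n j = \<nu>" using n[OF j] by simp
      then show ?thesis by simp
    qed
    then have [measurable]: "Measurable.pred (PiM I (\<lambda>_. borel))
        (\<lambda>w. \<forall>j\<in>{1..m}. S (n j) w \<le> t j \<and> (n j < \<nu> \<longrightarrow> t j < S (Suc (n j)) w))"
      by (intro pred_intros_finite) auto
    have [measurable]: "Measurable.pred (PiM I (\<lambda>_. borel)) B"
      unfolding B_def by measurable
    show ?thesis unfolding \<alpha>_def by measurable
  qed
  have \<zeta>_meas: "\<zeta> \<in> borel_measurable (PiM I (\<lambda>_. borel))" if "I2 \<subseteq> I" for I
    unfolding \<zeta>_def using that by (intro borel_measurable_sum measurable_component_singleton) (auto simp: I2_def)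
  have S_cong: "S r w = S r w'" if "\<And>i. i \<in> {1..r} \<Longrightarrow> w i = w' i" for r w w'
    using that by (simp add: S_def)
  have \<alpha>_restrict: "\<alpha> (restrict w I) = \<alpha> w" if "I1 \<subseteq> I" for w I
  proof -
    have S1: "S r (restrict w I) = S r w" if "r \<le> \<nu>" for r
      using that \<open>I1 \<subseteq> I\<close> by (intro S_cong restrict_apply') (auto simp: I1_def)
    have "B (restrict w I) = B w" unfolding B_def using S1 n by (auto simp: Suc_le_eq)
    then show ?thesis unfolding \<alpha>_def by (simp add: S1)
  qed
  have \<zeta>_restrict: "\<zeta> (restrict w I) = \<zeta> w" if "I2 \<subseteq> I" for w I
    unfolding \<zeta>_def using that by (intro sum.cong restrict_apply') (auto simp: I2_def)
  have disj: "(I1 \<union> I2) \<inter> {Suc \<nu>} = {}" "I1 \<inter> I2 = {}" by (auto simp: I1_def I2_def)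
  have sub: "I1 \<subseteq> {1..}" "I2 \<subseteq> {1..}" "{Suc \<nu>} \<subseteq> {1..}" "I1 \<union> I2 \<subseteq> {1..}" by (auto simp: I1_def I2_def)
  have AZ: "indep_var borel A borel Z"
    using indep_var_compose[OF indep_var_restrict[OF indep disj(2) sub(1,2)] \<alpha>_meas \<zeta>_meas]
    by (simp add: comp_def \<alpha>_restrict \<zeta>_restrict A_def Z_def W_def)
  have AZ_Y: "indep_var (borel \<Otimes>\<^sub>M borel) (\<lambda>\<omega>. (A \<omega>, Z \<omega>)) (borel \<Otimes>\<^sub>M borel) (\<lambda>\<omega>. (W (Suc \<nu>) \<omega>, 0 :: real))"
    using indep_var_compose[OF indep_var_restrict[OF indep disj(1) sub(4,3)],
        of "\<lambda>w. (\<alpha> w, \<zeta> w)" "borel \<Otimes>\<^sub>M borel" "\<lambda>w. (w (Suc \<nu>), 0 :: real)" "borel \<Otimes>\<^sub>M borel"] \<alpha>_meas \<zeta>_meas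
    by (simp add: comp_def \<alpha>_restrict \<zeta>_restrict A_def Z_def W_def)
  have Y: "distributed R lborel (W (Suc \<nu>)) (exponential_density l)"
    using expo[of "Suc \<nu>"] by (simp add: W_def)
  have arr_Suc: "arrival N (Suc \<nu>) \<omega> = arrival N \<nu> \<omega> + W (Suc \<nu>) \<omega>" for \<omega>
    by (simp add: W_def interarrival_def)
  have past: "(\<forall>j\<in>{1..m}. N (t j) \<omega> = enat (n j)) \<and> N \<tau> \<omega> = enat \<nu> \<longleftrightarrow> 0 \<le> A \<omega> \<and> A \<omega> < W (Suc \<nu>) \<omega>"
    if \<omega>: "\<omega> \<in> space R" for \<omega>
  proof -
    have A: "0 \<le> A \<omega> \<longleftrightarrow> B (\<lambda>i. W i \<omega>)" using \<tau> by (auto simp: A_def \<alpha>_def B_def)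
    have A': "A \<omega> < W (Suc \<nu>) \<omega> \<longleftrightarrow> \<tau> < arrival N (Suc \<nu>) \<omega>" if "B (\<lambda>i. W i \<omega>)"
      using that by (auto simp: A_def \<alpha>_def arr_Suc S_arr[OF \<omega>])
    have "N (t j) \<omega> = enat (n j) \<longleftrightarrow> arrival N (n j) \<omega> \<le> t j \<and> (n j < \<nu> \<longrightarrow> t j < arrival N (Suc (n j)) \<omega>)"
      if "j \<in> {1..m}" "\<tau> < arrival N (Suc \<nu>) \<omega>" for j
      using counting_eq_iff[OF N \<omega>, of "t j" "n j"] t[OF that(1)] n[OF that(1)] that(2)
      by (cases "n j < \<nu>") auto
    then show ?thesis using counting_eq_iff[OF N \<omega> \<tau>(1), of \<nu>] A A'
      by (auto simp: B_def S_arr[OF \<omega>])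
  qed
  have arr_k: "arrival N (\<nu> + k) \<omega> = arrival N \<nu> \<omega> + W (Suc \<nu>) \<omega> + Z \<omega>" if "\<omega> \<in> space R" for \<omega>
  proof -
    have "{1..\<nu>+k} = {1..\<nu>} \<union> ({Suc \<nu>} \<union> I2)" using k by (auto simp: I2_def)
    then have "arrival N (\<nu> + k) \<omega> = (\<Sum>i\<in>{1..\<nu>} \<union> ({Suc \<nu>} \<union> I2). W i \<omega>)"
      using arrival_eq_sum[OF N that] by (simp add: W_def)
    also have "\<dots> = arrival N \<nu> \<omega> + (W (Suc \<nu>) \<omega> + Z \<omega>)"
      using arrival_eq_sum[OF N that, of \<nu>]
      by (subst sum.union_disjoint) (auto simp: I2_def Z_def \<zeta>_def W_def)
    finally show ?thesis by simp
  qed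
  have future: "arrival N (\<nu> + k) \<omega> \<le> \<tau> + s \<longleftrightarrow> W (Suc \<nu>) \<omega> + Z \<omega> \<le> A \<omega> + s"
    if \<omega>: "\<omega> \<in> space R" and "0 \<le> A \<omega>" for \<omega>
  proof -
    have "A \<omega> = \<tau> - arrival N \<nu> \<omega>" using that S_arr[OF \<omega>] by (auto simp: A_def \<alpha>_def split: if_splits)
    then show ?thesis using arr_k[OF \<omega>] by auto
  qed
  have ev1: "{\<omega>\<in>space R. (\<forall>j\<in>{1..m}. N (t j) \<omega> = enat (n j)) \<and> N \<tau> \<omega> = enat \<nu> \<and> arrival N (\<nu> + k) \<omega> \<le> \<tau> + s} =
    {\<omega>\<in>space R. 0 \<le> A \<omega> \<and> A \<omega> < W (Suc \<nu>) \<omega> \<and> W (Suc \<nu>) \<omega> + Z \<omega> \<le> A \<omega> + s}"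
    using past future by blast
  have ev2: "{\<omega>\<in>space R. (\<forall>j\<in>{1..m}. N (t j) \<omega> = enat (n j)) \<and> N \<tau> \<omega> = enat \<nu>} =
    {\<omega>\<in>space R. 0 \<le> A \<omega> \<and> A \<omega> < W (Suc \<nu>) \<omega>}"
    using past by blast
  have "prob {\<omega>\<in>space R. W (Suc \<nu>) \<omega> + Z \<omega> \<le> s} = prob {\<omega>\<in>space R. arrival N k \<omega> \<le> s}"
  proof -
    have "W (Suc \<nu>) \<omega> + Z \<omega> = (\<Sum>i=Suc \<nu>..\<nu>+k. interarrival N i \<omega>)" for \<omega>
      using k by (subst sum.atLeast_Suc_atMost) (auto simp: W_def Z_def \<zeta>_def)
    then show ?thesis using prob_sum_le[OF k \<tau>(2), of \<nu>] prob_arrival_le[OF k \<tau>(2)] by simp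
  qed
  then show ?thesis unfolding ev1 ev2 using memoryless_delay[OF AZ_Y AZ Y l, of s] by simp
qed

text \<open>By induction on the number of times. The last count is \<open>n m + k\<close> exactly
  when that arrival has occurred by \<open>t m + s\<close> and the following one has not;
  \<open>prob_next_arrivals\<close> applied to both yields the new Poisson factor as a
  difference.\<close>

lemma independent_increments:
  fixes t :: "nat \<Rightarrow> real" and n :: "nat \<Rightarrow> nat"
  assumes t: "t 0 = 0" "\<And>j. j < m \<Longrightarrow> t j < t (Suc j)"
    and n: "n 0 = 0" "\<And>j. j < m \<Longrightarrow> n j \<le> n (Suc j)"
  shows "prob {\<omega>\<in>space R. \<forall>j\<in>{1..m}. N (t j) \<omega> = enat (n j)} =
    (\<Prod>j=1..m. exp (- l * (t j - t (j - 1))) * (l * (t j - t (j - 1))) ^ (n j - n (j - 1)) / fact (n j - n (j - 1)))"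
  using t(2) n(2)
proof (induction m)
  case 0
  then show ?case using prob_space by simp
next
  case (Suc m)
  have tle: "t i \<le> t j" if "i \<le> j" "j \<le> m" for i j
    by (rule nat_interval_mono) (use that Suc.prems(1) in \<open>auto intro: less_imp_le\<close>)
  have nle: "n i \<le> n j" if "i \<le> j" "j \<le> m" for i j
    by (rule nat_interval_mono) (use that Suc.prems(2) in auto)
  define s where "s = t (Suc m) - t m"
  define k where "k = n (Suc m) - n m"
  have s: "0 < s" "t (Suc m) = t m + s" using Suc.prems(1)[of m] by (auto simp: s_def)
  have k: "n (Suc m) = n m + k" using Suc.prems(2)[of m] by (auto simp: k_def)
  have tm: "0 \<le> t m" using tle[of 0 m] t by simp
  define E where "E = {\<omega>\<in>space R. \<forall>j\<in>{1..m}. N (t j) \<omega> = enat (n j)}"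
  have E_eq: "E = {\<omega>\<in>space R. (\<forall>j\<in>{1..m}. N (t j) \<omega> = enat (n j)) \<and> N (t m) \<omega> = enat (n m)}"
    using t(1) n(1) counting_0[OF N] by (cases "m = 0") (auto simp: E_def zero_enat_def)
  have E_sets: "E \<in> sets R" unfolding E_def
    using tle[of 0] t(1) by (intro counting_event_measurable[OF N]) auto
  have next_arr: "prob (E \<inter> {\<omega>\<in>space R. arrival N (n m + i) \<omega> \<le> t m + s}) = prob E * prob {\<omega>\<in>space R. arrival N i \<omega> \<le> s}" for i
  \<comment> \<open>With no further arrival to await both arrival events are sure, the first one on
    \<open>E\<close>; \<open>prob_next_arrivals\<close> needs at least one gap.\<close>
  proof (cases "i = 0")
    case True
    have "arrival N (n m) \<omega> \<le> t m + s" if "\<omega> \<in> E" for \<omega>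
      using that counting_eq_iff[OF N, of \<omega> "t m" "n m"] tm s by (auto simp: E_eq)
    then have "E \<inter> {\<omega>\<in>space R. arrival N (n m + i) \<omega> \<le> t m + s} = E" using True by (auto simp: E_def)
    moreover have "{\<omega>\<in>space R. arrival N i \<omega> \<le> s} = space R" using True s by (auto simp: arrival_def)
    ultimately show ?thesis using prob_space by simp
  next
    case False
    have "E \<inter> {\<omega>\<in>space R. arrival N (n m + i) \<omega> \<le> t m + s} =
      {\<omega>\<in>space R. (\<forall>j\<in>{1..m}. N (t j) \<omega> = enat (n j)) \<and> N (t m) \<omega> = enat (n m) \<and> arrival N (n m + i) \<omega> \<le> t m + s}"
      unfolding E_eq by blast
    then show ?thesis
      using prob_next_arrivals[of m t "t m" n "n m" s i] tle tle[of 0] nle t(1) s tm False unfolding E_eq by force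
  qed
  have "{\<omega>\<in>space R. \<forall>j\<in>{1..Suc m}. N (t j) \<omega> = enat (n j)} = E \<inter> {\<omega>\<in>space R. N (t m + s) \<omega> = enat (n m + k)}"
    by (auto simp: E_def atLeastAtMostSuc_conv s(2)[symmetric] k[symmetric])
  also have "\<dots> = (E \<inter> {\<omega>\<in>space R. arrival N (n m + k) \<omega> \<le> t m + s}) - (E \<inter> {\<omega>\<in>space R. arrival N (n m + Suc k) \<omega> \<le> t m + s})"
    using counting_event[of "t m + s" "n m + k"] tm s by auto
  also have "prob \<dots> = prob (E \<inter> {\<omega>\<in>space R. arrival N (n m + k) \<omega> \<le> t m + s}) - prob (E \<inter> {\<omega>\<in>space R. arrival N (n m + Suc k) \<omega> \<le> t m + s})"
    using E_sets arrival_mono[OF N, of _ "n m + k" "n m + Suc k"]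
    by (intro finite_measure_Diff) (auto intro: order_trans)
  also have "\<dots> = prob E * prob {\<omega>\<in>space R. N s \<omega> = enat k}"
    unfolding next_arr using s by (simp add: prob_counting algebra_simps)
  also have "\<dots> = prob E * (exp (- l * s) * (l * s) ^ k / fact k)"
    using s by (simp add: poisson_counting)
  finally show ?case using Suc.IH Suc.prems by (simp add: E_def s_def k_def)
qed

text \<open>The exponents telescope and the powers of \<open>l\<close> add up to the factors of a
  single Poisson count at \<open>t m\<close>, so the rate cancels against that count's
  probability.\<close>

lemma multinomial: "multinomial_property R N"
  unfolding multinomial_property_def Let_def
proof (intro allI impI)
  fix m :: nat and t :: "nat \<Rightarrow> real" and k :: "nat \<Rightarrow> nat"
  assume m: "1 \<le> m" and t0: "t 0 = 0" and t: "\<forall>j<m. t j < t (Suc j)"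
  define n where "n = (\<lambda>j. \<Sum>i=1..j. k i)"
  have n: "n 0 = 0" "\<And>j. j < m \<Longrightarrow> n j \<le> n (Suc j)" by (auto simp: n_def)
  have kn: "k j = n j - n (j - 1)" if "j \<in> {1..m}" for j
    using that by (cases j) (auto simp: n_def)
  have tm: "0 < t m"
  proof (rule less_le_trans)
    show "0 < t 1" using t m t0 by (metis One_nat_def Suc_le_lessD)
    show "t 1 \<le> t m" by (rule nat_interval_mono) (use m t in \<open>auto intro: less_imp_le\<close>)
  qed
  have telescope: "(\<Sum>j=1..m. t j - t (j - 1)) = t m" using t0 by (induction m) auto
  have "{\<omega>\<in>space R. \<forall>j\<in>{1..m}. N (t j) \<omega> - N (t (j - 1)) \<omega> = enat (k j)}
     = {\<omega>\<in>space R. \<forall>j\<in>{1..m}. N (t j) \<omega> = enat (n j)}"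
    using increments_eq_iff[OF N, of _ t m n] t t0 n kn by (auto intro: less_imp_le)
  then have "prob {\<omega>\<in>space R. \<forall>j\<in>{1..m}. N (t j) \<omega> - N (t (j - 1)) \<omega> = enat (k j)} =
    (\<Prod>j=1..m. exp (- l * (t j - t (j - 1))) * (l * (t j - t (j - 1))) ^ k j / fact (k j))"
    using independent_increments[of t m n] t t0 n kn by simp
  also have "\<dots> = (\<Prod>j=1..m. exp (- l * (t j - t (j - 1)))) * (\<Prod>j=1..m. l ^ k j) *
       (\<Prod>j=1..m. (t j - t (j - 1)) ^ k j) / (\<Prod>j=1..m. fact (k j))"
    by (simp add: prod.distrib prod_dividef power_mult_distrib mult_ac)
  also have "(\<Prod>j=1..m. exp (- l * (t j - t (j - 1)))) = exp (- l * t m)"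
    by (simp add: exp_sum[symmetric] sum_distrib_left[symmetric] telescope sum_negf del: One_nat_def)
  also have "(\<Prod>j=1..m. l ^ k j) = l ^ (\<Sum>j=1..m. k j)" by (simp add: power_sum)
  also have "(\<Prod>j=1..m. (t j - t (j - 1)) ^ k j) = (\<Prod>j=1..m. ((t j - t (j - 1)) / t m) ^ k j) * t m ^ (\<Sum>j=1..m. k j)"
    using tm by (simp add: power_divide prod_dividef power_sum)
  finally show "prob {\<omega>\<in>space R. \<forall>j\<in>{1..m}. N (t j) \<omega> - N (t (j - 1)) \<omega> = enat (k j)} =
      fact (\<Sum>j=1..m. k j) / (\<Prod>j=1..m. fact (k j)) * (\<Prod>j=1..m. ((t j - t (j - 1)) / t m) ^ k j) *
      prob {\<omega>\<in>space R. N (t m) \<omega> = enat (\<Sum>j=1..m. k j)}"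
    using tm by (simp add: poisson_counting power_mult_distrib)
qed

end

section \<open>Mixtures of smooth survival functions\<close>

lemma has_real_derivative_sequentially:
  fixes f :: "real \<Rightarrow> real"
  assumes "\<And>X. (\<And>n. X n \<noteq> x) \<Longrightarrow> X \<longlonglongrightarrow> x \<Longrightarrow> (\<lambda>n. (f (X n) - f x) / (X n - x)) \<longlonglongrightarrow> D"
  shows "(f has_real_derivative D) (at x)"
  unfolding has_field_derivative_iff by (rule iffD2[OF tendsto_at_iff_sequentially]) (auto simp: comp_def intro!: assms)

text \<open>Dominated convergence is sequential, hence the sequential form of the derivative. The
  mean value inequality turns the bound on \<phi>' into a bound on difference quotients.\<close>

lemma (in finite_measure) has_real_derivative_integral:
  fixes \<phi> \<phi>' :: "real \<Rightarrow> 'a \<Rightarrow> real"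
  assumes x: "a < x" "x < b"
    and int: "\<And>s. a < s \<Longrightarrow> s < b \<Longrightarrow> integrable M (\<phi> s)"
    and meas: "\<phi>' x \<in> borel_measurable M"
    and der: "\<And>s \<theta>. a < s \<Longrightarrow> s < b \<Longrightarrow> \<theta> \<in> space M \<Longrightarrow> ((\<lambda>s. \<phi> s \<theta>) has_real_derivative \<phi>' s \<theta>) (at s)"
    and bound: "\<And>s \<theta>. a < s \<Longrightarrow> s < b \<Longrightarrow> \<theta> \<in> space M \<Longrightarrow> \<bar>\<phi>' s \<theta>\<bar> \<le> C \<theta>"
    and C: "integrable M C"
  shows "((\<lambda>s. \<integral>\<theta>. \<phi> s \<theta> \<partial>M) has_real_derivative (\<integral>\<theta>. \<phi>' x \<theta> \<partial>M)) (at x)"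
proof (rule has_real_derivative_sequentially)
  fix X :: "nat \<Rightarrow> real" assume X: "\<And>n. X n \<noteq> x" "X \<longlonglongrightarrow> x"
  have ev: "\<forall>\<^sub>F n in sequentially. a < X n \<and> X n < b"
    using order_tendstoD[OF X(2)] x by (intro eventually_conj) auto
  then obtain n0 where n0: "\<And>n. n \<ge> n0 \<Longrightarrow> a < X n \<and> X n < b" by (auto simp: eventually_sequentially)
  \<comment> \<open>Only a tail of \<open>X\<close> is sure to stay in the interval;
    \<open>LIMSEQ_offset\<close> undoes the shift.\<close>
  define Y where "Y = (\<lambda>n. X (n + n0))"
  have Y: "Y n \<noteq> x" "a < Y n" "Y n < b" for n using X n0 by (auto simp: Y_def)
  have Ylim: "Y \<longlonglongrightarrow> x" unfolding Y_def using X(2) by (rule LIMSEQ_ignore_initial_segment)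
  have "(\<lambda>n. \<integral>\<theta>. (\<phi> (Y n) \<theta> - \<phi> x \<theta>) / (Y n - x) \<partial>M) \<longlonglongrightarrow> (\<integral>\<theta>. \<phi>' x \<theta> \<partial>M)"
  proof (rule integral_dominated_convergence[where w=C])
    show "(\<lambda>\<theta>. (\<phi> (Y n) \<theta> - \<phi> x \<theta>) / (Y n - x)) \<in> borel_measurable M" for n
      using int[of "Y n"] int[of x] x Y[of n] by (intro borel_measurable_divide borel_measurable_diff) auto
    show "AE \<theta> in M. norm ((\<phi> (Y n) \<theta> - \<phi> x \<theta>) / (Y n - x)) \<le> C \<theta>" for n
    proof (rule AE_I2)
      fix \<theta> assume \<theta>: "\<theta> \<in> space M"
      have "norm (\<phi> (Y n) \<theta> - \<phi> x \<theta>) \<le> C \<theta> * norm (Y n - x)"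
        using \<theta> bound der Y[of n] x
        by (intro field_differentiable_bound[where S="{a<..<b}" and f'="\<lambda>s. \<phi>' s \<theta>"])
          (auto intro: has_field_derivative_at_within)
      then show "norm ((\<phi> (Y n) \<theta> - \<phi> x \<theta>) / (Y n - x)) \<le> C \<theta>"
        using Y(1)[of n] by (simp add: divide_le_eq)
    qed
    show "AE \<theta> in M. (\<lambda>n. (\<phi> (Y n) \<theta> - \<phi> x \<theta>) / (Y n - x)) \<longlonglongrightarrow> \<phi>' x \<theta>"
    proof (rule AE_I2)
      fix \<theta> assume \<theta>: "\<theta> \<in> space M"
      from der[OF x \<theta>] have "((\<lambda>y. (\<phi> y \<theta> - \<phi> x \<theta>) / (y - x)) \<longlongrightarrow> \<phi>' x \<theta>) (at x)"
        by (simp add: has_field_derivative_iff)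
      then show "(\<lambda>n. (\<phi> (Y n) \<theta> - \<phi> x \<theta>) / (Y n - x)) \<longlonglongrightarrow> \<phi>' x \<theta>"
        using Y(1) Ylim by (auto simp: tendsto_at_iff_sequentially comp_def)
    qed
  qed (use meas C in auto)
  also have "(\<lambda>n. \<integral>\<theta>. (\<phi> (Y n) \<theta> - \<phi> x \<theta>) / (Y n - x) \<partial>M) =
      (\<lambda>n. ((\<integral>\<theta>. \<phi> (Y n) \<theta> \<partial>M) - (\<integral>\<theta>. \<phi> x \<theta> \<partial>M)) / (Y n - x))"
    using int x Y by (simp add: Bochner_Integration.integral_diff)
  finally show "(\<lambda>n. ((\<integral>\<theta>. \<phi> (X n) \<theta> \<partial>M) - (\<integral>\<theta>. \<phi> x \<theta> \<partial>M)) / (X n - x)) \<longlonglongrightarrow> (\<integral>\<theta>. \<phi>' x \<theta> \<partial>M)"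
    unfolding Y_def by (rule LIMSEQ_offset)
qed

lemma eq_on_Rats_pos_imp_eq:
  fixes k l :: "real \<Rightarrow> real"
  assumes "continuous_on {0<..} k" "continuous_on {0<..} l" "\<And>q. q \<in> \<rat> \<Longrightarrow> q > 0 \<Longrightarrow> k q = l q" "x > 0"
  shows "k x = l x"
proof (rule ccontr)
  assume ne: "k x \<noteq> l x"
  have "continuous (at x) (\<lambda>y. k y - l y)"
    using assms by (intro continuous_diff) (auto simp: continuous_on_eq_continuous_at)
  then have "((\<lambda>y. k y - l y) \<longlongrightarrow> k x - l x) (at x)" by (simp add: continuous_at)
  then have "\<forall>\<^sub>F y in at x. k y - l y \<noteq> 0"
    using ne by (intro tendsto_imp_eventually_ne) auto
  then have "\<forall>\<^sub>F y in at_right x. k y - l y \<noteq> 0" by (rule eventually_at_split[THEN iffD1, THEN conjunct2])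
  then obtain b where b: "b > x" "\<And>y. x < y \<Longrightarrow> y < b \<Longrightarrow> k y - l y \<noteq> 0"
    by (auto simp: eventually_at_right_field)
  obtain q where "q \<in> \<rat>" "x < q" "q < b" using Rats_dense_in_real[OF b(1)] by auto
  then show False using b(2)[of q] assms(3)[of q] assms(4) by simp
qed

text \<open>The space \<open>M\<close> is left open so that it can be the law of the parameter or,
  with functions constant in \<theta>, a single \<open>P\<^sub>\<theta>\<close>.\<close>

locale smooth_mixture = prob_space M for M :: "'m measure" +
  fixes F f :: "'m \<Rightarrow> real \<Rightarrow> real" and C p :: "'m \<Rightarrow> real"
  assumes F_meas[measurable]: "\<And>t. t > 0 \<Longrightarrow> (\<lambda>\<theta>. F \<theta> t) \<in> borel_measurable M"
    and F_deriv: "\<And>\<theta> t. \<theta> \<in> space M \<Longrightarrow> t > 0 \<Longrightarrow> (F \<theta> has_real_derivative f \<theta> t) (at t)"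
    and f_cont: "\<And>\<theta>. \<theta> \<in> space M \<Longrightarrow> continuous_on {0<..} (f \<theta>)"
    and f_pos: "\<And>\<theta> t. \<theta> \<in> space M \<Longrightarrow> t > 0 \<Longrightarrow> 0 < f \<theta> t"
    and f_le: "\<And>\<theta> t. \<theta> \<in> space M \<Longrightarrow> t > 0 \<Longrightarrow> f \<theta> t \<le> C \<theta>"
    and C_int: "integrable M C"
    and F_at_0: "\<And>\<theta>. \<theta> \<in> space M \<Longrightarrow> (F \<theta> \<longlongrightarrow> 0) (at_right 0)"
    and F_at_top: "\<And>\<theta>. \<theta> \<in> space M \<Longrightarrow> (F \<theta> \<longlongrightarrow> 1) at_top"
    and f_at_0: "\<And>\<theta>. \<theta> \<in> space M \<Longrightarrow> (f \<theta> \<longlongrightarrow> p \<theta>) (at_right 0)"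
begin

definition H :: "'m \<Rightarrow> real \<Rightarrow> real" where "H \<theta> t = 1 - F \<theta> t"

lemma F_strict_mono: "\<theta> \<in> space M \<Longrightarrow> 0 < s \<Longrightarrow> s < t \<Longrightarrow> F \<theta> s < F \<theta> t"
  by (rule DERIV_pos_imp_increasing[where f="F \<theta>"]) (assumption, meson F_deriv f_pos less_le_trans)

lemma F_pos: assumes "\<theta> \<in> space M" "0 < t" shows "0 < F \<theta> t"
proof -
  have "0 \<le> F \<theta> (t / 2)"
  proof (rule tendsto_upperbound[OF F_at_0[OF assms(1)]])
    have "\<forall>\<^sub>F s in at_right 0. 0 < s \<and> s < t / 2" using assms(2)
      unfolding eventually_at_right_field by (intro exI[of _ "t / 2"]) auto
    then show "\<forall>\<^sub>F s in at_right 0. F \<theta> s \<le> F \<theta> (t / 2)"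
      by eventually_elim (use F_strict_mono assms in \<open>auto intro: less_imp_le\<close>)
  qed simp
  also have "\<dots> < F \<theta> t" using assms by (intro F_strict_mono) auto
  finally show ?thesis .
qed

lemma F_less_1: assumes "\<theta> \<in> space M" "0 < t" shows "F \<theta> t < 1"
proof -
  have "F \<theta> t < F \<theta> (t + 1)" using assms by (intro F_strict_mono) auto
  also have "\<dots> \<le> 1"
  proof (rule tendsto_lowerbound[OF F_at_top[OF assms(1)]])
    show "\<forall>\<^sub>F s in at_top. F \<theta> (t + 1) \<le> F \<theta> s"
      using eventually_gt_at_top[of "t + 1"]
      by eventually_elim (use F_strict_mono[of \<theta> "t+1"] assms in \<open>auto intro: less_imp_le\<close>)
  qed simp
  finally show ?thesis .
qed

lemma H_bounds: "\<theta> \<in> space M \<Longrightarrow> 0 < t \<Longrightarrow> 0 < H \<theta> t \<and> H \<theta> t < 1"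
  using F_pos F_less_1 by (auto simp: H_def)

lemma H_strict_anti: "\<theta> \<in> space M \<Longrightarrow> 0 < s \<Longrightarrow> s < t \<Longrightarrow> H \<theta> t < H \<theta> s"
  using F_strict_mono by (auto simp: H_def)

lemma H_meas[measurable]: "t > 0 \<Longrightarrow> (\<lambda>\<theta>. H \<theta> t) \<in> borel_measurable M"
  unfolding H_def by measurable

lemma H_deriv: "\<theta> \<in> space M \<Longrightarrow> t > 0 \<Longrightarrow> (H \<theta> has_real_derivative - f \<theta> t) (at t)"
  unfolding H_def[abs_def] by (auto intro!: derivative_eq_intros F_deriv)

lemma H_cont: "\<theta> \<in> space M \<Longrightarrow> t > 0 \<Longrightarrow> isCont (H \<theta>) t"
  using H_deriv by (auto intro: DERIV_isCont)

lemma f_isCont: "\<theta> \<in> space M \<Longrightarrow> t > 0 \<Longrightarrow> isCont (f \<theta>) t"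
  using f_cont[of \<theta>] by (auto simp: continuous_on_eq_continuous_at)

lemma F_quotient_tendsto:
  assumes "\<theta> \<in> space M" "t > 0" "X \<longlonglongrightarrow> t" "\<And>n. X n \<noteq> t"
  shows "(\<lambda>n. (F \<theta> (X n) - F \<theta> t) / (X n - t)) \<longlonglongrightarrow> f \<theta> t"
  using F_deriv[OF assms(1,2)] assms(3,4)
  by (auto simp: has_field_derivative_iff tendsto_at_iff_sequentially comp_def)

lemma F_quotient_le:
  assumes "\<theta> \<in> space M" "0 < s" "s < t"
  shows "0 < (F \<theta> t - F \<theta> s) / (t - s)" "(F \<theta> t - F \<theta> s) / (t - s) \<le> C \<theta>"
proof -
  obtain z where z: "s < z" "z < t" "F \<theta> t - F \<theta> s = (t - s) * f \<theta> z"
    using MVT2[of s t "F \<theta>" "f \<theta>"] assms F_deriv by force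
  then show "0 < (F \<theta> t - F \<theta> s) / (t - s)" "(F \<theta> t - F \<theta> s) / (t - s) \<le> C \<theta>"
    using f_pos[of \<theta> z] f_le[of \<theta> z] assms by simp_all
qed

text \<open>Measurability in \<theta> is assumed for \<open>F\<close> only; the density inherits it
  as a limit of difference quotients.\<close>

lemma f_meas[measurable]:
  assumes "t > 0" shows "(\<lambda>\<theta>. f \<theta> t) \<in> borel_measurable M"
proof (rule borel_measurable_LIMSEQ_real)
  define X where "X = (\<lambda>n. t + inverse (real (Suc n)))"
  have X: "X n > t" for n by (simp add: X_def)
  have Xl: "X \<longlonglongrightarrow> t" unfolding X_def
    using tendsto_add[OF tendsto_const[of t] LIMSEQ_inverse_real_of_nat] by simp
  show "(\<lambda>n. (F \<theta> (X n) - F \<theta> t) / (X n - t)) \<longlonglongrightarrow> f \<theta> t" if "\<theta> \<in> space M" for \<theta>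
    using F_quotient_tendsto[OF that assms Xl] X by (metis less_irrefl)
  show "(\<lambda>\<theta>. (F \<theta> (X n) - F \<theta> t) / (X n - t)) \<in> borel_measurable M" for n
    using assms X[of n] by (intro borel_measurable_divide borel_measurable_diff F_meas) auto
qed

lemma integrable_dominated:
  assumes "g \<in> borel_measurable M" "\<And>\<theta>. \<theta> \<in> space M \<Longrightarrow> \<bar>g \<theta>\<bar> \<le> C \<theta>"
  shows "integrable M (g :: 'm \<Rightarrow> real)"
  using C_int assms(1) by (rule Bochner_Integration.integrable_bound) (use assms(2) in \<open>force\<close>)

lemma integrable_bounded1:
  assumes "g \<in> borel_measurable M" "\<And>\<theta>. \<theta> \<in> space M \<Longrightarrow> \<bar>g \<theta>\<bar> \<le> 1"
  shows "integrable M (g :: 'm \<Rightarrow> real)"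
  by (rule integrable_const_bound[of _ 1]) (use assms in auto)

lemma integral_pos:
  assumes "integrable M g" "\<And>\<theta>. \<theta> \<in> space M \<Longrightarrow> (0::real) < g \<theta>"
  shows "0 < (\<integral>\<theta>. g \<theta> \<partial>M)"
proof -
  have "(\<integral>\<theta>. g \<theta> \<partial>M) \<noteq> 0"
  proof
    assume "(\<integral>\<theta>. g \<theta> \<partial>M) = 0"
    then have "AE \<theta> in M. g \<theta> = 0"
      using assms by (subst (asm) integral_nonneg_eq_0_iff_AE) (auto intro: less_imp_le)
    then have "AE \<theta> in M. False" using AE_space by eventually_elim (use assms(2) in force)
    then show False by simp
  qed
  moreover have "0 \<le> (\<integral>\<theta>. g \<theta> \<partial>M)" using assms(2) by (intro integral_nonneg_AE AE_I2) (auto intro: less_imp_le)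
  ultimately show ?thesis by linarith
qed

text \<open>For gaps that are independent given \<theta>, this is the probability that the first
  lies in \<open>(x, y]\<close>, the second exceeds \<open>v\<close>, and an event of the other gaps
  with conditional probability \<open>X \<theta>\<close> occurs.\<close>

definition gain :: "('m \<Rightarrow> real) \<Rightarrow> real \<Rightarrow> real \<Rightarrow> real \<Rightarrow> real" where
  "gain X x y v = (\<integral>\<theta>. X \<theta> * (F \<theta> y - F \<theta> x) * H \<theta> v \<partial>M)"

text \<open>In the application \<open>r\<close> is the distribution function of the first arrival
  given count one at \<open>t\<close>. The middle term is the probability that the first arrival
  lies in \<open>(x, x']\<close> and the second beyond \<open>u\<close>; moving the first arrival to
  either end of the interval gives the bounds.\<close>

definition splits :: "('m \<Rightarrow> real) \<Rightarrow> real \<Rightarrow> bool" where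
  "splits X t \<longleftrightarrow> (\<exists>r \<beta>. \<forall>x x' u. 0 < x \<longrightarrow> x < x' \<longrightarrow> x' < t \<longrightarrow> t \<le> u \<longrightarrow>
     gain X x x' (u - x) \<le> (r x' - r x) * \<beta> u \<and> (r x' - r x) * \<beta> u \<le> gain X x x' (u - x'))"

text \<open>
  The joint law of the first two arrival times is only used through these two bounds, so no convolution is
  needed; letting \<open>x'\<close> decrease to \<open>x\<close> turns them into a pointwise identity.
\<close>

lemma sandwich_factorization:
  assumes X: "X \<in> borel_measurable M" "\<And>\<theta>. \<theta> \<in> space M \<Longrightarrow> 0 < X \<theta> \<and> X \<theta> \<le> 1"
    and low: "\<And>x x' u. 0 < x \<Longrightarrow> x < x' \<Longrightarrow> x' < t \<Longrightarrow> t \<le> u \<Longrightarrow> gain X x x' (u - x) \<le> (r x' - r x) * \<beta> u"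
    and up: "\<And>x x' u. 0 < x \<Longrightarrow> x < x' \<Longrightarrow> x' < t \<Longrightarrow> t \<le> u \<Longrightarrow> (r x' - r x) * \<beta> u \<le> gain X x x' (u - x')"
    and x: "0 < x" "x < t" and u: "t \<le> u" "t \<le> u'"
  shows "(\<integral>\<theta>. X \<theta> * f \<theta> x * H \<theta> (u - x) \<partial>M) * \<beta> u' = (\<integral>\<theta>. X \<theta> * f \<theta> x * H \<theta> (u' - x) \<partial>M) * \<beta> u"
proof -
  define g where "g = (\<lambda>u. \<integral>\<theta>. X \<theta> * f \<theta> x * H \<theta> (u - x) \<partial>M)"
  \<comment> \<open>A sequence in \<open>(x, t)\<close> tending to \<open>x\<close>; the shift by
    two keeps it strictly below \<open>t\<close>.\<close>
  define Y where "Y = (\<lambda>n. x + (t - x) * inverse (real (Suc (Suc n))))"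
  have Y: "x < Y n" "Y n < t" for n
  proof -
    define c where "c = inverse (real (Suc (Suc n)))"
    have c: "0 < c" "c < 1" by (simp_all add: c_def field_simps)
    then have "0 < (t - x) * c" "(t - x) * c < (t - x) * 1"
      using x by (intro mult_pos_pos mult_strict_left_mono; simp)+
    then show "x < Y n" "Y n < t" unfolding Y_def c_def[symmetric] by auto
  qed
  have Ylim: "Y \<longlonglongrightarrow> x"
    unfolding Y_def
    using tendsto_add[OF tendsto_const[of x] tendsto_mult[OF tendsto_const[of "t - x"] LIMSEQ_Suc[OF LIMSEQ_inverse_real_of_nat]]]
    by simp
  \<comment> \<open>\<open>r\<close> is not known to be differentiable; only the products
    \<open>q n * \<beta> v\<close> are shown to converge.\<close>
  define q where "q = (\<lambda>n. (r (Y n) - r x) / (Y n - x))"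
  note [measurable] = X(1)
  have lim: "(\<lambda>n. q n * \<beta> v) \<longlonglongrightarrow> g v" if v: "t \<le> v" for v
  proof (rule tendsto_sandwich)
    have Xb: "\<bar>X \<theta> * ((F \<theta> (Y n) - F \<theta> x) / (Y n - x)) * H \<theta> w\<bar> \<le> C \<theta>"
      if "\<theta> \<in> space M" "w > 0" for \<theta> n w
    proof -
      have "\<bar>X \<theta> * ((F \<theta> (Y n) - F \<theta> x) / (Y n - x)) * H \<theta> w\<bar> =
         X \<theta> * ((F \<theta> (Y n) - F \<theta> x) / (Y n - x)) * H \<theta> w"
        using X(2)[OF that(1)] F_quotient_le(1)[OF that(1) x(1) Y(1)[of n]] H_bounds[OF that]
        by (intro abs_of_nonneg mult_nonneg_nonneg) auto
      also have "\<dots> \<le> 1 * C \<theta> * 1"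
        using X(2)[OF that(1)] F_quotient_le[OF that(1) x(1) Y(1)[of n]] H_bounds[OF that]
        by (intro mult_mono) auto
      finally show ?thesis by simp
    qed
    \<comment> \<open>\<open>W\<close> is the constant \<open>x\<close> in the lower bound and
      \<open>Y\<close> in the upper one. Both tend to \<open>x\<close>, so the two bounds share the
      limit \<open>g v\<close>.\<close>
    have dct: "(\<lambda>n. \<integral>\<theta>. X \<theta> * ((F \<theta> (Y n) - F \<theta> x) / (Y n - x)) * H \<theta> (v - W n) \<partial>M) \<longlonglongrightarrow> g v"
      if W: "W \<longlonglongrightarrow> x" "\<And>n. W n < t" for W
      unfolding g_def
    proof (rule integral_dominated_convergence[where w=C])
      show "(\<lambda>\<theta>. X \<theta> * f \<theta> x * H \<theta> (v - x)) \<in> borel_measurable M" using x v by (intro borel_measurable_times X f_meas H_meas) auto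
      show "(\<lambda>\<theta>. X \<theta> * ((F \<theta> (Y n) - F \<theta> x) / (Y n - x)) * H \<theta> (v - W n)) \<in> borel_measurable M" for n
        using x v W(2)[of n] Y(1)[of n]
        by (intro borel_measurable_times X borel_measurable_divide borel_measurable_diff F_meas H_meas) auto
      show "AE \<theta> in M. norm (X \<theta> * ((F \<theta> (Y n) - F \<theta> x) / (Y n - x)) * H \<theta> (v - W n)) \<le> C \<theta>" for n
        using Xb[of _ "v - W n" n] W(2)[of n] v by (intro AE_I2) auto
      show "AE \<theta> in M. (\<lambda>n. X \<theta> * ((F \<theta> (Y n) - F \<theta> x) / (Y n - x)) * H \<theta> (v - W n)) \<longlonglongrightarrow> X \<theta> * f \<theta> x * H \<theta> (v - x)"
      proof (rule AE_I2)
        fix \<theta> assume \<theta>: "\<theta> \<in> space M"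
        have "(\<lambda>n. H \<theta> (v - W n)) \<longlonglongrightarrow> H \<theta> (v - x)"
          using x v W by (intro isCont_tendsto_compose[OF H_cont[OF \<theta>]] tendsto_intros) auto
        moreover have "(\<lambda>n. (F \<theta> (Y n) - F \<theta> x) / (Y n - x)) \<longlonglongrightarrow> f \<theta> x"
          by (rule F_quotient_tendsto[OF \<theta> x(1) Ylim]) (use Y in \<open>metis less_irrefl\<close>)
        ultimately show "(\<lambda>n. X \<theta> * ((F \<theta> (Y n) - F \<theta> x) / (Y n - x)) * H \<theta> (v - W n)) \<longlonglongrightarrow> X \<theta> * f \<theta> x * H \<theta> (v - x)"
          by (intro tendsto_intros)
      qed
    qed (rule C_int)
    have eq: "(\<integral>\<theta>. X \<theta> * ((F \<theta> (Y n) - F \<theta> x) / (Y n - x)) * H \<theta> w \<partial>M) =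
       (\<integral>\<theta>. X \<theta> * (F \<theta> (Y n) - F \<theta> x) * H \<theta> w \<partial>M) / (Y n - x)" for n w
      by (subst Bochner_Integration.integral_divide_zero[symmetric]) (simp add: mult_ac)
    show "(\<lambda>n. \<integral>\<theta>. X \<theta> * ((F \<theta> (Y n) - F \<theta> x) / (Y n - x)) * H \<theta> (v - x) \<partial>M) \<longlonglongrightarrow> g v"
      using x by (intro dct) auto
    show "(\<lambda>n. \<integral>\<theta>. X \<theta> * ((F \<theta> (Y n) - F \<theta> x) / (Y n - x)) * H \<theta> (v - Y n) \<partial>M) \<longlonglongrightarrow> g v"
      using Ylim Y by (intro dct) auto
    show "\<forall>\<^sub>F n in sequentially. (\<integral>\<theta>. X \<theta> * ((F \<theta> (Y n) - F \<theta> x) / (Y n - x)) * H \<theta> (v - x) \<partial>M) \<le> q n * \<beta> v"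
      using low[OF x(1) Y(1) Y(2) v] less_imp_le[OF Y(1)]
      by (intro always_eventually allI) (simp add: eq gain_def[symmetric] q_def divide_right_mono)
    show "\<forall>\<^sub>F n in sequentially. q n * \<beta> v \<le> (\<integral>\<theta>. X \<theta> * ((F \<theta> (Y n) - F \<theta> x) / (Y n - x)) * H \<theta> (v - Y n) \<partial>M)"
      using up[OF x(1) Y(1) Y(2) v] less_imp_le[OF Y(1)]
      by (intro always_eventually allI) (simp add: eq gain_def[symmetric] q_def divide_right_mono)
  qed
  \<comment> \<open>One sequence is read in two ways, as a multiple of
    \<open>q n * \<beta> u\<close> and of \<open>q n * \<beta> u'\<close>; uniqueness of limits
    eliminates \<open>q\<close>.\<close>
  have "(\<lambda>n. q n * \<beta> u * \<beta> u') \<longlonglongrightarrow> g u * \<beta> u'"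
    by (intro tendsto_intros lim u)
  moreover have "(\<lambda>n. q n * \<beta> u * \<beta> u') \<longlonglongrightarrow> g u' * \<beta> u"
    using tendsto_mult_right[OF lim[OF u(2)], of "\<beta> u"] by (simp add: mult_ac)
  ultimately show ?thesis unfolding g_def by (rule LIMSEQ_unique)
qed

section \<open>The weighted joint survival function of two gaps\<close>

definition J :: "('m \<Rightarrow> real) \<Rightarrow> real \<Rightarrow> real \<Rightarrow> real" where
  "J X y v = (\<integral>\<theta>. X \<theta> * H \<theta> y * H \<theta> v \<partial>M)"

text \<open>By \<open>J_deriv\<close> this is minus the partial derivative of \<open>J\<close> in
  its first argument.\<close>

definition g :: "('m \<Rightarrow> real) \<Rightarrow> real \<Rightarrow> real \<Rightarrow> real" where
  "g X y v = (\<integral>\<theta>. X \<theta> * f \<theta> y * H \<theta> v \<partial>M)"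

context
  fixes X :: "'m \<Rightarrow> real"
  assumes X[measurable]: "X \<in> borel_measurable M"
    and X01: "\<And>\<theta>. \<theta> \<in> space M \<Longrightarrow> 0 < X \<theta> \<and> X \<theta> \<le> 1"
begin

lemma g_bound:
  assumes "\<theta> \<in> space M" "0 < y" "0 < v"
  shows "0 < X \<theta> * f \<theta> y * H \<theta> v" "X \<theta> * f \<theta> y * H \<theta> v \<le> C \<theta>" "\<bar>X \<theta> * f \<theta> y * H \<theta> v\<bar> \<le> C \<theta>"
proof -
  show 1: "0 < X \<theta> * f \<theta> y * H \<theta> v"
    using X01 f_pos H_bounds assms by (simp add: mult_pos_pos)
  have "X \<theta> * f \<theta> y * H \<theta> v \<le> 1 * C \<theta> * 1"
    using X01[of \<theta>] f_pos[of \<theta> y] f_le[of \<theta> y] H_bounds[of \<theta> v] assms by (intro mult_mono) auto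
  then show "X \<theta> * f \<theta> y * H \<theta> v \<le> C \<theta>" by simp
  with 1 show "\<bar>X \<theta> * f \<theta> y * H \<theta> v\<bar> \<le> C \<theta>" by simp
qed

lemma g_integrable: "0 < y \<Longrightarrow> 0 < v \<Longrightarrow> integrable M (\<lambda>\<theta>. X \<theta> * f \<theta> y * H \<theta> v)"
  by (rule integrable_dominated) (use g_bound in auto)

lemma J_bound:
  assumes "\<theta> \<in> space M" "0 < y" "0 < v"
  shows "\<bar>X \<theta> * H \<theta> y * H \<theta> v\<bar> \<le> 1"
proof -
  have "0 < X \<theta> * H \<theta> y * H \<theta> v" using X01 H_bounds assms by (simp add: mult_pos_pos)
  moreover have "X \<theta> * H \<theta> y * H \<theta> v \<le> 1 * 1 * 1"
    using X01[of \<theta>] H_bounds[of \<theta>] assms by (intro mult_mono) (auto intro: less_imp_le)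
  ultimately show ?thesis by simp
qed

lemma J_integrable: "0 < y \<Longrightarrow> 0 < v \<Longrightarrow> integrable M (\<lambda>\<theta>. X \<theta> * H \<theta> y * H \<theta> v)"
  by (rule integrable_bounded1) (use J_bound in auto)

lemma J_commute: "J X y v = J X v y"
  unfolding J_def by (simp add: mult_ac)

lemma g_pos: "0 < y \<Longrightarrow> 0 < v \<Longrightarrow> 0 < g X y v"
  unfolding g_def by (rule integral_pos) (use g_integrable g_bound in auto)

text \<open>Strictness makes \<beta> injective in \<open>g_symmetric\<close>, which keeps increments
  over squares away from 0.\<close>

lemma g_strict_anti: "0 < y \<Longrightarrow> 0 < v \<Longrightarrow> v < v' \<Longrightarrow> g X y v' < g X y v"
proof -
  assume *: "0 < y" "0 < v" "v < v'"
  have "0 < (\<integral>\<theta>. X \<theta> * f \<theta> y * H \<theta> v - X \<theta> * f \<theta> y * H \<theta> v' \<partial>M)"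
  proof (rule integral_pos)
    show "0 < X \<theta> * f \<theta> y * H \<theta> v - X \<theta> * f \<theta> y * H \<theta> v'" if "\<theta> \<in> space M" for \<theta>
      using H_strict_anti[OF that *(2,3)] X01[OF that] f_pos[OF that *(1)] by simp
  qed (use * g_integrable in auto)
  then show ?thesis using * g_integrable by (simp add: g_def)
qed

lemma g_tendsto:
  assumes "0 < y" "0 < v" "Y \<longlonglongrightarrow> y" "V \<longlonglongrightarrow> v" "\<And>n. 0 < Y n" "\<And>n. 0 < V n"
  shows "(\<lambda>n. g X (Y n) (V n)) \<longlonglongrightarrow> g X y v"
  unfolding g_def
proof (rule integral_dominated_convergence[where w=C])
  show "AE \<theta> in M. (\<lambda>n. X \<theta> * f \<theta> (Y n) * H \<theta> (V n)) \<longlonglongrightarrow> X \<theta> * f \<theta> y * H \<theta> v"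
    using assms by (intro AE_I2 tendsto_intros isCont_tendsto_compose[OF H_cont] isCont_tendsto_compose[OF f_isCont])
  show "AE \<theta> in M. norm (X \<theta> * f \<theta> (Y n) * H \<theta> (V n)) \<le> C \<theta>" for n
    using g_bound(3) assms by (intro AE_I2) auto
qed (use assms C_int in \<open>auto intro!: borel_measurable_times f_meas H_meas\<close>)

lemma J_deriv:
  assumes "0 < y" "0 < v"
  shows "((\<lambda>y. J X y v) has_real_derivative - g X y v) (at y)"
proof -
  have "((\<lambda>y. \<integral>\<theta>. X \<theta> * H \<theta> y * H \<theta> v \<partial>M) has_real_derivative (\<integral>\<theta>. X \<theta> * (- f \<theta> y) * H \<theta> v \<partial>M)) (at y)"
  proof (rule has_real_derivative_integral[where a=0 and b="y+1" and C=C and \<phi>'="\<lambda>y \<theta>. X \<theta> * (- f \<theta> y) * H \<theta> v"])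
    fix s \<theta> assume s: "0 < s" "s < y + 1" and \<theta>: "\<theta> \<in> space M"
    show "((\<lambda>s. X \<theta> * H \<theta> s * H \<theta> v) has_real_derivative X \<theta> * (- f \<theta> s) * H \<theta> v) (at s)"
      using s \<theta> by (auto intro!: derivative_eq_intros H_deriv)
    show "\<bar>X \<theta> * (- f \<theta> s) * H \<theta> v\<bar> \<le> C \<theta>" using g_bound(3)[OF \<theta> s(1) assms(2)] by (simp add: abs_mult)
  qed (use assms C_int J_integrable in auto)
  then show ?thesis by (simp add: J_def g_def)
qed

text \<open>The derivative vanishes where \<open>g\<close> is symmetric, so constancy along
  \<open>w + v = s\<close> reduces to symmetry of \<open>g\<close>.\<close>

lemma J_antidiagonal_deriv:
  assumes "0 < w" "w < s"
  shows "((\<lambda>w. J X w (s - w)) has_real_derivative g X (s - w) w - g X w (s - w)) (at w)"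
proof -
  have "((\<lambda>w. \<integral>\<theta>. X \<theta> * H \<theta> w * H \<theta> (s - w) \<partial>M) has_real_derivative
     (\<integral>\<theta>. X \<theta> * f \<theta> (s - w) * H \<theta> w - X \<theta> * f \<theta> w * H \<theta> (s - w) \<partial>M)) (at w)"
  proof (rule has_real_derivative_integral[where a=0 and b=s and C="\<lambda>\<theta>. 2 * C \<theta>" and
        \<phi>'="\<lambda>w \<theta>. X \<theta> * f \<theta> (s - w) * H \<theta> w - X \<theta> * f \<theta> w * H \<theta> (s - w)"])
    fix w \<theta> assume w: "0 < w" "w < s" and \<theta>: "\<theta> \<in> space M"
    show "((\<lambda>w. X \<theta> * H \<theta> w * H \<theta> (s - w)) has_real_derivative
        X \<theta> * f \<theta> (s - w) * H \<theta> w - X \<theta> * f \<theta> w * H \<theta> (s - w)) (at w)"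
    proof -
      have "((\<lambda>w. H \<theta> (s - w)) has_real_derivative - f \<theta> (s - w) * (0 - 1)) (at w)"
        using w \<theta> by (intro DERIV_chain2[where f="H \<theta>"] H_deriv derivative_intros) auto
      then show ?thesis
        using w \<theta> by (auto intro!: derivative_eq_intros H_deriv simp: algebra_simps)
    qed
    show "\<bar>X \<theta> * f \<theta> (s - w) * H \<theta> w - X \<theta> * f \<theta> w * H \<theta> (s - w)\<bar> \<le> 2 * C \<theta>"
      using g_bound(3)[OF \<theta>, of "s - w" w] g_bound(3)[OF \<theta>, of w "s - w"] w by linarith
  qed (use assms C_int J_integrable in auto)
  also have "(\<integral>\<theta>. X \<theta> * f \<theta> (s - w) * H \<theta> w - X \<theta> * f \<theta> w * H \<theta> (s - w) \<partial>M) = g X (s - w) w - g X w (s - w)"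
    unfolding g_def using assms by (intro Bochner_Integration.integral_diff g_integrable) auto
  finally show ?thesis unfolding J_def .
qed

text \<open>
  The mean value theorem is applied relative to a function whose increment \<open>m\<close> depends on \<open>y\<close>, \<open>v\<close> only through
  \<open>y + v\<close>, so that exchanging \<open>y\<close> and \<open>v\<close> leaves \<open>m\<close> unchanged.
\<close>

lemma rectangle_increment:
  assumes t: "0 < y" "0 < v" "y + \<delta> < t" "t < y + v" "0 < \<delta>"
    and \<beta>: "continuous_on {t..} \<beta>" "\<And>u u'. t \<le> u \<Longrightarrow> u < u' \<Longrightarrow> \<beta> u \<noteq> \<beta> u'"
    and g: "\<And>x u. 0 < x \<Longrightarrow> x < t \<Longrightarrow> t \<le> u \<Longrightarrow> g X x (u - x) = a x * \<beta> u"
  defines "B \<equiv> (\<lambda>u. integral {t..u} \<beta>)"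
  defines "m \<equiv> B (y + v + 2 * \<delta>) - 2 * B (y + v + \<delta>) + B (y + v)"
  obtains \<xi> where "y < \<xi>" "\<xi> < y + \<delta>" "m \<noteq> 0"
    "J X (y + \<delta>) v - J X (y + \<delta>) (v + \<delta>) - J X y v + J X y (v + \<delta>) = a \<xi> * m"
proof -
  \<comment> \<open>Strictly beyond \<open>t\<close> the primitive has a two-sided derivative;
    \<open>t < y + v\<close> keeps all arguments there.\<close>
  have B: "(B has_real_derivative \<beta> u) (at u)" if "t < u" for u
  proof -
    have "(B has_real_derivative \<beta> u) (at u within {t..u+1})"
      unfolding B_def using that \<beta>(1)
      by (intro integral_has_real_derivative continuous_on_subset[OF \<beta>(1)]) auto
    moreover have "at u within {t..u+1} = at u" using that by (intro at_within_interior) auto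
    ultimately show ?thesis by simp
  qed
  define \<phi> where "\<phi> = (\<lambda>w. J X w v - J X w (v + \<delta>))"
  define \<psi> where "\<psi> = (\<lambda>w. B (w + v + \<delta>) - B (w + v))"
  define \<psi>' where "\<psi>' = (\<lambda>w. \<beta> (w + v + \<delta>) - \<beta> (w + v))"
  have \<phi>: "(\<phi> has_real_derivative a w * \<psi>' w) (at w)" if "y \<le> w" "w \<le> y + \<delta>" for w
  proof -
    have "(\<phi> has_real_derivative - g X w v - - g X w (v + \<delta>)) (at w)"
      unfolding \<phi>_def using that t by (intro DERIV_diff J_deriv) auto
    also have "- g X w v - - g X w (v + \<delta>) = a w * \<psi>' w"
      using g[of w "w + v"] g[of w "w + v + \<delta>"] that t by (simp add: \<psi>'_def algebra_simps)
    finally show ?thesis .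
  qed
  have \<psi>: "(\<psi> has_real_derivative \<psi>' w) (at w)" if "y \<le> w" "w \<le> y + \<delta>" for w
    unfolding \<psi>_def \<psi>'_def using that t
    by (auto intro!: derivative_eq_intros DERIV_chain2[where f=B, OF B])
  have \<psi>'0: "\<psi>' w \<noteq> 0" if "y \<le> w" for w
    using \<beta>(2)[of "w + v" "w + v + \<delta>"] that t by (simp add: \<psi>'_def)
  have m: "\<psi> (y + \<delta>) - \<psi> y = m"
    by (simp add: \<psi>_def m_def algebra_simps)
  \<comment> \<open>Cauchy's mean value theorem compares \<phi> with \<psi> and needs no regularity
    of \<open>a\<close>; the nonzero factor \<open>\<psi>' \<xi>\<close> cancels.\<close>
  have "\<exists>\<xi>>y. \<xi> < y + \<delta> \<and> (\<phi> (y + \<delta>) - \<phi> y) * \<psi>' \<xi> = (\<psi> (y + \<delta>) - \<psi> y) * (a \<xi> * \<psi>' \<xi>)"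
    using \<phi> \<psi> t by (intro GMVT') (auto intro!: DERIV_isCont)
  then obtain \<xi> where \<xi>: "y < \<xi>" "\<xi> < y + \<delta>" "(\<phi> (y + \<delta>) - \<phi> y) * \<psi>' \<xi> = m * (a \<xi> * \<psi>' \<xi>)"
    by (auto simp: m)
  then have "\<phi> (y + \<delta>) - \<phi> y = a \<xi> * m" using \<psi>'0[of \<xi>] by (simp add: mult_ac)
  moreover have "m \<noteq> 0"
  proof -
    obtain z where "y < z" "\<psi> (y + \<delta>) - \<psi> y = (y + \<delta> - y) * \<psi>' z"
      using MVT2[of y "y + \<delta>" \<psi> \<psi>'] \<psi> t by force
    then show ?thesis using \<psi>'0[of z] t m by auto
  qed
  ultimately show thesis using that[of \<xi>] \<xi> by (simp add: \<phi>_def)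
qed

text \<open>By symmetry of \<open>J\<close>, its increments over the square with corner
  \<open>(y, v)\<close> and over the reflected square agree, and both are a value of
  \<open>a\<close> times the same nonzero \<open>m\<close>. Hence \<open>a\<close> takes a common
  value arbitrarily close to \<open>y\<close> and to \<open>v\<close>; continuity gives
  \<open>a y = a v\<close>, and the factor \<open>\<beta> (y + v)\<close> is common to both
  sides.\<close>

lemma g_symmetric:
  assumes yv: "0 < y" "0 < v" "y < t" "v < t" "t < y + v"
    and \<beta>0: "\<And>u. t \<le> u \<Longrightarrow> \<beta> u \<noteq> 0"
    and fac: "\<And>x u u'. 0 < x \<Longrightarrow> x < t \<Longrightarrow> t \<le> u \<Longrightarrow> t \<le> u' \<Longrightarrow>
      g X x (u - x) * \<beta> u' = g X x (u' - x) * \<beta> u"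
  shows "g X y v = g X v y"
proof -
  \<comment> \<open>The ratio of \<open>g\<close> to \<beta> at fixed \<open>x\<close>, normalised
    at the admissible value \<open>y + v\<close>.\<close>
  define a where "a = (\<lambda>x. g X x (y + v - x) / \<beta> (y + v))"
  have g: "g X x (u - x) = a x * \<beta> u" if "0 < x" "x < t" "t \<le> u" for x u
    using fac[OF that, of "y + v"] \<beta>0[of "y + v"] yv by (simp add: a_def field_simps)
  have a0: "a x \<noteq> 0" if "0 < x" "x < t" for x
    using g[of x t] g_pos[of x "t - x"] that by auto
  \<comment> \<open>Any point of \<open>(0, t)\<close> would serve: through it \<beta> is a multiple
    of \<open>g\<close> and inherits continuity and injectivity.\<close>
  define x0 where "x0 = t / 2"
  have x0: "0 < x0" "x0 < t" using yv by (auto simp: x0_def)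
  have \<beta>_eq: "\<beta> u = g X x0 (u - x0) / a x0" if "t \<le> u" for u
    using g[OF x0 that] a0[OF x0] by (simp add: field_simps)
  have \<beta>_inj: "\<beta> u \<noteq> \<beta> u'" if "t \<le> u" "u < u'" for u u'
    using g_strict_anti[of x0 "u - x0" "u' - x0"] \<beta>_eq[of u] \<beta>_eq[of u'] a0[OF x0] x0 that by auto
  have \<beta>_cont: "continuous_on {t..} \<beta>"
    unfolding continuous_on_sequentially
  proof safe
    fix U u assume u: "u \<ge> t" and U: "\<forall>n. U n \<in> {t..}" "U \<longlonglongrightarrow> u"
    have "(\<lambda>n. g X x0 (U n - x0) / a x0) \<longlonglongrightarrow> g X x0 (u - x0) / a x0"
      using u U x0 a0[OF x0] by (intro tendsto_divide tendsto_const g_tendsto tendsto_diff) (auto intro: less_le_trans)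
    then show "(\<beta> \<circ> U) \<longlonglongrightarrow> \<beta> u" using \<beta>_eq u U(1) by (simp add: comp_def)
  qed
  have ex: "\<exists>\<xi> \<eta>. y < \<xi> \<and> \<xi> < y + \<delta> \<and> v < \<eta> \<and> \<eta> < v + \<delta> \<and> a \<xi> = a \<eta>"
    if \<delta>: "0 < \<delta>" "y + \<delta> < t" "v + \<delta> < t" for \<delta>
  proof -
    define B where "B = (\<lambda>u. integral {t..u} \<beta>)"
    define m where "m = B (y + v + 2 * \<delta>) - 2 * B (y + v + \<delta>) + B (y + v)"
    obtain \<xi> where \<xi>: "y < \<xi>" "\<xi> < y + \<delta>" "m \<noteq> 0"
      "J X (y + \<delta>) v - J X (y + \<delta>) (v + \<delta>) - J X y v + J X y (v + \<delta>) = a \<xi> * m"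
      unfolding m_def B_def
      by (rule rectangle_increment[of y v \<delta> t \<beta> a]) (use yv \<delta> \<beta>_cont \<beta>_inj g in auto)
    have m': "m = B (v + y + 2 * \<delta>) - 2 * B (v + y + \<delta>) + B (v + y)" by (simp add: m_def add.commute)
    obtain \<eta> where \<eta>: "v < \<eta>" "\<eta> < v + \<delta>" "m \<noteq> 0"
      "J X (v + \<delta>) y - J X (v + \<delta>) (y + \<delta>) - J X v y + J X v (y + \<delta>) = a \<eta> * m"
      unfolding m' B_def
      by (rule rectangle_increment[of v y \<delta> t \<beta> a]) (use yv \<delta> \<beta>_cont \<beta>_inj g in auto)
    have "a \<xi> * m = a \<eta> * m"
      using \<xi>(4) \<eta>(4) J_commute[of "v + \<delta>" y] J_commute[of "v + \<delta>" "y + \<delta>"] J_commute[of v y] J_commute[of v "y + \<delta>"]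
      by linarith
    then show ?thesis using \<xi> \<eta> by auto
  qed
  \<comment> \<open>Side lengths tending to 0 for which both squares keep their sides below
    \<open>t\<close>.\<close>
  define d where "d = (\<lambda>n. min (t - y) (t - v) * inverse (real (Suc (Suc n))))"
  have d: "0 < d n" "d n < min (t - y) (t - v)" for n
  proof -
    define c where "c = inverse (real (Suc (Suc n)))"
    have c: "0 < c" "c < 1" by (simp_all add: c_def field_simps)
    moreover have M: "0 < min (t - y) (t - v)" using yv by auto
    ultimately have "0 < min (t - y) (t - v) * c" "min (t - y) (t - v) * c < min (t - y) (t - v) * 1"
      by (intro mult_pos_pos mult_strict_left_mono; simp)+
    then show "0 < d n" "d n < min (t - y) (t - v)" unfolding d_def c_def[symmetric] by auto
  qed
  have dlim: "d \<longlonglongrightarrow> 0"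
    unfolding d_def
    using tendsto_mult[OF tendsto_const[of "min (t - y) (t - v)"] LIMSEQ_Suc[OF LIMSEQ_inverse_real_of_nat]] by simp
  have "\<exists>\<xi> \<eta>. y < \<xi> \<and> \<xi> < y + d n \<and> v < \<eta> \<and> \<eta> < v + d n \<and> a \<xi> = a \<eta>" for n
    using d[of n] by (intro ex) auto
  then obtain \<xi> \<eta> where \<xi>\<eta>: "\<And>n. y < \<xi> n" "\<And>n. \<xi> n < y + d n" "\<And>n. v < \<eta> n" "\<And>n. \<eta> n < v + d n" "\<And>n. a (\<xi> n) = a (\<eta> n)"
    by metis
  have lim: "\<xi> \<longlonglongrightarrow> y" "\<eta> \<longlonglongrightarrow> v"
  proof -
    show "\<xi> \<longlonglongrightarrow> y"
      using \<xi>\<eta>(1,2) tendsto_add[OF tendsto_const[of y] dlim]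
      by (intro tendsto_sandwich[OF _ _ tendsto_const[of y], of \<xi> _ "\<lambda>n. y + d n"]) (auto intro: less_imp_le always_eventually)
    show "\<eta> \<longlonglongrightarrow> v"
      using \<xi>\<eta>(3,4) tendsto_add[OF tendsto_const[of v] dlim]
      by (intro tendsto_sandwich[OF _ _ tendsto_const[of v], of \<eta> _ "\<lambda>n. v + d n"]) (auto intro: less_imp_le always_eventually)
  qed
  have alim: "(\<lambda>n. a (Z n)) \<longlonglongrightarrow> a z" if "Z \<longlonglongrightarrow> z" "0 < z" "z < t" "\<And>n. 0 < Z n" "\<And>n. Z n < t" for Z z
    unfolding a_def using that yv \<beta>0[of "y + v"]
    by (intro tendsto_divide tendsto_const g_tendsto tendsto_diff) (auto intro: less_trans)
  have lt: "\<xi> n < t" "\<eta> n < t" for n using \<xi>\<eta>(2,4)[of n] d[of n] by auto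
  have "(\<lambda>n. a (\<xi> n)) \<longlonglongrightarrow> a y" "(\<lambda>n. a (\<eta> n)) \<longlonglongrightarrow> a v"
    using lim less_trans[OF yv(1) \<xi>\<eta>(1)] less_trans[OF yv(2) \<xi>\<eta>(3)] yv lt by (auto intro!: alim)
  then have "a y = a v" unfolding \<xi>\<eta>(5) by (rule LIMSEQ_unique)
  then show ?thesis using g[of y "y + v"] g[of v "y + v"] yv by simp
qed

lemma J_antidiagonal_const:
  assumes fac: "\<And>t. 0 < t \<Longrightarrow> splits X t"
    and w: "0 < w" "w < s" "0 < w'" "w' < s"
  shows "J X w (s - w) = J X w' (s - w')"
proof -
  have sym: "g X y v = g X v y" if yv: "0 < y" "0 < v" for y v
  proof -
    \<comment> \<open>The midpoint between \<open>max y v\<close> and \<open>y + v\<close>: above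
      both arguments, below their sum, so the factorisation at \<open>t\<close> covers both orders
      of the pair.\<close>
    define t where "t = (max y v + (y + v)) / 2"
    have t: "y < t" "v < t" "t < y + v" "0 < t" using yv by (auto simp: t_def)
    from fac[OF t(4)] obtain r \<beta> where r:
      "\<And>x x' u. 0 < x \<Longrightarrow> x < x' \<Longrightarrow> x' < t \<Longrightarrow> t \<le> u \<Longrightarrow> gain X x x' (u - x) \<le> (r x' - r x) * \<beta> u"
      "\<And>x x' u. 0 < x \<Longrightarrow> x < x' \<Longrightarrow> x' < t \<Longrightarrow> t \<le> u \<Longrightarrow> (r x' - r x) * \<beta> u \<le> gain X x x' (u - x')"
      unfolding splits_def by blast
    \<comment> \<open>A positive \<open>gain\<close> below the product forces a nonzero \<beta>;
      \<open>t / 3 < t / 2\<close> are arbitrary points below \<open>t\<close>.\<close>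
    have \<beta>0: "\<beta> u \<noteq> 0" if "t \<le> u" for u
    proof -
      have x: "0 < t / 3" "t / 3 < t / 2" "t / 2 < t" "0 < t / 2" "0 < u - t / 3" using t(4) that by auto
      have "0 < gain X (t / 3) (t / 2) (u - t / 3)"
        unfolding gain_def
      proof (rule integral_pos)
        have "\<bar>X \<theta> * (F \<theta> (t / 2) - F \<theta> (t / 3)) * H \<theta> (u - t / 3)\<bar> \<le> 1 * 1 * 1" if "\<theta> \<in> space M" for \<theta>
          unfolding abs_mult
          using X01[OF that] F_pos[OF that x(1)] F_less_1[OF that x(4)] F_strict_mono[OF that x(1,2)] H_bounds[OF that x(5)]
          by (intro mult_mono) auto
        then show "integrable M (\<lambda>\<theta>. X \<theta> * (F \<theta> (t / 2) - F \<theta> (t / 3)) * H \<theta> (u - t / 3))"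
          using x by (intro integrable_bounded1 borel_measurable_times X borel_measurable_diff F_meas H_meas) auto
        show "0 < X \<theta> * (F \<theta> (t / 2) - F \<theta> (t / 3)) * H \<theta> (u - t / 3)" if "\<theta> \<in> space M" for \<theta>
          using X01[OF that] F_strict_mono[OF that x(1,2)] H_bounds[OF that x(5)] by simp
      qed
      then show ?thesis using r(1)[OF x(1-3) that] by auto
    qed
    have fac': "g X x (u - x) * \<beta> u' = g X x (u' - x) * \<beta> u"
      if "0 < x" "x < t" "t \<le> u" "t \<le> u'" for x u u'
      unfolding g_def using that by (intro sandwich_factorization[of X t r \<beta>] X X01 r)
    show ?thesis by (rule g_symmetric[OF yv t(1-3) \<beta>0 fac'])
  qed
  have "((\<lambda>w. J X w (s - w)) has_real_derivative 0) (at z)" if "z \<in> {0<..<s}" for z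
    using J_antidiagonal_deriv[of z s] sym[of z "s - z"] that by simp
  then have "\<exists>c. \<forall>z\<in>{0<..<s}. J X z (s - z) = c"
    by (intro has_field_derivative_zero_constant) (auto intro: has_field_derivative_at_within)
  then show ?thesis using w by auto
qed

end

lemma survival_exponential:
  assumes fac: "\<And>a b t. 0 < a \<Longrightarrow> 0 < b \<Longrightarrow> 0 < t \<Longrightarrow> splits (\<lambda>\<theta>. H \<theta> a * H \<theta> b) t"
  shows "AE \<theta> in M. \<forall>t>0. F \<theta> t = 1 - exp (- (p \<theta> * t))"
proof -
  have X: "(\<lambda>\<theta>. H \<theta> a * H \<theta> b) \<in> borel_measurable M" "\<And>\<theta>. \<theta> \<in> space M \<Longrightarrow> 0 < H \<theta> a * H \<theta> b \<and> H \<theta> a * H \<theta> b \<le> 1"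
    if "0 < a" "0 < b" for a b
  proof -
    show "(\<lambda>\<theta>. H \<theta> a * H \<theta> b) \<in> borel_measurable M"
      using that by (intro borel_measurable_times H_meas)
    show "0 < H \<theta> a * H \<theta> b \<and> H \<theta> a * H \<theta> b \<le> 1" if "\<theta> \<in> space M" for \<theta>
      using H_bounds[OF that \<open>0 < a\<close>] H_bounds[OF that \<open>0 < b\<close>] by (simp add: mult_le_one)
  qed
  \<comment> \<open>The expanded square consists of four integrals \<open>J\<close>, with weight
    \<open>H \<theta> w * H \<theta> v\<close> or \<open>H \<theta> w' * H \<theta> v'\<close>. For
    each weight the values at \<open>(w, v)\<close> and \<open>(w', v')\<close> agree, so everything
    cancels.\<close>
  have sq: "AE \<theta> in M. H \<theta> w * H \<theta> v = H \<theta> w' * H \<theta> v'"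
    if pos: "0 < w" "0 < v" "0 < w'" "0 < v'" and sum: "w + v = w' + v'" for w v w' v'
  proof -
    have J: "J (\<lambda>\<theta>. H \<theta> a * H \<theta> b) w v = J (\<lambda>\<theta>. H \<theta> a * H \<theta> b) w' v'" if "0 < a" "0 < b" for a b
    proof -
      have v: "v = (w + v) - w" "v' = (w + v) - w'" using sum by auto
      have "J (\<lambda>\<theta>. H \<theta> a * H \<theta> b) w ((w + v) - w) = J (\<lambda>\<theta>. H \<theta> a * H \<theta> b) w' ((w + v) - w')"
        by (rule J_antidiagonal_const[OF X[OF that] fac[OF that]]) (use pos sum in auto)
      then show ?thesis using v by (simp only:)
    qed
    have int: "integrable M (\<lambda>\<theta>. H \<theta> a * H \<theta> b * H \<theta> c * H \<theta> d)" if "0 < a" "0 < b" "0 < c" "0 < d" for a b c d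
      by (rule J_integrable[OF X]) (use that in auto)
    have "(\<integral>\<theta>. (H \<theta> w * H \<theta> v - H \<theta> w' * H \<theta> v')\<^sup>2 \<partial>M) =
       (\<integral>\<theta>. (H \<theta> w * H \<theta> v * H \<theta> w * H \<theta> v - H \<theta> w * H \<theta> v * H \<theta> w' * H \<theta> v')
          - (H \<theta> w' * H \<theta> v' * H \<theta> w * H \<theta> v - H \<theta> w' * H \<theta> v' * H \<theta> w' * H \<theta> v') \<partial>M)"
      by (intro Bochner_Integration.integral_cong refl) (simp add: power2_eq_square algebra_simps)
    also have "\<dots> = (J (\<lambda>\<theta>. H \<theta> w * H \<theta> v) w v - J (\<lambda>\<theta>. H \<theta> w * H \<theta> v) w' v')
       - (J (\<lambda>\<theta>. H \<theta> w' * H \<theta> v') w v - J (\<lambda>\<theta>. H \<theta> w' * H \<theta> v') w' v')"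
      unfolding J_def
      by (simp only: Bochner_Integration.integral_diff Bochner_Integration.integrable_diff int pos)
    also have "\<dots> = 0" using J pos by simp
    finally have "(\<integral>\<theta>. (H \<theta> w * H \<theta> v - H \<theta> w' * H \<theta> v')\<^sup>2 \<partial>M) = 0" .
    moreover have "integrable M (\<lambda>\<theta>. (H \<theta> w * H \<theta> v - H \<theta> w' * H \<theta> v')\<^sup>2)"
    proof (rule integrable_bounded1)
      show "(\<lambda>\<theta>. (H \<theta> w * H \<theta> v - H \<theta> w' * H \<theta> v')\<^sup>2) \<in> borel_measurable M"
        using pos by (intro borel_measurable_power borel_measurable_diff borel_measurable_times H_meas)
      show "\<bar>(H \<theta> w * H \<theta> v - H \<theta> w' * H \<theta> v')\<^sup>2\<bar> \<le> 1" if "\<theta> \<in> space M" for \<theta>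
        using X(2)[OF pos(1,2) that] X(2)[OF pos(3,4) that] by (auto simp: abs_square_le_1 abs_le_iff)
    qed
    ultimately have "AE \<theta> in M. (H \<theta> w * H \<theta> v - H \<theta> w' * H \<theta> v')\<^sup>2 = 0"
      by (subst (asm) integral_nonneg_eq_0_iff_AE) auto
    then show ?thesis by eventually_elim simp
  qed
  \<comment> \<open>Each choice of arguments has its own null set; rational \<open>w\<close>,
    \<open>v\<close>, \<open>v'\<close> leave countably many, and \<open>w'\<close> is determined by
    the sum.\<close>
  have "AE \<theta> in M. \<forall>w\<in>\<rat>. \<forall>v\<in>\<rat>. \<forall>v'\<in>\<rat>. 0 < w \<longrightarrow> 0 < v \<longrightarrow> 0 < v' \<longrightarrow> v' < w + v \<longrightarrow>
      H \<theta> w * H \<theta> v = H \<theta> (w + v - v') * H \<theta> v'"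
    using sq by (intro AE_ball_countable'[OF _ countable_rat]) (auto intro!: AE_impI)
  then show ?thesis using AE_space
  proof eventually_elim
    fix \<theta> assume rat: "\<forall>w\<in>\<rat>. \<forall>v\<in>\<rat>. \<forall>v'\<in>\<rat>. 0 < w \<longrightarrow> 0 < v \<longrightarrow> 0 < v' \<longrightarrow> v' < w + v \<longrightarrow>
      H \<theta> w * H \<theta> v = H \<theta> (w + v - v') * H \<theta> v'" and \<theta>: "\<theta> \<in> space M"
    have H0: "(H \<theta> \<longlongrightarrow> 1) (at_right 0)"
      unfolding H_def[abs_def] using tendsto_diff[OF tendsto_const[of 1] F_at_0[OF \<theta>]] by simp
    \<comment> \<open>Let \<open>v'\<close> run through 1/(n+1): then \<open>H \<theta> v'\<close>
      tends to 1 and \<open>H \<theta> (w + v - v')\<close> to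
      \<open>H \<theta> (w + v)\<close>.\<close>
    have mult_rat: "H \<theta> (w + v) = H \<theta> w * H \<theta> v" if "w \<in> \<rat>" "v \<in> \<rat>" "0 < w" "0 < v" for w v
    proof (rule LIMSEQ_unique)
      define e where "e = (\<lambda>n. inverse (real (Suc n)))"
      have e: "e \<longlonglongrightarrow> 0" "\<And>n. 0 < e n" "\<And>n. e n \<in> \<rat>"
        unfolding e_def by (rule LIMSEQ_inverse_real_of_nat) auto
      have e': "filterlim e (at_right 0) sequentially"
        unfolding filterlim_at using e(1) less_imp_neq[OF e(2), symmetric] e(2) by (auto intro!: always_eventually)
      have "(\<lambda>n. H \<theta> (w + v - e n)) \<longlonglongrightarrow> H \<theta> (w + v)"
        using that e by (intro isCont_tendsto_compose[OF H_cont[OF \<theta>]]) (auto intro!: tendsto_eq_intros)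
      from tendsto_mult[OF this filterlim_compose[OF H0 e']]
      show "(\<lambda>n. H \<theta> (w + v - e n) * H \<theta> (e n)) \<longlonglongrightarrow> H \<theta> (w + v)" by simp
      have "\<forall>\<^sub>F n in sequentially. e n < w + v"
        using that by (intro order_tendstoD(2)[OF e(1)]) auto
      moreover have "H \<theta> (w + v - r) * H \<theta> r = H \<theta> w * H \<theta> v" if "r \<in> \<rat>" "0 < r" "r < w + v" for r
        using rat[rule_format, of w v r] that \<open>w \<in> \<rat>\<close> \<open>v \<in> \<rat>\<close> \<open>0 < w\<close> \<open>0 < v\<close> by simp
      ultimately have "\<forall>\<^sub>F n in sequentially. H \<theta> (w + v - e n) * H \<theta> (e n) = H \<theta> w * H \<theta> v"
        using e(2,3) by (auto elim!: eventually_mono)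
      then show "(\<lambda>n. H \<theta> (w + v - e n) * H \<theta> (e n)) \<longlonglongrightarrow> H \<theta> w * H \<theta> v"
        by (rule tendsto_eventually)
    qed
    have cont: "continuous_on {0<..} (\<lambda>z. H \<theta> (c + z))" if "0 \<le> c" for c
    proof (rule continuous_at_imp_continuous_on, rule ballI)
      fix z :: real assume "z \<in> {0<..}"
      with that have "isCont (H \<theta>) (c + z)" by (intro H_cont[OF \<theta>]) auto
      then show "isCont (\<lambda>z. H \<theta> (c + z)) z"
        by (rule isCont_o2[rotated]) (intro continuous_intros)
    qed
    have c0: "continuous_on {0<..} (H \<theta>)" using cont[of 0] by simp
    \<comment> \<open>Continuity removes the restriction to rationals one variable at a
      time.\<close>
    have mult_half: "H \<theta> (w + v) = H \<theta> w * H \<theta> v" if w: "w \<in> \<rat>" "0 < w" and v: "0 < v" for w v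
      by (rule eq_on_Rats_pos_imp_eq[OF cont[OF less_imp_le[OF w(2)]] continuous_on_mult_left[OF c0] _ v])
        (rule mult_rat[OF w(1) _ w(2)])
    have mult: "H \<theta> (w + v) = H \<theta> w * H \<theta> v" if w: "0 < w" and v: "0 < v" for w v
    proof -
      have "H \<theta> (v + w) = H \<theta> w * H \<theta> v"
        by (rule eq_on_Rats_pos_imp_eq[OF cont[OF less_imp_le[OF v]] continuous_on_mult_right[OF c0] _ w])
          (subst add.commute, rule mult_half[OF _ _ v])
      then show ?thesis by (simp only: add.commute)
    qed
    \<comment> \<open>Differentiating the functional equation in \<open>v\<close> and then letting
      \<open>v\<close> tend to 0 gives \<open>f = p * H\<close>, which identifies the rate.\<close>
    have f_add: "f \<theta> (w + v) = H \<theta> w * f \<theta> v" if "0 < w" "0 < v" for w v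
    proof -
      have "((\<lambda>v. H \<theta> w * H \<theta> v) has_real_derivative H \<theta> w * - f \<theta> v) (at v)"
        using that \<theta> by (intro DERIV_cmult H_deriv)
      then have "((\<lambda>v. H \<theta> (w + v)) has_real_derivative H \<theta> w * - f \<theta> v) (at v)"
        by (rule DERIV_cong_ev[THEN iffD1, OF refl _ refl, rotated])
          (use that mult in \<open>auto simp: eventually_nhds intro!: exI[of _ "{0<..}"]\<close>)
      moreover have "((\<lambda>v. H \<theta> (w + v)) has_real_derivative - f \<theta> (w + v) * (0 + 1)) (at v)"
        using that \<theta> by (intro DERIV_chain2[where f="H \<theta>"] H_deriv derivative_intros) auto
      ultimately show ?thesis using DERIV_unique by fastforce
    qed
    have f_eq: "f \<theta> w = p \<theta> * H \<theta> w" if "0 < w" for w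
    proof (rule tendsto_unique)
      show "((\<lambda>v. f \<theta> (w + v)) \<longlongrightarrow> f \<theta> w) (at_right 0)"
      proof (rule isCont_tendsto_compose[OF f_isCont[OF \<theta> that]])
        have "((\<lambda>v. w + v) \<longlongrightarrow> w + 0) (at_right 0)" by (intro tendsto_intros)
        then show "((\<lambda>v. w + v) \<longlongrightarrow> w) (at_right 0)" by simp
      qed
      have "\<forall>\<^sub>F v in at_right 0. f \<theta> (w + v) = H \<theta> w * f \<theta> v"
        unfolding eventually_at_right_field using f_add that by (intro exI[of _ 1]) auto
      moreover have "((\<lambda>v. H \<theta> w * f \<theta> v) \<longlongrightarrow> p \<theta> * H \<theta> w) (at_right 0)"
        unfolding mult.commute[of "p \<theta>"] by (intro tendsto_mult tendsto_const f_at_0[OF \<theta>])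
      ultimately show "((\<lambda>v. f \<theta> (w + v)) \<longlongrightarrow> p \<theta> * H \<theta> w) (at_right 0)"
        by (simp add: tendsto_cong)
    qed simp
    \<comment> \<open>The product with the integrating factor is constant; its limit at 0 is
      1.\<close>
    have "((\<lambda>t. H \<theta> t * exp (p \<theta> * t)) has_real_derivative 0) (at t)" if "t \<in> {0<..}" for t
      using that \<theta> f_eq[of t] by (auto intro!: derivative_eq_intros H_deriv)
    then have "\<exists>c. \<forall>t\<in>{0<..}. H \<theta> t * exp (p \<theta> * t) = c"
      by (intro has_field_derivative_zero_constant) (auto intro: has_field_derivative_at_within)
    then obtain c where c: "\<And>t. t \<in> {0<..} \<Longrightarrow> H \<theta> t * exp (p \<theta> * t) = c" by auto
    have "((\<lambda>t. H \<theta> t * exp (p \<theta> * t)) \<longlongrightarrow> 1 * exp (p \<theta> * 0)) (at_right 0)"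
      by (intro tendsto_intros H0)
    moreover have "\<forall>\<^sub>F t in at_right 0. H \<theta> t * exp (p \<theta> * t) = c"
      unfolding eventually_at_right_field using c by (intro exI[of _ 1]) auto
    then have "((\<lambda>t. H \<theta> t * exp (p \<theta> * t)) \<longlongrightarrow> c) (at_right 0)" by (rule tendsto_eventually)
    ultimately have "c = 1" using tendsto_unique[of "at_right (0::real)"] by fastforce
    then show "\<forall>t>0. F \<theta> t = 1 - exp (- (p \<theta> * t))"
      using c by (auto simp: H_def exp_minus field_simps)
  qed
qed

end

section \<open>The Markov property of a counting process\<close>

text \<open>\<open>markov_property\<close> predicts one more state from a whole past. Induction
  accumulates these predictions until the state at \<open>u 1\<close> is independent of all later
  states given that at \<open>u 2\<close>; the product form avoids conditioning on null
  events.\<close>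

lemma markov_past_future:
  fixes u :: "nat \<Rightarrow> real" and n :: "nat \<Rightarrow> nat"
  assumes "prob_space R" and N: "counting_process R N" and markov: "markov_property R N"
    and u: "0 < u 1" "\<And>j. 1 \<le> j \<Longrightarrow> j < m \<Longrightarrow> u j < u (Suc j)" and m: "2 \<le> m"
  shows "measure R {\<omega>\<in>space R. \<forall>j\<in>{1..m}. N (u j) \<omega> = enat (n j)} * measure R {\<omega>\<in>space R. N (u 2) \<omega> = enat (n 2)} =
    measure R {\<omega>\<in>space R. \<forall>j\<in>{1..2}. N (u j) \<omega> = enat (n j)} * measure R {\<omega>\<in>space R. \<forall>j\<in>{2..m}. N (u j) \<omega> = enat (n j)}"
  using m u(2)
proof (induction m rule: nat_induct_at_least)
  case base
  have "{2..2::nat} = {2}" by auto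
  then show ?case by simp
next
  case (Suc m)
  interpret prob_space R by fact
  have upos: "0 < u j" if "1 \<le> j" "j \<le> Suc m" for j
    by (rule less_le_trans[OF u(1) nat_interval_mono[of 1 j u]]) (use that Suc.prems in \<open>auto intro: less_imp_le\<close>)
  define A where "A = (\<lambda>I. {\<omega>\<in>space R. \<forall>j\<in>I. N (u j) \<omega> = enat (n j)})"
  have A_sets: "A I \<in> events" if "I \<subseteq> {1..Suc m}" for I
    unfolding A_def using that finite_subset[OF that]
    by (intro counting_event_measurable[OF N]) (auto intro!: less_imp_le[OF upos])
  have A_mono: "prob (A I) \<le> prob (A I')" if "I' \<subseteq> I" "I \<subseteq> {1..Suc m}" for I I'
    using that A_sets[of I'] by (intro finite_measure_mono) (auto simp: A_def)
  have A_single: "{\<omega>\<in>space R. N (u j) \<omega> = enat (n j)} = A {j}" for j by (auto simp: A_def)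
  have A_eq: "{\<omega>\<in>space R. \<forall>j\<in>I. N (u j) \<omega> = enat (n j)} = A I" for I by (simp add: A_def)
  \<comment> \<open>The one-step rule for a past starting at index \<open>i\<close>, used with the
    long past \<open>i = 1\<close> and the shorter one \<open>i = 2\<close>.\<close>
  have step: "prob (A {i..Suc m}) * prob (A {m}) = prob (A {i..m}) * prob (A {m, Suc m})"
    if i: "1 \<le> i" "i \<le> m" for i
  proof (cases "prob (A {i..m}) > 0")
    case False
    then have 0: "prob (A {i..m}) = 0" by (simp add: zero_less_measure_iff)
    moreover have "prob (A {i..Suc m}) \<le> prob (A {i..m})" using i by (intro A_mono) auto
    ultimately have "prob (A {i..Suc m}) = 0" by (simp add: measure_le_0_iff)
    then show ?thesis using 0 by simp
  next
    case True
    define k where "k = m - i + 1"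
    define v where "v = (\<lambda>j. u (j + i - 1))"
    define l where "l = (\<lambda>j. n (j + i - 1))"
    have shift: "(\<forall>j\<in>{1..k}. N (v j) \<omega> = enat (l j)) \<longleftrightarrow> (\<forall>j\<in>{i..m}. N (u j) \<omega> = enat (n j))" for \<omega>
    proof -
      have im: "{i..m} = (\<lambda>j. j + i - 1) ` {1..k}"
      proof (intro equalityI subsetI)
        fix j assume "j \<in> {i..m}"
        then show "j \<in> (\<lambda>j. j + i - 1) ` {1..k}" using i by (intro image_eqI[of _ _ "j - i + 1"]) (auto simp: k_def)
      qed (use i in \<open>auto simp: k_def\<close>)
      show ?thesis unfolding im by (simp add: v_def l_def)
    qed
    have vk: "v k = u m" "v (Suc k) = u (Suc m)" "l k = n m" "l (Suc k) = n (Suc m)"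
      using i by (auto simp: v_def l_def k_def)
    have "\<P>(\<omega> in R. N (v (Suc k)) \<omega> = enat (l (Suc k)) \<bar> \<forall>j\<in>{1..k}. N (v j) \<omega> = enat (l j)) =
        \<P>(\<omega> in R. N (v (Suc k)) \<omega> = enat (l (Suc k)) \<bar> N (v k) \<omega> = enat (l k))"
    proof (rule markov[unfolded markov_property_def, rule_format])
      show "1 \<le> k" by (simp add: k_def)
      show "0 < v 1" using upos[of i] i by (simp add: v_def)
      show "v j < v (Suc j)" if "j \<in> {1..k}" for j
        using Suc.prems[of "j + i - 1"] that i by (auto simp: v_def k_def Suc_diff_Suc)
      show "0 < prob {\<omega> \<in> space R. \<forall>j\<in>{1..k}. N (v j) \<omega> = enat (l j)}"
        using True unfolding shift A_def .
    qed
    then have "prob {\<omega>\<in>space R. N (u (Suc m)) \<omega> = enat (n (Suc m)) \<and> (\<forall>j\<in>{i..m}. N (u j) \<omega> = enat (n j))} / prob (A {i..m}) =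
       prob {\<omega>\<in>space R. N (u (Suc m)) \<omega> = enat (n (Suc m)) \<and> N (u m) \<omega> = enat (n m)} / prob (A {m})"
      unfolding cond_prob_def shift vk A_def by simp
    moreover have "{\<omega>\<in>space R. N (u (Suc m)) \<omega> = enat (n (Suc m)) \<and> (\<forall>j\<in>{i..m}. N (u j) \<omega> = enat (n j))} = A {i..Suc m}"
      using i by (auto simp: A_def atLeastAtMostSuc_conv)
    moreover have "{\<omega>\<in>space R. N (u (Suc m)) \<omega> = enat (n (Suc m)) \<and> N (u m) \<omega> = enat (n m)} = A {m, Suc m}"
      by (auto simp: A_def)
    moreover have "prob (A {m}) > 0"
      using True A_mono[of "{m}" "{i..m}"] i by auto
    ultimately show ?thesis using True by (simp add: field_simps)
  qed
  have IH: "prob (A {1..m}) * prob (A {2}) = prob (A {1..2}) * prob (A {2..m})"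
    using Suc.IH Suc.prems unfolding A_single A_eq by simp
  have "prob (A {1..Suc m}) * prob (A {2}) = prob (A {1..2}) * prob (A {2..Suc m})"
  \<comment> \<open>Multiplying by \<open>prob (A {m})\<close> makes \<open>step\<close> applicable
    to both sides; if this factor is 0, both sides vanish.\<close>
  proof (cases "prob (A {m}) = 0")
    case True
    have "prob (A {1..Suc m}) \<le> prob (A {m})" "prob (A {2..Suc m}) \<le> prob (A {m})"
      using Suc.hyps by (intro A_mono; auto)+
    then show ?thesis using True by (simp add: measure_le_0_iff)
  next
    case False
    have "(prob (A {1..Suc m}) * prob (A {2})) * prob (A {m}) = (prob (A {1..Suc m}) * prob (A {m})) * prob (A {2})"
      by (simp only: mult_ac)
    also have "\<dots> = (prob (A {1..m}) * prob (A {2})) * prob (A {m, Suc m})"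
      using step[of 1] Suc.hyps by (simp only: mult_ac)
    also have "\<dots> = prob (A {1..2}) * (prob (A {2..m}) * prob (A {m, Suc m}))"
      unfolding IH by (simp only: mult_ac)
    also have "\<dots> = (prob (A {1..2}) * prob (A {2..Suc m})) * prob (A {m})"
      using step[OF one_le_numeral Suc.hyps] by (simp only: mult.assoc)
    finally have "(prob (A {1..Suc m}) * prob (A {2})) * prob (A {m}) = (prob (A {1..2}) * prob (A {2..Suc m})) * prob (A {m})" .
    then show ?thesis using False by simp
  qed
  then show ?case unfolding A_single A_eq .
qed

section \<open>Past and future of a time with count one\<close>

locale markov_counting = prob_space R for R :: "'a measure" +
  fixes N :: "real \<Rightarrow> 'a \<Rightarrow> enat" and t :: real
  assumes N: "counting_process R N" and markov: "markov_property R N" and t: "0 < t"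
begin

definition count_event :: "real set \<Rightarrow> (real \<Rightarrow> nat) \<Rightarrow> 'a set" where
  "count_event S k = {\<omega>\<in>space R. \<forall>s\<in>S. N s \<omega> = enat (k s)}"

definition now :: "'a set" where "now = {\<omega>\<in>space R. N t \<omega> = 1}"

text \<open>The empty set is added because cylinders prescribing different counts at a common time
  are disjoint, and stability under intersection is required.\<close>

definition cylinders :: "'a set set" where
  "cylinders = insert {} {count_event S k | S k. finite S \<and> S \<subseteq> {t..}}"

definition future :: "'a measure" where "future = sigma (space R) cylinders"

lemma count_event_sets: "finite S \<Longrightarrow> (\<And>s. s \<in> S \<Longrightarrow> 0 \<le> s) \<Longrightarrow> count_event S k \<in> events"
  unfolding count_event_def by (rule counting_event_measurable[OF N])

lemma now_sets: "now \<in> events"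
  using count_event_sets[of "{t}" "\<lambda>_. 1"] t by (simp add: count_event_def now_def one_enat_def)

lemma cylinders_sets: "cylinders \<subseteq> events"
  using t by (auto simp: cylinders_def intro!: count_event_sets)

lemma Int_stable_cylinders: "Int_stable cylinders"
proof (rule Int_stableI)
  fix a b assume ab: "a \<in> cylinders" "b \<in> cylinders"
  show "a \<inter> b \<in> cylinders"
  proof (cases "a \<inter> b = {}")
    case True then show ?thesis by (simp add: cylinders_def)
  next
    case False
    with ab obtain S k S' k' where S: "a = count_event S k" "finite S" "S \<subseteq> {t..}"
      and S': "b = count_event S' k'" "finite S'" "S' \<subseteq> {t..}" by (auto simp: cylinders_def)
    from False obtain \<omega> where \<omega>: "\<omega> \<in> a" "\<omega> \<in> b" by auto
    have agree: "k s = k' s" if "s \<in> S" "s \<in> S'" for s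
      using \<omega> that by (auto simp: S S' count_event_def dest!: bspec[of _ _ s])
    have "a \<inter> b = count_event (S \<union> S') (\<lambda>s. if s \<in> S then k s else k' s)"
      using agree by (auto simp: S S' count_event_def)
    then show ?thesis using S S' by (auto simp: cylinders_def)
  qed
qed

text \<open>The times \<open>x\<close>, \<open>t\<close> and those of the cylinder beyond
  \<open>t\<close>, in increasing order, form a sequence to which \<open>markov_past_future\<close>
  applies.\<close>

lemma cylinder_independent:
  assumes x: "0 < x" "x < t" and E: "E \<in> cylinders"
  shows "prob ({\<omega>\<in>space R. N x \<omega> = 1} \<inter> now \<inter> E) * prob now =
    prob ({\<omega>\<in>space R. N x \<omega> = 1} \<inter> now) * prob (now \<inter> E)"
proof (cases "E \<inter> now = {}")
  case True
  then have "{\<omega>\<in>space R. N x \<omega> = 1} \<inter> now \<inter> E = {}" "now \<inter> E = {}" by auto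
  then show ?thesis by simp
next
  case False
  with E obtain S0 k0 where S0: "E = count_event S0 k0" "finite S0" "S0 \<subseteq> {t..}" by (auto simp: cylinders_def)
  \<comment> \<open>The cylinder may or may not prescribe the count at \<open>t\<close>. Meeting
    \<open>now\<close> forces the value 1 there, so \<open>t\<close> is removed and put back with
    that value.\<close>
  define S where "S = S0 - {t}"
  define k where "k = k0(x := 1, t := 1)"
  have S: "finite S" "S \<subseteq> {t<..}" using S0 by (auto simp: S_def)
  have nowE: "now \<inter> E = {\<omega>\<in>space R. \<forall>s\<in>insert t S. N s \<omega> = enat (k s)}"
  proof -
    have "k0 t = 1" if "t \<in> S0" using False that by (auto simp: now_def S0(1) count_event_def one_enat_def)
    then have k: "k s = k0 s" if "s \<in> S0" for s using that x S0(3) by (auto simp: k_def)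
    have "(\<forall>s\<in>insert t S. N s \<omega> = enat (k s)) \<longleftrightarrow> N t \<omega> = enat (k t) \<and> (\<forall>s\<in>S0. N s \<omega> = enat (k0 s))" for \<omega>
      using k by (auto simp: S_def)
    then show ?thesis by (auto simp: now_def S0(1) count_event_def k_def one_enat_def)
  qed
  define xs where "xs = x # t # sorted_list_of_set S"
  define m where "m = length xs"
  define u where "u = (\<lambda>j. xs ! (j - 1))"
  define n where "n = (\<lambda>j. k (u j))"
  have sorted: "sorted_wrt (<) xs"
    using S x by (auto simp: xs_def)
  have m: "2 \<le> m" by (simp add: m_def xs_def)
  have u_image: "u ` {i..m} = set (drop (i - 1) xs)" if "1 \<le> i" for i
  proof -
    have "{i..m} = Suc ` {i - 1..<m}" using that by (auto simp: image_Suc_atLeastLessThan)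
    then have "u ` {i..m} = (!) xs ` {i - 1..<m}" by (simp only: u_def image_image diff_Suc_1)
    also have "\<dots> = set (drop (i - 1) xs)"
    proof (intro equalityI subsetI)
      fix y assume "y \<in> (!) xs ` {i - 1..<m}"
      then obtain j where j: "i - 1 \<le> j" "j < length xs" "y = xs ! j" by (auto simp: m_def)
      then have "y = drop (i - 1) xs ! (j - (i - 1))" "j - (i - 1) < length (drop (i - 1) xs)" by auto
      then show "y \<in> set (drop (i - 1) xs)" using nth_mem by blast
    next
      fix y assume "y \<in> set (drop (i - 1) xs)"
      then obtain j where j: "j < length (drop (i - 1) xs)" "y = drop (i - 1) xs ! j" by (metis in_set_conv_nth)
      then show "y \<in> (!) xs ` {i - 1..<m}" by (intro image_eqI[of _ _ "i - 1 + j"]) (auto simp: m_def)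
    qed
    finally show ?thesis .
  qed
  have ball: "(\<forall>j\<in>{i..m}. N (u j) \<omega> = enat (n j)) \<longleftrightarrow> (\<forall>s\<in>set (drop (i - 1) xs). N s \<omega> = enat (k s))" if "1 \<le> i" for i \<omega>
    unfolding u_image[OF that, symmetric] by (simp add: n_def)
  have u12: "u 1 = x" "u 2 = t" "n 1 = 1" "n 2 = 1" by (auto simp: u_def n_def xs_def k_def)
  have "measure R {\<omega>\<in>space R. \<forall>j\<in>{1..m}. N (u j) \<omega> = enat (n j)} * measure R {\<omega>\<in>space R. N (u 2) \<omega> = enat (n 2)} =
    measure R {\<omega>\<in>space R. \<forall>j\<in>{1..2}. N (u j) \<omega> = enat (n j)} * measure R {\<omega>\<in>space R. \<forall>j\<in>{2..m}. N (u j) \<omega> = enat (n j)}"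
  proof (rule markov_past_future[OF _ N markov _ _ m])
    show "prob_space R" by unfold_locales
    show "0 < u 1" using x u12 by simp
    show "u j < u (Suc j)" if "1 \<le> j" "j < m" for j
      using sorted that by (auto simp: u_def m_def sorted_wrt_iff_nth_less)
  qed
  moreover have "{\<omega>\<in>space R. \<forall>j\<in>{1..m}. N (u j) \<omega> = enat (n j)} = {\<omega>\<in>space R. N x \<omega> = 1} \<inter> (now \<inter> E)"
    unfolding ball[OF order_refl] nowE using S(1) by (auto simp: xs_def k_def one_enat_def)
  moreover have "{\<omega>\<in>space R. \<forall>j\<in>{2..m}. N (u j) \<omega> = enat (n j)} = now \<inter> E"
    unfolding ball[OF one_le_numeral] nowE using S(1) by (auto simp: xs_def)
  moreover have "{\<omega>\<in>space R. N (u 2) \<omega> = enat (n 2)} = now" by (simp add: u12 now_def one_enat_def)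
  moreover have "{\<omega>\<in>space R. \<forall>j\<in>{1..2}. N (u j) \<omega> = enat (n j)} = {\<omega>\<in>space R. N x \<omega> = 1} \<inter> now"
    using u12 by (auto simp: now_def one_enat_def numeral_2_eq_2 atLeastAtMostSuc_conv)
  ultimately show ?thesis by (simp add: Int_assoc)
qed

lemma sets_future: "sets future = sigma_sets (space R) cylinders"
  unfolding future_def using cylinders_sets sets.sets_into_space by (intro sets_measure_of) blast

lemma space_future: "space future = space R"
  by (simp add: future_def space_measure_of_conv)

text \<open>Both sides are countably additive in \<open>E\<close> and the cylinders are stable under
  intersection, so the identity extends to the sigma-algebra they generate.\<close>

lemma future_independent:
  assumes x: "0 < x" "x < t" and E: "E \<in> sets future"
  shows "prob ({\<omega>\<in>space R. N x \<omega> = 1} \<inter> now \<inter> E) * prob now =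
    prob ({\<omega>\<in>space R. N x \<omega> = 1} \<inter> now) * prob (now \<inter> E)"
proof -
  define A where "A = {\<omega>\<in>space R. N x \<omega> = 1}"
  have A: "A \<in> events" using count_event_sets[of "{x}" "\<lambda>_. 1"] x by (simp add: A_def count_event_def one_enat_def)
  have "cylinders \<subseteq> Pow (space R)" using cylinders_sets sets.sets_into_space by blast
  from Int_stable_cylinders this E[unfolded sets_future]
  have "E \<in> events \<and> prob (A \<inter> now \<inter> E) * prob now = prob (A \<inter> now) * prob (now \<inter> E)"
  proof (induction rule: sigma_sets_induct_disjoint)
    case (basic E)
    then show ?case using cylinder_independent[OF x basic] cylinders_sets by (auto simp: A_def)
  next
    case empty then show ?case by simp
  next
    case (compl E)
    then have E: "E \<in> events" by simp
    have "prob (B \<inter> (space R - E)) = prob B - prob (B \<inter> E)" if "B \<in> events" for B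
    proof -
      have "B \<inter> (space R - E) = B - B \<inter> E" using sets.sets_into_space[OF that] by auto
      then show ?thesis using that E by (simp add: finite_measure_Diff)
    qed
    then have "prob (A \<inter> now \<inter> (space R - E)) = prob (A \<inter> now) - prob (A \<inter> now \<inter> E)"
      "prob (now \<inter> (space R - E)) = prob now - prob (now \<inter> E)"
      using A now_sets by auto
    then show ?case using compl E by (simp add: left_diff_distrib right_diff_distrib)
  next
    case (union E)
    then have E: "\<And>i. E i \<in> events" by auto
    have sums: "(\<lambda>i. prob (B \<inter> E i)) sums prob (B \<inter> (\<Union>i. E i))" if "B \<in> events" for B
    proof -
      have "(\<lambda>i. prob (B \<inter> E i)) sums prob (\<Union>i. B \<inter> E i)"
        using union(1) that E by (intro finite_measure_UNION) (auto simp: disjoint_family_on_def)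
      then show ?thesis by simp
    qed
    have "(\<lambda>i. prob (A \<inter> now \<inter> E i) * prob now) sums (prob (A \<inter> now \<inter> (\<Union>i. E i)) * prob now)"
      using A now_sets by (intro sums_mult2 sums) auto
    moreover have "(\<lambda>i. prob (A \<inter> now) * prob (now \<inter> E i)) sums (prob (A \<inter> now) * prob (now \<inter> (\<Union>i. E i)))"
      using now_sets by (intro sums_mult sums) auto
    moreover have "prob (A \<inter> now \<inter> E i) * prob now = prob (A \<inter> now) * prob (now \<inter> E i)" for i
      using union(3)[of i] by simp
    ultimately show ?case using E sums_unique2 by fastforce
  qed
  then show ?thesis by (simp add: A_def)
qed

text \<open>Cylinders prescribe finite counts only; the complement of the finitely many smaller
  counts also captures the value infinity.\<close>

lemma count_ge_future:
  assumes "t \<le> s" shows "{\<omega>\<in>space R. enat n \<le> N s \<omega>} \<in> sets future"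
proof -
  have "{\<omega>\<in>space R. N s \<omega> = enat i} \<in> sets future" for i
  proof -
    have "{\<omega>\<in>space R. N s \<omega> = enat i} = count_event {s} (\<lambda>_. i)" by (auto simp: count_event_def)
    also have "\<dots> \<in> cylinders" using assms by (auto simp: cylinders_def)
    finally show ?thesis unfolding sets_future by (rule sigma_sets.Basic)
  qed
  then have "space future - (\<Union>i\<in>{..<n}. {\<omega>\<in>space R. N s \<omega> = enat i}) \<in> sets future"
    by (intro sets.compl_sets sets.finite_UN) auto
  also have "space future - (\<Union>i\<in>{..<n}. {\<omega>\<in>space R. N s \<omega> = enat i}) = {\<omega>\<in>space R. enat n \<le> N s \<omega>}"
  proof -
    have "enat n \<le> N s \<omega> \<longleftrightarrow> \<not> (\<exists>i<n. N s \<omega> = enat i)" for \<omega> by (cases "N s \<omega>") auto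
    then show ?thesis by (auto simp: space_future)
  qed
  finally show ?thesis .
qed

text \<open>Arrivals before \<open>t\<close> are not determined by the counts from \<open>t\<close>
  on; truncation at \<open>t\<close> removes this dependence.\<close>

lemma arrival_future: "(\<lambda>\<omega>. max (arrival N n \<omega>) t) \<in> borel_measurable future"
proof (rule borel_measurable_iff_le[THEN iffD2], rule allI)
  fix s :: real
  show "{\<omega> \<in> space future. max (arrival N n \<omega>) t \<le> s} \<in> sets future"
  proof (cases "t \<le> s")
    case True
    have "{\<omega> \<in> space future. max (arrival N n \<omega>) t \<le> s} = {\<omega>\<in>space R. enat n \<le> N s \<omega>}"
      using True t by (auto simp: space_future arrival_le_iff[OF N])
    then show ?thesis using count_ge_future[OF True] by simp
  next
    case False
    then have "{\<omega> \<in> space future. max (arrival N n \<omega>) t \<le> s} = {}" by auto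
    then show ?thesis by (simp only: sets.empty_sets)
  qed
qed

definition gaps :: "real \<Rightarrow> real \<Rightarrow> real \<Rightarrow> 'a \<Rightarrow> bool" where
  "gaps u a b \<omega> \<longleftrightarrow> u < arrival N 2 \<omega> \<and> a < interarrival N 3 \<omega> \<and> b < interarrival N 4 \<omega>"

lemma now_iff:
  assumes "\<omega> \<in> space R"
  shows "\<omega> \<in> now \<longleftrightarrow> arrival N 1 \<omega> \<le> t \<and> t < arrival N 2 \<omega>"
proof -
  have "\<omega> \<in> now \<longleftrightarrow> N t \<omega> = enat 1" using assms by (simp add: now_def one_enat_def)
  also have "\<dots> \<longleftrightarrow> arrival N 1 \<omega> \<le> t \<and> t < arrival N (Suc 1) \<omega>"
    by (rule counting_eq_iff[OF N assms less_imp_le[OF t]])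
  finally show ?thesis by (simp only: Suc_1)
qed

lemma gaps_independent:
  assumes x: "0 < x" "x < t" and u: "t \<le> u"
  shows "prob {\<omega>\<in>space R. arrival N 1 \<omega> \<le> x \<and> gaps u a b \<omega>} * prob now =
    prob ({\<omega>\<in>space R. N x \<omega> = 1} \<inter> now) * prob {\<omega>\<in>now. gaps u a b \<omega>}"
proof -
  define T where "T = (\<lambda>n \<omega>. max (arrival N n \<omega>) t)"
  define E where "E = {\<omega>\<in>space future. (u = t \<or> u < T 2 \<omega>) \<and> a < T 3 \<omega> - T 2 \<omega> \<and> b < T 4 \<omega> - T 3 \<omega>}"
  have [measurable]: "T n \<in> borel_measurable future" for n unfolding T_def by (rule arrival_future)
  have E: "E \<in> sets future" unfolding E_def by measurable
  \<comment> \<open>On \<open>now\<close> the second arrival lies beyond \<open>t\<close>, so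
    truncation changes none of the arrivals involved.\<close>
  have nowE: "now \<inter> E = {\<omega>\<in>now. gaps u a b \<omega>}"
  proof -
    have "\<omega> \<in> E \<longleftrightarrow> gaps u a b \<omega>" if "\<omega> \<in> now" for \<omega>
    proof -
      have \<omega>: "\<omega> \<in> space R" using that by (simp add: now_def)
      have "t < arrival N 2 \<omega>" using now_iff[OF \<omega>] that by simp
      moreover have "arrival N 2 \<omega> \<le> arrival N 3 \<omega>" "arrival N 3 \<omega> \<le> arrival N 4 \<omega>"
        using arrival_mono[OF N \<omega>] by auto
      ultimately show ?thesis using \<omega> u
        by (auto simp: E_def T_def gaps_def interarrival_def space_future)
    qed
    then show ?thesis by blast
  qed
  \<comment> \<open>A first arrival by \<open>x\<close> and a second after \<open>u \<ge> t\<close>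
    already force count one at \<open>x\<close> and at \<open>t\<close>.\<close>
  have "{\<omega>\<in>space R. arrival N 1 \<omega> \<le> x \<and> gaps u a b \<omega>} = {\<omega>\<in>space R. N x \<omega> = 1} \<inter> {\<omega>\<in>now. gaps u a b \<omega>}"
  proof -
    have "arrival N 1 \<omega> \<le> x \<and> gaps u a b \<omega> \<longleftrightarrow> N x \<omega> = 1 \<and> \<omega> \<in> now \<and> gaps u a b \<omega>" if \<omega>: "\<omega> \<in> space R" for \<omega>
      using counting_eq_iff[OF N \<omega>, of x 1] now_iff[OF \<omega>] x u
      by (auto simp: one_enat_def numeral_2_eq_2 gaps_def)
    then show ?thesis by (auto simp: now_def)
  qed
  then show ?thesis using future_independent[OF x E] nowE by (simp add: Int_assoc)
qed

lemma gaps_increment: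
  assumes x: "0 < x" "x < x'" "x' < t" and u: "t \<le> u"
  shows "prob {\<omega>\<in>space R. x < arrival N 1 \<omega> \<and> arrival N 1 \<omega> \<le> x' \<and> gaps u a b \<omega>} =
    (prob ({\<omega>\<in>space R. N x' \<omega> = 1} \<inter> now) / prob now - prob ({\<omega>\<in>space R. N x \<omega> = 1} \<inter> now) / prob now) *
     prob {\<omega>\<in>now. gaps u a b \<omega>}"
\<comment> \<open>The quotients are then 0 by convention, and the event on the left is a subset of
  the null event \<open>now\<close>.\<close>
proof (cases "prob now = 0")
  case True
  have "prob {\<omega>\<in>space R. x < arrival N 1 \<omega> \<and> arrival N 1 \<omega> \<le> x' \<and> gaps u a b \<omega>} \<le> prob now"
    using x u now_sets now_iff by (intro finite_measure_mono) (auto simp: gaps_def)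
  then show ?thesis using True by (simp add: measure_le_0_iff)
next
  case False
  have [measurable]: "arrival N n \<in> borel_measurable R" "interarrival N n \<in> borel_measurable R" for n
    using N by (auto intro: borel_measurable_arrival borel_measurable_interarrival)
  have sets: "{\<omega>\<in>space R. arrival N 1 \<omega> \<le> y \<and> gaps u a b \<omega>} \<in> events" for y
    unfolding gaps_def by measurable
  have "{\<omega>\<in>space R. x < arrival N 1 \<omega> \<and> arrival N 1 \<omega> \<le> x' \<and> gaps u a b \<omega>} =
    {\<omega>\<in>space R. arrival N 1 \<omega> \<le> x' \<and> gaps u a b \<omega>} - {\<omega>\<in>space R. arrival N 1 \<omega> \<le> x \<and> gaps u a b \<omega>}"
    by auto
  then have "prob {\<omega>\<in>space R. x < arrival N 1 \<omega> \<and> arrival N 1 \<omega> \<le> x' \<and> gaps u a b \<omega>} =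
    prob {\<omega>\<in>space R. arrival N 1 \<omega> \<le> x' \<and> gaps u a b \<omega>} - prob {\<omega>\<in>space R. arrival N 1 \<omega> \<le> x \<and> gaps u a b \<omega>}"
    using sets x by (simp add: finite_measure_Diff subset_eq)
  moreover have "prob {\<omega>\<in>space R. arrival N 1 \<omega> \<le> y \<and> gaps u a b \<omega>} =
      prob ({\<omega>\<in>space R. N y \<omega> = 1} \<inter> now) / prob now * prob {\<omega>\<in>now. gaps u a b \<omega>}"
    if "0 < y" "y < t" for y
    using gaps_independent[OF that u, of a b] False by (simp add: nonzero_eq_divide_eq)
  ultimately show ?thesis using x by (simp only: left_diff_distrib)
qed

end

text \<open>If the first gap lies in \<open>(x, x']\<close>, a second arrival beyond
  \<open>u\<close> is implied by a second gap above \<open>u - x\<close> and implies one above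
  \<open>u - x'\<close>. These are the two bounds of \<open>splits\<close>, with the third and
  fourth gaps as weight.\<close>

lemma (in smooth_mixture) markov_imp_exponential:
  assumes "prob_space R" "counting_process R N" "markov_property R N"
    and law: "\<And>x y a b c. 0 < x \<Longrightarrow> x < y \<Longrightarrow> 0 < a \<Longrightarrow> 0 < b \<Longrightarrow> 0 < c \<Longrightarrow>
      measure R {\<omega>\<in>space R. x < interarrival N 1 \<omega> \<and> interarrival N 1 \<omega> \<le> y \<and> c < interarrival N 2 \<omega> \<and>
          a < interarrival N 3 \<omega> \<and> b < interarrival N 4 \<omega>} =
      gain (\<lambda>\<theta>. H \<theta> a * H \<theta> b) x y c"
  shows "AE \<theta> in M. \<forall>t>0. F \<theta> t = 1 - exp (- (p \<theta> * t))"
proof (rule survival_exponential)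
  fix a b t :: real assume pos: "0 < a" "0 < b" "0 < t"
  interpret R: markov_counting R N t
    unfolding markov_counting_def markov_counting_axioms_def by (intro conjI assms(1-3) pos(3))
  have [measurable]: "arrival N n \<in> borel_measurable R" "interarrival N n \<in> borel_measurable R" for n
    using assms(2) by (auto intro: borel_measurable_arrival borel_measurable_interarrival)
  define r where "r = (\<lambda>x. R.prob ({\<omega>\<in>space R. N x \<omega> = 1} \<inter> R.now) / R.prob R.now)"
  define \<beta> where "\<beta> = (\<lambda>u. R.prob {\<omega>\<in>R.now. R.gaps u a b \<omega>})"
  have arr: "arrival N 1 \<omega> = interarrival N 1 \<omega>" "arrival N 2 \<omega> = interarrival N 1 \<omega> + interarrival N 2 \<omega>" for \<omega>
    by (auto simp: interarrival_def arrival_def[of N 0])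
  have "gain (\<lambda>\<theta>. H \<theta> a * H \<theta> b) x x' (u - x) \<le> (r x' - r x) * \<beta> u \<and>
      (r x' - r x) * \<beta> u \<le> gain (\<lambda>\<theta>. H \<theta> a * H \<theta> b) x x' (u - x')"
    if x: "0 < x" "x < x'" "x' < t" "t \<le> u" for x x' u
  proof -
    have x1: "0 < u - x" "0 < u - x'" using x by auto
    have eq: "(r x' - r x) * \<beta> u = R.prob {\<omega>\<in>space R. x < arrival N 1 \<omega> \<and> arrival N 1 \<omega> \<le> x' \<and> R.gaps u a b \<omega>}"
      unfolding r_def \<beta>_def using R.gaps_increment[OF x] by simp
    show ?thesis
      unfolding eq law[OF x(1,2) pos(1,2) x1(1), symmetric] law[OF x(1,2) pos(1,2) x1(2), symmetric]
    proof (intro conjI R.finite_measure_mono)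
      show "{\<omega>\<in>space R. x < arrival N 1 \<omega> \<and> arrival N 1 \<omega> \<le> x' \<and> R.gaps u a b \<omega>} \<in> R.events"
        unfolding R.gaps_def by measurable
    qed (auto simp: R.gaps_def arr[unfolded One_nat_def])
  qed
  then show "splits (\<lambda>\<theta>. H \<theta> a * H \<theta> b) t" unfolding splits_def
    by blast
qed

section \<open>Disintegrations and conditional renewal structure\<close>

text \<open>Countably many generators keep the exceptional null sets in \<open>AE_renewal\<close>
  countable in number.\<close>

lemma borel_eq_atMost_Rats: "(borel :: real measure) = sigma UNIV ((\<lambda>q. {..q}) ` \<rat>)"
proof (rule borel_eq_sigmaI1[OF borel_eq_atMost])
  fix X :: "real set" assume "X \<in> range (\<lambda>a. {..a})"
  then obtain a where X: "X = {..a}" by auto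
  have "{..a} = (\<Inter>q\<in>{q\<in>\<rat>. a < q}. {..q})"
  proof (intro equalityI subsetI)
    fix x assume x: "x \<in> (\<Inter>q\<in>{q\<in>\<rat>. a < q}. {..q})"
    show "x \<in> {..a}"
    proof (rule ccontr)
      assume "x \<notin> {..a}"
      then obtain q where "q \<in> \<rat>" "a < q" "q < x" using Rats_dense_in_real[of a x] by auto
      then show False using x by force
    qed
  qed auto
  also have "\<dots> \<in> sets (sigma UNIV ((\<lambda>q. {..q}) ` \<rat>))"
  proof (rule sets.countable_INT')
    show "countable {q\<in>\<rat>. a < (q::real)}" by (rule countable_subset[OF _ countable_rat]) auto
    show "{q\<in>\<rat>. a < (q::real)} \<noteq> {}" using Rats_dense_in_real[of a "a + 1"] by auto
    show "atMost ` {q\<in>\<rat>. a < (q::real)} \<subseteq> sets (sigma UNIV (atMost ` \<rat>))" by auto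
  qed
  finally show "X \<in> sets (sigma UNIV ((\<lambda>q. {..q}) ` \<rat>))" by (simp add: X)
qed auto

text \<open>Rational half-lines are stable under intersection, so independence of their preimages
  extends to the generated sigma-algebras.\<close>

lemma (in prob_space) indep_vars_Rats:
  fixes X :: "'i \<Rightarrow> 'a \<Rightarrow> real"
  assumes X: "\<And>i. i \<in> I \<Longrightarrow> X i \<in> borel_measurable M"
    and indep: "\<And>J q. J \<subseteq> I \<Longrightarrow> finite J \<Longrightarrow> J \<noteq> {} \<Longrightarrow> q \<in> J \<rightarrow> \<rat> \<Longrightarrow>
      prob (\<Inter>j\<in>J. X j -` {..q j} \<inter> space M) = (\<Prod>j\<in>J. prob (X j -` {..q j} \<inter> space M))"
  shows "indep_vars (\<lambda>_. borel) X I"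
proof -
  define G where "G = (\<lambda>i. {X i -` A \<inter> space M | A. A \<in> atMost ` \<rat>})"
  have sig: "{X i -` A \<inter> space M | A. A \<in> sets borel} = sigma_sets (space M) (G i)" for i
    unfolding G_def by (subst sigma_sets_vimage_commute[symmetric, where \<Omega>'=UNIV]) (auto simp: borel_eq_atMost_Rats)
  have "indep_sets G I"
  proof (rule indep_setsI)
    show "G i \<subseteq> events" if "i \<in> I" for i
      using measurable_sets[OF X[OF that]] by (auto simp: G_def)
    fix A J assume J: "J \<noteq> {}" "J \<subseteq> I" "finite J" and A: "\<forall>j\<in>J. A j \<in> G j"
    then have "\<forall>j\<in>J. \<exists>q\<in>\<rat>. A j = X j -` {..q} \<inter> space M" by (fastforce simp: G_def)
    then obtain q where q: "\<And>j. j \<in> J \<Longrightarrow> q j \<in> \<rat>" "\<And>j. j \<in> J \<Longrightarrow> A j = X j -` {..q j} \<inter> space M" by metis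
    then have "(\<Inter>j\<in>J. A j) = (\<Inter>j\<in>J. X j -` {..q j} \<inter> space M)" by auto
    with q indep[OF J(2,3,1), of q] show "prob (\<Inter>j\<in>J. A j) = (\<Prod>j\<in>J. prob (A j))" by (auto cong: prod.cong)
  qed
  moreover have "Int_stable (G i)" for i
  proof (rule Int_stableI)
    fix a b assume "a \<in> G i" "b \<in> G i"
    then obtain q r where qr: "q \<in> \<rat>" "r \<in> \<rat>" "a = X i -` {..q} \<inter> space M" "b = X i -` {..r} \<inter> space M"
      by (auto simp: G_def)
    then have "a \<inter> b = X i -` {..min q r} \<inter> space M" by auto
    moreover have "min q r \<in> \<rat>" using qr by (simp add: min_def)
    ultimately show "a \<inter> b \<in> G i" by (auto simp: G_def)
  qed
  ultimately have "indep_sets (\<lambda>i. sigma_sets (space M) (G i)) I" by (intro indep_sets_sigma) auto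
  then show ?thesis unfolding indep_vars_def2 sig using X by simp
qed

lemma (in prob_space) renewal_gaps_prob:
  fixes W :: "nat \<Rightarrow> 'a \<Rightarrow> real"
  assumes ind: "indep_vars (\<lambda>_. borel) W {1..}"
    and \<Phi>: "\<And>n t. n \<ge> 1 \<Longrightarrow> t \<ge> 0 \<Longrightarrow> prob {\<omega>\<in>space M. W n \<omega> \<le> t} = \<Phi> t"
    and pos: "0 < x" "x < y" "0 < a" "0 < b" "0 < c"
  shows "prob {\<omega>\<in>space M. x < W 1 \<omega> \<and> W 1 \<omega> \<le> y \<and> c < W 2 \<omega> \<and> a < W 3 \<omega> \<and> b < W 4 \<omega>} =
    ((1 - \<Phi> a) * (1 - \<Phi> b)) * (\<Phi> y - \<Phi> x) * (1 - \<Phi> c)"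
proof -
  have [measurable]: "W n \<in> borel_measurable M" if "n \<ge> 1" for n
    using ind that by (auto simp: indep_vars_def)
  have gt: "prob {\<omega>\<in>space M. s < W n \<omega>} = 1 - \<Phi> s" if "n \<ge> 1" "s > 0" for n s
  proof -
    have "{\<omega>\<in>space M. s < W n \<omega>} = space M - {\<omega>\<in>space M. W n \<omega> \<le> s}" by auto
    then show ?thesis using that \<Phi>[of n s] by (simp add: prob_compl)
  qed
  have "prob {\<omega>\<in>space M. x < W 1 \<omega> \<and> W 1 \<omega> \<le> y} = prob ({\<omega>\<in>space M. W 1 \<omega> \<le> y} - {\<omega>\<in>space M. W 1 \<omega> \<le> x})"
    by (intro arg_cong[where f=prob]) auto
  also have "\<dots> = \<Phi> y - \<Phi> x" using pos \<Phi>[of 1] by (subst finite_measure_Diff) auto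
  finally have mid: "prob {\<omega>\<in>space M. x < W 1 \<omega> \<and> W 1 \<omega> \<le> y} = \<Phi> y - \<Phi> x" .
  define B where "B = (\<lambda>i::nat. if i = 1 then {x<..y} else if i = 2 then {c<..} else if i = 3 then {a<..} else {b<..})"
  have "prob (\<Inter>i\<in>{1,2,3,4}. W i -` B i \<inter> space M) = (\<Prod>i\<in>{1,2,3,4}. prob (W i -` B i \<inter> space M))"
    by (rule indep_varsD[OF ind]) (auto simp: B_def)
  moreover have "(\<Inter>i\<in>{1,2,3,4}. W i -` B i \<inter> space M) =
      {\<omega>\<in>space M. x < W 1 \<omega> \<and> W 1 \<omega> \<le> y \<and> c < W 2 \<omega> \<and> a < W 3 \<omega> \<and> b < W 4 \<omega>}"
    by (auto simp: B_def)
  moreover have "W 1 -` B 1 \<inter> space M = {\<omega>\<in>space M. x < W 1 \<omega> \<and> W 1 \<omega> \<le> y}"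
    "W 2 -` B 2 \<inter> space M = {\<omega>\<in>space M. c < W 2 \<omega>}"
    "W 3 -` B 3 \<inter> space M = {\<omega>\<in>space M. a < W 3 \<omega>}"
    "W 4 -` B 4 \<inter> space M = {\<omega>\<in>space M. b < W 4 \<omega>}"
    by (auto simp: B_def)
  ultimately show ?thesis using gt pos mid by simp
qed

lemma restrict_borel_UNIV: "restrict_space borel UNIV = borel"
  by (rule measure_eqI) (auto simp: emeasure_restrict_space sets_restrict_space)

lemma disintegration_measurable:
  assumes "disintegration P E X R" "A \<in> sets P"
  shows "(\<lambda>x. measure (R x) A) \<in> borel_measurable (restrict_space borel E)"
  unfolding measure_def using assms by (intro borel_measurable_enn2real) (auto simp: disintegration_def)

lemma disintegration_integral:
  assumes "prob_space P" and dis: "disintegration P E X R" and A: "A \<in> sets P"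
    and X: "X \<in> measurable P (restrict_space borel E)"
  shows "measure P A = (\<integral>x. measure (R x) A \<partial>distr P (restrict_space borel E) X)"
proof -
  interpret prob_space P by fact
  have R: "prob_space (R x)" if "x \<in> E" for x using dis that by (auto simp: disintegration_def)
  have "ennreal (measure P A) = (\<integral>\<^sup>+x. emeasure (R x) A \<partial>distr P (restrict_space borel E) X)"
    using dis A by (auto simp: disintegration_def emeasure_eq_measure)
  also have "\<dots> = (\<integral>\<^sup>+x. ennreal (measure (R x) A) \<partial>distr P (restrict_space borel E) X)"
    by (intro nn_integral_cong) (auto simp: space_restrict_space finite_measure.emeasure_eq_measure[OF prob_space.finite_measure] R)
  finally have *: "(\<integral>\<^sup>+x. ennreal (measure (R x) A) \<partial>distr P (restrict_space borel E) X) = ennreal (measure P A)" ..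
  have "(\<integral>x. measure (R x) A \<partial>distr P (restrict_space borel E) X) = measure P A"
    by (rule integral_eq_nn_integral[THEN trans])
      (use * disintegration_measurable[OF dis A] in auto)
  then show ?thesis ..
qed

text \<open>For fixed times and counts the factor \<open>c\<close> does not depend on the parameter,
  so the identity can be integrated.\<close>

lemma multinomial_mixture:
  assumes "prob_space P" and dis: "disintegration P UNIV X Q" and X: "X \<in> borel_measurable P"
    and N: "counting_process P N"
    and mult: "AE x in distr P borel X. multinomial_property (Q x) N"
  shows "multinomial_property P N"
  unfolding multinomial_property_def Let_def
proof (intro allI impI)
  fix m :: nat and t :: "nat \<Rightarrow> real" and k :: "nat \<Rightarrow> nat"
  assume m: "1 \<le> m" and t0: "t 0 = 0" and t: "\<forall>j<m. t j < t (Suc j)"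
  define c where "c = fact (\<Sum>j=1..m. k j) / (\<Prod>j=1..m. fact (k j)) * (\<Prod>j=1..m. ((t j - t (j - 1)) / t m) ^ k j)"
  define A where "A = {\<omega>\<in>space P. \<forall>j\<in>{1..m}. N (t j) \<omega> - N (t (j - 1)) \<omega> = enat (k j)}"
  define B where "B = {\<omega>\<in>space P. N (t m) \<omega> = enat (\<Sum>j=1..m. k j)}"
  have tpos: "0 \<le> t j" if "j \<le> m" for j
    unfolding t0[symmetric] by (rule nat_interval_mono) (use that t in \<open>auto intro: less_imp_le\<close>)
  \<comment> \<open>Increments are rewritten as states, whose events are known to be
    measurable.\<close>
  have A: "A \<in> sets P"
  proof -
    define n where "n = (\<lambda>j. \<Sum>i=1..j. k i)"
    have kn: "k j = n j - n (j - 1)" if "j \<in> {1..m}" for j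
      using that by (cases j) (auto simp: n_def)
    have "(\<forall>j\<in>{1..m}. N (t j) \<omega> - N (t (j - 1)) \<omega> = enat (n j - n (j - 1))) \<longleftrightarrow>
        (\<forall>j\<in>{1..m}. N (t j) \<omega> = enat (n j))" if "\<omega> \<in> space P" for \<omega>
      by (rule increments_eq_iff[OF N that, of t m n]) (use t t0 in \<open>auto simp: n_def intro: less_imp_le\<close>)
    then have "A = {\<omega>\<in>space P. \<forall>j\<in>{1..m}. N (t j) \<omega> = enat (n j)}"
      unfolding A_def by (intro Collect_cong conj_cong refl) (simp add: kn)
    then show ?thesis by (simp only:) (intro counting_event_measurable[OF N]; use tpos in auto)
  qed
  have B: "B \<in> sets P"
    using tpos[of m] counting_event_measurable[OF N, of "{m}" t "\<lambda>_. enat (\<Sum>j=1..m. k j)"] by (simp add: B_def)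
  have X': "X \<in> measurable P (restrict_space borel UNIV)" using X by simp
  have spaceQ: "space (Q x) = space P" for x
    using dis by (intro sets_eq_imp_space_eq) (auto simp: disintegration_def)
  have "AE x in distr P borel X. measure (Q x) A = c * measure (Q x) B"
    using mult
  proof eventually_elim
    case (elim x)
    from elim[unfolded multinomial_property_def Let_def, rule_format, of m t k] m t0 t
    show ?case by (simp add: A_def B_def c_def spaceQ)
  qed
  then have "(\<integral>x. measure (Q x) A \<partial>distr P borel X) = (\<integral>x. c * measure (Q x) B \<partial>distr P borel X)"
    using disintegration_measurable[OF dis A] disintegration_measurable[OF dis B]
    by (intro integral_cong_AE) auto
  then have "measure P A = c * measure P B"
    using disintegration_integral[OF assms(1) dis A X'] disintegration_integral[OF assms(1) dis B X']
    by (simp add: restrict_borel_UNIV)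
  then show "\<P>(\<omega> in P. \<forall>j\<in>{1..m}. N (t j) \<omega> - N (t (j - 1)) \<omega> = enat (k j)) =
      fact (\<Sum>j=1..m. k j) / (\<Prod>j=1..m. fact (k j)) * (\<Prod>j=1..m. ((t j - t (j - 1)) / t m) ^ k j) *
      \<P>(\<omega> in P. N (t m) \<omega> = enat (\<Sum>j=1..m. k j))"
    by (simp add: A_def B_def c_def)
qed

section \<open>Consistent disintegrations and conditional independence\<close>

locale disintegrated = prob_space P for P :: "'a measure" +
  fixes \<Theta> :: "'a \<Rightarrow> 'b::topological_space" and D :: "'b set" and R :: "'b \<Rightarrow> 'a measure"
  assumes \<Theta>: "\<Theta> \<in> borel_measurable P" and D: "D \<in> sets borel" "\<Theta> ` space P \<subseteq> D"
    and dis: "disintegration P D \<Theta> R" and consistent: "consistent_with P D \<Theta> R"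
begin

abbreviation \<mu> :: "'b measure" where "\<mu> \<equiv> distr P (restrict_space borel D) \<Theta>"

lemma \<Theta>_restrict[measurable]: "\<Theta> \<in> measurable P (restrict_space borel D)"
  using \<Theta> D by (intro measurable_restrict_space2) auto

lemma sets_generated: "sets (generated_algebra P \<Theta>) = {\<Theta> -` A \<inter> space P | A. A \<in> sets borel}"
  by (rule sets_vimage_algebra2) auto

lemma subalg: "subalgebra P (generated_algebra P \<Theta>)"
  unfolding subalgebra_def sets_generated using measurable_sets[OF \<Theta>] by auto

lemma prob_space_\<mu>: "prob_space \<mu>" by (rule prob_space_distr) simp

lemma R_prob: "\<theta> \<in> D \<Longrightarrow> prob_space (R \<theta>)" and R_sets: "\<theta> \<in> D \<Longrightarrow> sets (R \<theta>) = sets P"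
  and R_space: "\<theta> \<in> D \<Longrightarrow> space (R \<theta>) = space P"
  using dis sets_eq_imp_space_eq[of "R \<theta>" P] by (auto simp: disintegration_def)

text \<open>Consistency at \<open>E\<close> concentrates \<open>R \<theta>\<close> on the preimage
  of \<open>E\<close> for \<theta> in \<open>E\<close>; consistency at \<open>D - E\<close> makes
  that preimage null for the other \<theta>.\<close>

lemma emeasure_Int_vimage:
  assumes G: "G \<in> events" and E: "E \<in> sets (restrict_space borel D)"
  shows "emeasure P (G \<inter> (\<Theta> -` E \<inter> space P)) = (\<integral>\<^sup>+\<theta>. emeasure (R \<theta>) G * indicator E \<theta> \<partial>\<mu>)"
proof -
  have E': "D - E \<in> sets (restrict_space borel D)"
    using sets.compl_sets[OF E] by (simp add: space_restrict_space)
  have V: "\<Theta> -` E \<inter> space P \<in> events" "\<Theta> -` (D - E) \<inter> space P \<in> events"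
    using measurable_sets[OF \<Theta>_restrict E] measurable_sets[OF \<Theta>_restrict E'] by auto
  have "emeasure P (G \<inter> (\<Theta> -` E \<inter> space P)) = (\<integral>\<^sup>+\<theta>. emeasure (R \<theta>) (G \<inter> (\<Theta> -` E \<inter> space P)) \<partial>\<mu>)"
    using dis G V(1) by (auto simp: disintegration_def)
  also have "\<dots> = (\<integral>\<^sup>+\<theta>. emeasure (R \<theta>) G * indicator E \<theta> \<partial>\<mu>)"
  proof (rule nn_integral_cong_AE)
    have "AE \<theta> in \<mu>. \<theta> \<in> E \<longrightarrow> emeasure (R \<theta>) (\<Theta> -` E \<inter> space P) = 1"
      "AE \<theta> in \<mu>. \<theta> \<in> D - E \<longrightarrow> emeasure (R \<theta>) (\<Theta> -` (D - E) \<inter> space P) = 1"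
      using consistent E E' by (auto simp: consistent_with_def)
    then show "AE \<theta> in \<mu>. emeasure (R \<theta>) (G \<inter> (\<Theta> -` E \<inter> space P)) = emeasure (R \<theta>) G * indicator E \<theta>"
      using AE_space
    proof eventually_elim
      fix \<theta> assume 1: "\<theta> \<in> E \<longrightarrow> emeasure (R \<theta>) (\<Theta> -` E \<inter> space P) = 1"
        and 2: "\<theta> \<in> D - E \<longrightarrow> emeasure (R \<theta>) (\<Theta> -` (D - E) \<inter> space P) = 1" and \<theta>: "\<theta> \<in> space \<mu>"
      have \<theta>D: "\<theta> \<in> D" using \<theta> by (simp add: space_restrict_space)
      interpret R: prob_space "R \<theta>" by (rule R_prob[OF \<theta>D])
      note S = R_sets[OF \<theta>D] R_space[OF \<theta>D]
      show "emeasure (R \<theta>) (G \<inter> (\<Theta> -` E \<inter> space P)) = emeasure (R \<theta>) G * indicator E \<theta>"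
      proof (cases "\<theta> \<in> E")
        case True
        then have "AE \<omega> in R \<theta>. \<omega> \<in> \<Theta> -` E \<inter> space P"
          using 1 V S by (intro R.AE_in_set_eq_1[THEN iffD2]) (auto simp: R.emeasure_eq_measure)
        then have "emeasure (R \<theta>) (G \<inter> (\<Theta> -` E \<inter> space P)) = emeasure (R \<theta>) G"
          using G V S by (intro emeasure_eq_AE) auto
        then show ?thesis using True by simp
      next
        case False
        then have "AE \<omega> in R \<theta>. \<omega> \<in> \<Theta> -` (D - E) \<inter> space P"
          using 2 \<theta>D V S by (intro R.AE_in_set_eq_1[THEN iffD2]) (auto simp: R.emeasure_eq_measure)
        then have "emeasure (R \<theta>) (G \<inter> (\<Theta> -` E \<inter> space P)) = emeasure (R \<theta>) {}"
          using G V S by (intro emeasure_eq_AE) auto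
        then show ?thesis using False by simp
      qed
    qed
  qed
  finally show ?thesis .
qed

lemma emeasure_R_measurable: "G \<in> events \<Longrightarrow> (\<lambda>\<theta>. emeasure (R \<theta>) G) \<in> borel_measurable \<mu>"
  using dis by (auto simp: disintegration_def)

text \<open>Both functions are densities with respect to \<mu> of the finite measure taking
  \<open>E\<close> to the probability of \<open>G\<close> with \<Theta> in \<open>E\<close>, so they
  agree almost everywhere.\<close>

lemma AE_R_eq_conditional:
  assumes G: "G \<in> events" and v: "v \<in> borel_measurable (restrict_space borel D)" "\<And>\<theta>. \<theta> \<in> D \<Longrightarrow> 0 \<le> v \<theta> \<and> v \<theta> \<le> 1"
    and cond: "AE \<omega> in P. real_cond_exp P (generated_algebra P \<Theta>) (indicator G) \<omega> = v (\<Theta> \<omega>)"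
  shows "AE \<theta> in \<mu>. measure (R \<theta>) G = v \<theta>"
proof -
  interpret \<mu>: prob_space \<mu> by (rule prob_space_\<mu>)
  interpret S: finite_measure_subalgebra P "generated_algebra P \<Theta>"
    using subalg by unfold_locales
  have vP[measurable]: "(\<lambda>\<omega>. v (\<Theta> \<omega>)) \<in> borel_measurable P"
    using measurable_compose[OF \<Theta>_restrict v(1)] .
  have "AE \<theta> in \<mu>. emeasure (R \<theta>) G = ennreal (v \<theta>)"
  proof (rule \<mu>.density_unique_finite_measure)
    show "(\<lambda>\<theta>. emeasure (R \<theta>) G) \<in> borel_measurable \<mu>" by (rule emeasure_R_measurable[OF G])
    show "(\<lambda>\<theta>. ennreal (v \<theta>)) \<in> borel_measurable \<mu>" using v(1) by simp
    fix E assume "E \<in> sets \<mu>"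
    then have E: "E \<in> sets (restrict_space borel D)" by simp
    then have E': "E \<in> sets borel" using D by (auto simp: sets_restrict_space)
    define V where "V = \<Theta> -` E \<inter> space P"
    have V: "V \<in> sets (generated_algebra P \<Theta>)" using E' by (auto simp: V_def sets_generated)
    then have Ve: "V \<in> events" using subalg by (auto simp: subalgebra_def)
    have "measure P (G \<inter> V) = (\<integral>\<omega>\<in>V. indicator G \<omega> \<partial>P)"
      using G Ve by (simp add: set_lebesgue_integral_def indicator_inter_arith[symmetric] Int_commute)
    also have "\<dots> = (\<integral>\<omega>\<in>V. real_cond_exp P (generated_algebra P \<Theta>) (indicator G) \<omega> \<partial>P)"
      using G V by (intro S.real_cond_exp_intA integrable_real_indicator) (auto simp: emeasure_eq_measure)
    also have "\<dots> = (\<integral>\<omega>. v (\<Theta> \<omega>) * indicator V \<omega> \<partial>P)"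
      unfolding set_lebesgue_integral_def using cond Ve
      by (intro integral_cong_AE) (auto simp: mult.commute)
    finally have eq: "measure P (G \<inter> V) = (\<integral>\<omega>. v (\<Theta> \<omega>) * indicator V \<omega> \<partial>P)" .
    have v01: "0 \<le> v (\<Theta> \<omega>) \<and> v (\<Theta> \<omega>) \<le> 1" if "\<omega> \<in> space P" for \<omega> using v(2) D(2) that by auto
    have "(\<integral>\<^sup>+\<theta>. emeasure (R \<theta>) G * indicator E \<theta> \<partial>\<mu>) = ennreal (measure P (G \<inter> V))"
      using emeasure_Int_vimage[OF G E] by (simp add: V_def emeasure_eq_measure)
    also have "\<dots> = (\<integral>\<^sup>+\<omega>. ennreal (v (\<Theta> \<omega>) * indicator V \<omega>) \<partial>P)"
      unfolding eq using v01 Ve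
      by (intro nn_integral_eq_integral[symmetric] integrable_const_bound[where B=1] AE_I2)
        (auto simp: indicator_def)
    also have "\<dots> = (\<integral>\<^sup>+\<omega>. ennreal (v (\<Theta> \<omega>)) * indicator E (\<Theta> \<omega>) \<partial>P)"
      by (intro nn_integral_cong) (auto simp: V_def indicator_def)
    also have "\<dots> = (\<integral>\<^sup>+\<theta>. ennreal (v \<theta>) * indicator E \<theta> \<partial>\<mu>)"
      using v(1) E by (intro nn_integral_distr[symmetric]) auto
    finally show "(\<integral>\<^sup>+\<theta>. emeasure (R \<theta>) G * indicator E \<theta> \<partial>\<mu>) = (\<integral>\<^sup>+\<theta>. ennreal (v \<theta>) * indicator E \<theta> \<partial>\<mu>)" .
  qed auto
  then show ?thesis using AE_space
  proof eventually_elim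
    fix \<theta> assume "emeasure (R \<theta>) G = ennreal (v \<theta>)" "\<theta> \<in> space \<mu>"
    then show "measure (R \<theta>) G = v \<theta>" using v(2)[of \<theta>] by (simp add: measure_def space_restrict_space)
  qed
qed

text \<open>Conditional independence under \<open>P\<close> gives, through
  \<open>AE_R_eq_conditional\<close>, the product formula for one box outside one null set. Boxes
  with rational corners suffice, and there are countably many.\<close>

lemma AE_renewal:
  fixes h :: "'b \<Rightarrow> 'c::topological_space"
  assumes N: "counting_process P N" and eMRP: "eMRP P N \<Theta> K h"
    and h: "h \<in> borel_measurable (restrict_space borel D)" and K: "K \<in> measurable borel (prob_algebra borel)"
    and law: "\<And>n \<theta>. n \<ge> 1 \<Longrightarrow> \<theta> \<in> D \<Longrightarrow> distr (R \<theta>) borel (interarrival N n) = K (h \<theta>)"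
  shows "AE \<theta> in \<mu>. prob_space.indep_vars (R \<theta>) (\<lambda>_. borel) (interarrival N) {1..}"
proof -
  define W where "W = interarrival N"
  have W[measurable]: "W n \<in> borel_measurable P" for n
    unfolding W_def by (rule borel_measurable_interarrival[OF N])
  have KB[measurable]: "(\<lambda>\<theta>. measure (K (h \<theta>)) B) \<in> borel_measurable (restrict_space borel D)" if "B \<in> sets borel" for B
  proof -
    have "(\<lambda>\<theta>. K (h \<theta>)) \<in> measurable (restrict_space borel D) (subprob_algebra borel)"
      using measurable_compose[OF h measurable_prob_algebraD[OF K]] .
    then show ?thesis using that by (rule measurable_compose[OF _ measurable_measure_subprob_algebra])
  qed
  have Kprob: "prob_space (K y)" for y
    using measurable_space[OF K, of y] by (simp add: space_prob_algebra)
  have box: "AE \<theta> in \<mu>. measure (R \<theta>) (\<Inter>j\<in>J. W j -` {..q j} \<inter> space P) = (\<Prod>j\<in>J. measure (K (h \<theta>)) {..q j})"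
    if J: "J \<subseteq> {1..}" "finite J" "J \<noteq> {}" for J and q :: "nat \<Rightarrow> real"
  proof (rule AE_R_eq_conditional)
    show "(\<Inter>j\<in>J. W j -` {..q j} \<inter> space P) \<in> events"
      using J measurable_sets[OF W] by (intro sets.finite_INT) auto
    show "(\<lambda>\<theta>. \<Prod>j\<in>J. measure (K (h \<theta>)) {..q j}) \<in> borel_measurable (restrict_space borel D)"
      by (intro borel_measurable_prod KB) auto
    show "0 \<le> (\<Prod>j\<in>J. measure (K (h \<theta>)) {..q j}) \<and> (\<Prod>j\<in>J. measure (K (h \<theta>)) {..q j}) \<le> 1" for \<theta>
      by (intro conjI prod_nonneg prod_le_1 ballI) (simp_all add: prob_space.prob_le_1[OF Kprob])
    have one: "AE \<omega> in P. real_cond_exp P (generated_algebra P \<Theta>) (indicator (W j -` {..q j} \<inter> space P)) \<omega> =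
        measure (K (h (\<Theta> \<omega>))) {..q j}" if j: "j \<in> J" for j
    proof -
      have "1 \<le> j" using j J by auto
      then obtain \<kappa> where \<kappa>: "cond_distribution P (generated_algebra P \<Theta>) (W j) \<kappa>"
        "AE \<omega> in restr_to_subalg P (generated_algebra P \<Theta>). \<kappa> \<omega> = K (h (\<Theta> \<omega>))"
        using eMRP unfolding eMRP_def W_def by auto
      have "AE \<omega> in P. measure (\<kappa> \<omega>) {..q j} = real_cond_exp P (generated_algebra P \<Theta>) (indicator (W j -` {..q j} \<inter> space P)) \<omega>"
        using \<kappa>(1) by (auto simp: cond_distribution_def)
      with AE_restr_to_subalg[OF subalg \<kappa>(2)] show ?thesis by eventually_elim simp
    qed
    then have "AE \<omega> in P. \<forall>j\<in>J. real_cond_exp P (generated_algebra P \<Theta>) (indicator (W j -` {..q j} \<inter> space P)) \<omega> =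
        measure (K (h (\<Theta> \<omega>))) {..q j}" using J by (intro AE_finite_allI) auto
    moreover have "AE \<omega> in P. real_cond_exp P (generated_algebra P \<Theta>) (indicator (\<Inter>j\<in>J. W j -` {..q j} \<inter> space P)) \<omega> =
      (\<Prod>j\<in>J. real_cond_exp P (generated_algebra P \<Theta>) (indicator (W j -` {..q j} \<inter> space P)) \<omega>)"
    proof -
      have "cond_indep_vars P (generated_algebra P \<Theta>) (\<lambda>_. borel) W {1..}"
        using eMRP by (simp add: eMRP_def W_def)
      then show ?thesis using J unfolding cond_indep_vars_def
        by (elim conjE allE[of _ J] impE allE[of _ "\<lambda>j. {..q j}"]) auto
    qed
    ultimately show "AE \<omega> in P. real_cond_exp P (generated_algebra P \<Theta>) (indicator (\<Inter>j\<in>J. W j -` {..q j} \<inter> space P)) \<omega> =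
      (\<Prod>j\<in>J. measure (K (h (\<Theta> \<omega>))) {..q j})" by eventually_elim simp
  qed
  \<comment> \<open>Extensional functions from a finite \<open>J\<close> to the rationals form a
    countable set, so one null set serves all boxes.\<close>
  have "AE \<theta> in \<mu>. \<forall>J\<in>{J. finite J \<and> J \<subseteq> {1..} \<and> J \<noteq> {}}. \<forall>q\<in>J \<rightarrow>\<^sub>E \<rat>.
    measure (R \<theta>) (\<Inter>j\<in>J. W j -` {..q j} \<inter> space P) = (\<Prod>j\<in>J. measure (K (h \<theta>)) {..q j})"
  proof (intro AE_ball_countable')
    show "countable {J. finite J \<and> J \<subseteq> {1..} \<and> J \<noteq> ({} :: nat set)}"
      by (rule countable_subset[OF _ countable_Collect_finite]) auto
    show "countable (J \<rightarrow>\<^sub>E (\<rat> :: real set))" if "J \<in> {J. finite J \<and> J \<subseteq> {1..} \<and> J \<noteq> ({} :: nat set)}" for J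
      using that by (intro countable_PiE countable_rat) auto
  qed (use box in auto)
  then show ?thesis using AE_space
  proof eventually_elim
    fix \<theta> assume boxes: "\<forall>J\<in>{J. finite J \<and> J \<subseteq> {1..} \<and> J \<noteq> {}}. \<forall>q\<in>J \<rightarrow>\<^sub>E \<rat>.
      measure (R \<theta>) (\<Inter>j\<in>J. W j -` {..q j} \<inter> space P) = (\<Prod>j\<in>J. measure (K (h \<theta>)) {..q j})"
      and "\<theta> \<in> space \<mu>"
    then have \<theta>: "\<theta> \<in> D" by (simp add: space_restrict_space)
    interpret R: prob_space "R \<theta>" by (rule R_prob[OF \<theta>])
    have WR[measurable]: "W n \<in> borel_measurable (R \<theta>)" for n
      using W by (simp add: measurable_cong_sets[OF R_sets[OF \<theta>] refl])
    \<comment> \<open>The assumed law identifies the factors from \<open>K\<close> with the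
      marginals under \<open>R \<theta>\<close>, turning the box formula into independence.\<close>
    have KW: "measure (K (h \<theta>)) {..q} = R.prob (W j -` {..q} \<inter> space (R \<theta>))" if "j \<ge> 1" for j q
      using law[OF that \<theta>] WR by (metis W_def measure_distr atMost_borel)
    show "R.indep_vars (\<lambda>_. borel) (interarrival N) {1..}"
      unfolding W_def[symmetric]
    proof (rule R.indep_vars_Rats)
      fix J and q :: "nat \<Rightarrow> real" assume J: "J \<subseteq> {1..}" "finite J" "J \<noteq> {}" "q \<in> J \<rightarrow> \<rat>"
      have "measure (R \<theta>) (\<Inter>j\<in>J. W j -` {..restrict q J j} \<inter> space P) = (\<Prod>j\<in>J. measure (K (h \<theta>)) {..restrict q J j})"
        using J by (intro boxes[rule_format]) auto
      then have "measure (R \<theta>) (\<Inter>j\<in>J. W j -` {..q j} \<inter> space P) = (\<Prod>j\<in>J. measure (K (h \<theta>)) {..q j})"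
        by (simp cong: INF_cong prod.cong)
      also have "\<dots> = (\<Prod>j\<in>J. R.prob (W j -` {..q j} \<inter> space (R \<theta>)))"
        using J by (intro prod.cong KW) auto
      finally show "R.prob (\<Inter>j\<in>J. W j -` {..q j} \<inter> space (R \<theta>)) = (\<Prod>j\<in>J. R.prob (W j -` {..q j} \<inter> space (R \<theta>)))"
        by (simp add: R_space[OF \<theta>])
    qed simp
  qed
qed

end

section \<open>The reparametrized disintegration\<close>

lemma C1_differentiable_on_real:
  fixes f :: "real \<Rightarrow> real"
  assumes "f C1_differentiable_on S"
  shows "\<And>x. x \<in> S \<Longrightarrow> (f has_real_derivative deriv f x) (at x)" "continuous_on S (deriv f)"
proof -
  obtain D where D: "\<And>x. x \<in> S \<Longrightarrow> (f has_vector_derivative D x) (at x)" "continuous_on S D"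
    using assms by (auto simp: C1_differentiable_on_def)
  then have f: "(f has_real_derivative D x) (at x)" if "x \<in> S" for x
    using that by (simp add: has_real_derivative_iff_has_vector_derivative)
  then have eq: "deriv f x = D x" if "x \<in> S" for x
    using that by (intro DERIV_imp_deriv) auto
  show "\<And>x. x \<in> S \<Longrightarrow> (f has_real_derivative deriv f x) (at x)" using f eq by simp
  show "continuous_on S (deriv f)" using D(2) eq by (simp cong: continuous_on_cong)
qed

section \<open>Smoothness of the renewal model\<close>

locale identifiable_renewal = disintegrated P \<Theta> D P\<^sub>\<theta>
  for P :: "'a measure" and \<Theta> :: "'a \<Rightarrow> 'b::euclidean_space" and D :: "'b set" and P\<^sub>\<theta> :: "'b \<Rightarrow> 'a measure" +
  fixes L\<^sub>0 L\<^sub>h :: "'b set" and h :: "'b \<Rightarrow> 'c::topological_space" and K :: "'c \<Rightarrow> real measure"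
    and N :: "real \<Rightarrow> 'a \<Rightarrow> enat" and F :: "'c \<Rightarrow> real \<Rightarrow> real" and C :: "'c \<Rightarrow> real"
    and p\<^sub>h :: "'b \<Rightarrow> real" and \<Theta>h :: "'a \<Rightarrow> real"
  assumes h: "h \<in> borel_measurable (restrict_space borel D)"
    and L\<^sub>0: "L\<^sub>0 \<in> null_sets \<mu>"
    and K: "K \<in> measurable borel (prob_algebra borel)"
    and N: "counting_process P N"
    and eMRP: "eMRP P N \<Theta> K h"
    and law: "\<And>n \<theta>. n \<ge> 1 \<Longrightarrow> \<theta> \<in> D \<Longrightarrow> distr (P\<^sub>\<theta> \<theta>) borel (interarrival N n) = K (h \<theta>)"
    and F: "\<And>n \<theta> t. n \<ge> 1 \<Longrightarrow> \<theta> \<in> D \<Longrightarrow> t \<ge> 0 \<Longrightarrow> F (h \<theta>) t = \<P>(\<omega> in P\<^sub>\<theta> \<theta>. interarrival N n \<omega> \<le> t)"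
    and L\<^sub>h: "L\<^sub>h \<in> null_sets \<mu>"
    and C: "integrable (distr P borel (\<lambda>\<omega>. h (\<Theta> \<omega>))) C"
    and C1: "\<And>\<theta>. \<theta> \<in> D - L\<^sub>h \<Longrightarrow> F (h \<theta>) C1_differentiable_on {0<..}"
    and deriv_bounds: "\<And>\<theta> t. \<theta> \<in> D - L\<^sub>h \<Longrightarrow> t > 0 \<Longrightarrow> 0 < deriv (F (h \<theta>)) t \<and> deriv (F (h \<theta>)) t < C (h \<theta>)"
    and deriv_lim: "\<And>\<theta>. \<theta> \<in> D - L\<^sub>h \<Longrightarrow> (deriv (F (h \<theta>)) \<longlongrightarrow> p\<^sub>h \<theta>) (at_right 0)"
    and p_pos: "\<And>\<theta>. \<theta> \<in> D - L\<^sub>h \<Longrightarrow> p\<^sub>h \<theta> > 0"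
    and p_inj: "inj_on p\<^sub>h (D - L\<^sub>h)"
    and \<Theta>h: "\<Theta>h \<in> borel_measurable P"
    and \<Theta>h_eq: "\<And>\<omega>. \<omega> \<in> space P \<Longrightarrow> \<Theta> \<omega> \<in> D - (L\<^sub>0 \<union> L\<^sub>h) \<Longrightarrow> \<Theta>h \<omega> = p\<^sub>h (\<Theta> \<omega>)"
begin

abbreviation S :: "'b set" where "S \<equiv> D - (L\<^sub>0 \<union> L\<^sub>h)"

abbreviation Q :: "real \<Rightarrow> 'a measure" where "Q \<equiv> reparam_disintegration P P\<^sub>\<theta> p\<^sub>h S"

abbreviation independent_gaps :: "'b \<Rightarrow> bool" where
  "independent_gaps \<theta> \<equiv> prob_space.indep_vars (P\<^sub>\<theta> \<theta>) (\<lambda>_. borel) (interarrival N) {1..}"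

lemma AE_S: "AE \<theta> in \<mu>. \<theta> \<in> S"
  using AE_not_in[OF L\<^sub>0] AE_not_in[OF L\<^sub>h] AE_space
  by eventually_elim (simp add: space_restrict_space)

lemma sets_\<mu>_borel: "A \<in> sets \<mu> \<Longrightarrow> A \<in> sets borel"
  using D(1) by (auto simp: sets_restrict_space)

lemma S_borel: "S \<in> sets borel"
  using D(1) sets_\<mu>_borel L\<^sub>0 L\<^sub>h by (intro sets.Diff sets.Un) auto

lemma AE_\<Theta>: "AE \<theta> in \<mu>. \<Phi> \<theta> \<Longrightarrow> AE \<omega> in P. \<Phi> (\<Theta> \<omega>)"
  by (rule AE_distrD[OF \<Theta>_restrict])

lemma counting_P\<^sub>\<theta>: "\<theta> \<in> D \<Longrightarrow> counting_process (P\<^sub>\<theta> \<theta>) N"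
  by (rule counting_process_cong_sets[OF N R_sets])

lemma interarrival_P\<^sub>\<theta>: "\<theta> \<in> D \<Longrightarrow> interarrival N n \<in> borel_measurable (P\<^sub>\<theta> \<theta>)"
  by (rule borel_measurable_interarrival[OF counting_P\<^sub>\<theta>])

lemma real_distribution_W: "\<theta> \<in> D \<Longrightarrow> real_distribution (distr (P\<^sub>\<theta> \<theta>) borel (interarrival N 1))"
  using R_prob interarrival_P\<^sub>\<theta> by (intro prob_space.real_distribution_distr)

lemma F_cdf: "\<theta> \<in> D \<Longrightarrow> t \<ge> 0 \<Longrightarrow> F (h \<theta>) t = cdf (distr (P\<^sub>\<theta> \<theta>) borel (interarrival N 1)) t"
  using F[of 1 \<theta> t] interarrival_P\<^sub>\<theta>[of \<theta> 1]
  by (auto simp: cdf_def measure_distr intro!: arg_cong[where f="measure (P\<^sub>\<theta> \<theta>)"])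

text \<open>Arrivals increase strictly on every path, so no gap is ever at most 0.\<close>

lemma F_0: assumes \<theta>: "\<theta> \<in> D" shows "F (h \<theta>) 0 = 0"
proof -
  have "F (h \<theta>) 0 = measure (P\<^sub>\<theta> \<theta>) {\<omega> \<in> space (P\<^sub>\<theta> \<theta>). interarrival N 1 \<omega> \<le> 0}"
    by (rule F) (use \<theta> in auto)
  also have "{\<omega> \<in> space (P\<^sub>\<theta> \<theta>). interarrival N 1 \<omega> \<le> 0} = {}"
    using interarrival_pos[OF counting_P\<^sub>\<theta>[OF \<theta>], of _ 1] by force
  finally show ?thesis by simp
qed

lemma F_at_right_0: assumes \<theta>: "\<theta> \<in> D" shows "(F (h \<theta>) \<longlongrightarrow> 0) (at_right 0)"
proof -
  interpret W: real_distribution "distr (P\<^sub>\<theta> \<theta>) borel (interarrival N 1)" by (rule real_distribution_W[OF \<theta>])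
  define c where "c = cdf (distr (P\<^sub>\<theta> \<theta>) borel (interarrival N 1))"
  have c0: "c 0 = 0" using F_cdf[OF \<theta>, of 0] F_0[OF \<theta>] by (simp add: c_def)
  have "(c \<longlongrightarrow> c 0) (at_right 0)"
    using W.cdf_is_right_cont[of 0] by (simp add: continuous_within c_def)
  moreover have "\<forall>\<^sub>F t in at_right 0. F (h \<theta>) t = c t"
    unfolding eventually_at_right_field c_def using F_cdf[OF \<theta>] by (intro exI[of _ 1]) auto
  ultimately show ?thesis by (simp add: c0 tendsto_cong)
qed

lemma F_at_top: assumes \<theta>: "\<theta> \<in> D" shows "(F (h \<theta>) \<longlongrightarrow> 1) at_top"
proof -
  interpret W: real_distribution "distr (P\<^sub>\<theta> \<theta>) borel (interarrival N 1)" by (rule real_distribution_W[OF \<theta>])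
  have "\<forall>\<^sub>F t in at_top. F (h \<theta>) t = cdf (distr (P\<^sub>\<theta> \<theta>) borel (interarrival N 1)) t"
    using eventually_ge_at_top[of 0] by eventually_elim (rule F_cdf[OF \<theta>])
  then show ?thesis using W.cdf_lim_at_top_prob by (simp add: tendsto_cong)
qed

lemma F_measurable: "t \<ge> 0 \<Longrightarrow> (\<lambda>\<theta>. F (h \<theta>) t) \<in> borel_measurable \<mu>"
proof -
  assume t: "t \<ge> 0"
  have "{\<omega> \<in> space P. interarrival N 1 \<omega> \<le> t} \<in> events"
    using borel_measurable_interarrival[OF N, of 1] by measurable
  then have "(\<lambda>\<theta>. measure (P\<^sub>\<theta> \<theta>) {\<omega> \<in> space P. interarrival N 1 \<omega> \<le> t}) \<in> borel_measurable \<mu>"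
    using disintegration_measurable[OF dis] by simp
  also have "?this \<longleftrightarrow> (\<lambda>\<theta>. F (h \<theta>) t) \<in> borel_measurable \<mu>"
    using F[of 1 _ t] t by (intro measurable_cong) (auto simp: space_restrict_space R_space)
  finally show ?thesis .
qed

lemma deriv_F:
  assumes "\<theta> \<in> D - L\<^sub>h"
  shows "\<And>t. t > 0 \<Longrightarrow> (F (h \<theta>) has_real_derivative deriv (F (h \<theta>)) t) (at t)"
    "continuous_on {0<..} (deriv (F (h \<theta>)))"
  using C1_differentiable_on_real[OF C1[OF assms]] by auto

text \<open>
  On the null set \<open>L\<^sub>h\<close> the standard exponential law is substituted, so that the smoothness conditions hold
  without exception.
\<close>

definition F' :: "'b \<Rightarrow> real \<Rightarrow> real" where
  "F' \<theta> t = (if \<theta> \<in> D - L\<^sub>h then F (h \<theta>) t else 1 - exp (- t))"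

definition f' :: "'b \<Rightarrow> real \<Rightarrow> real" where
  "f' \<theta> t = (if \<theta> \<in> D - L\<^sub>h then deriv (F (h \<theta>)) t else exp (- t))"

definition C' :: "'b \<Rightarrow> real" where
  "C' \<theta> = (if \<theta> \<in> D - L\<^sub>h then C (h \<theta>) else 1)"

definition p' :: "'b \<Rightarrow> real" where
  "p' \<theta> = (if \<theta> \<in> D - L\<^sub>h then p\<^sub>h \<theta> else 1)"

lemma D_L\<^sub>h: "D - L\<^sub>h \<in> sets \<mu>"
  using sets.compl_sets[of L\<^sub>h \<mu>] L\<^sub>h by (auto simp: space_restrict_space)

lemma smooth_mixture_\<mu>: "smooth_mixture \<mu> F' f' C' p'"
proof -
  interpret \<mu>: prob_space \<mu> by (rule prob_space_\<mu>)
  note [measurable] = D_L\<^sub>h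
  have DL: "{\<theta> \<in> space \<mu>. \<theta> \<in> D - L\<^sub>h} \<in> sets \<mu>" by measurable
  have hP: "(\<lambda>\<omega>. h (\<Theta> \<omega>)) \<in> borel_measurable P" by (rule measurable_compose[OF \<Theta>_restrict h])
  have C_meas: "C \<in> borel_measurable borel" using borel_measurable_integrable[OF C] by simp
  have Ch_meas: "(\<lambda>\<theta>. C (h \<theta>)) \<in> borel_measurable \<mu>"
    using measurable_compose[OF h C_meas] by simp
  have "integrable P (\<lambda>\<omega>. C (h (\<Theta> \<omega>)))"
    using C C_meas hP by (simp add: integrable_distr_eq)
  then have Ch: "integrable \<mu> (\<lambda>\<theta>. C (h \<theta>))"
    using Ch_meas by (subst integrable_distr_eq) auto
  show ?thesis
  proof
    show "(\<lambda>\<theta>. F' \<theta> t) \<in> borel_measurable \<mu>" if "t > 0" for t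
      unfolding F'_def using F_measurable[of t] that DL by (intro measurable_If) auto
    show "integrable \<mu> C'"
    proof (rule Bochner_Integration.integrable_bound)
      \<comment> \<open>This bound covers both branches of \<open>C'\<close>.\<close>
      show "integrable \<mu> (\<lambda>\<theta>. \<bar>C (h \<theta>)\<bar> + 1)" using Ch by simp
      show "C' \<in> borel_measurable \<mu>"
        unfolding C'_def[abs_def] using Ch_meas DL by (intro measurable_If) auto
    qed (auto simp: C'_def)
    fix \<theta> assume "\<theta> \<in> space \<mu>"
    consider (regular) "\<theta> \<in> D - L\<^sub>h" "F' \<theta> = F (h \<theta>)" "f' \<theta> = deriv (F (h \<theta>))" "C' \<theta> = C (h \<theta>)" "p' \<theta> = p\<^sub>h \<theta>"
      | (default) "F' \<theta> = (\<lambda>t. 1 - exp (- t))" "f' \<theta> = (\<lambda>t. exp (- t))" "C' \<theta> = 1" "p' \<theta> = 1"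
      unfolding F'_def f'_def C'_def p'_def by (cases "\<theta> \<in> D - L\<^sub>h") auto
    note cases = this
    show "(F' \<theta> has_real_derivative f' \<theta> t) (at t)" if "t > 0" for t
      using cases
    proof cases
      case regular
      show ?thesis unfolding regular(2,3) by (rule deriv_F(1)[OF regular(1) that])
    next
      case default
      show ?thesis unfolding default by (auto intro!: derivative_eq_intros)
    qed
    show "continuous_on {0<..} (f' \<theta>)"
      using cases
    proof cases
      case regular
      show ?thesis unfolding regular(3) by (rule deriv_F(2)[OF regular(1)])
    next
      case default
      show ?thesis unfolding default by (intro continuous_intros)
    qed
    show "0 < f' \<theta> t" if "t > 0" for t
      using cases by cases (use deriv_bounds[of \<theta> t] that in auto)
    show "f' \<theta> t \<le> C' \<theta>" if "t > 0" for t
      using cases by cases (use deriv_bounds[of \<theta> t] that in \<open>auto intro: less_imp_le\<close>)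
    show "(F' \<theta> \<longlongrightarrow> 0) (at_right 0)"
      using cases
    proof cases
      case regular
      show ?thesis unfolding regular(2) using regular(1) by (intro F_at_right_0) auto
    next
      case default
      have "((\<lambda>t::real. 1 - exp (- t)) \<longlongrightarrow> 1 - exp (- 0)) (at_right 0)" by (intro tendsto_intros)
      then show ?thesis unfolding default by simp
    qed
    show "(F' \<theta> \<longlongrightarrow> 1) at_top"
      using cases
    proof cases
      case regular
      show ?thesis unfolding regular(2) using regular(1) by (intro F_at_top) auto
    next
      case default
      have "((\<lambda>t::real. 1 - exp (- t)) \<longlongrightarrow> 1 - 0) at_top"
        by (intro tendsto_diff tendsto_const filterlim_compose[OF exp_at_bot] filterlim_uminus_at_bot_at_top)
      then show ?thesis unfolding default by simp
    qed
    show "(f' \<theta> \<longlongrightarrow> p' \<theta>) (at_right 0)"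
      using cases
    proof cases
      case regular
      show ?thesis unfolding regular(3,5) by (rule deriv_lim[OF regular(1)])
    next
      case default
      have "((\<lambda>t::real. exp (- t)) \<longlongrightarrow> exp (- 0)) (at_right 0)" by (intro tendsto_intros)
      then show ?thesis unfolding default by simp
    qed
  qed
qed

text \<open>All functions are constant in the sample point: integrals reduce to their values, and an
  almost sure statement about \<theta> becomes a plain one.\<close>

lemma smooth_mixture_P\<^sub>\<theta>:
  assumes \<theta>: "\<theta> \<in> D - L\<^sub>h"
  shows "smooth_mixture (P\<^sub>\<theta> \<theta>) (\<lambda>_. F (h \<theta>)) (\<lambda>_. deriv (F (h \<theta>))) (\<lambda>_. C (h \<theta>)) (\<lambda>_. p\<^sub>h \<theta>)"
proof -
  interpret R: prob_space "P\<^sub>\<theta> \<theta>" using \<theta> R_prob by auto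
  show ?thesis
    using deriv_F[OF \<theta>] deriv_bounds[OF \<theta>] deriv_lim[OF \<theta>] F_at_right_0[of \<theta>] F_at_top[of \<theta>] \<theta>
    by unfold_locales (auto intro: less_imp_le)
qed

text \<open>\<open>p\<^sub>h\<close> is the limit of the densities at the points 1/(n+1), and each
  density is measurable in \<theta>.\<close>

lemma p_measurable: "p\<^sub>h \<in> borel_measurable (restrict_space borel S)"
proof -
  interpret mix: smooth_mixture \<mu> F' f' C' p' by (rule smooth_mixture_\<mu>)
  have "p' \<in> borel_measurable \<mu>"
  proof (rule borel_measurable_LIMSEQ_real)
    have e: "filterlim (\<lambda>n. inverse (real (Suc n))) (at_right 0) sequentially"
      unfolding filterlim_at using LIMSEQ_inverse_real_of_nat by (auto intro!: always_eventually)
    show "(\<lambda>n. f' \<theta> (inverse (real (Suc n)))) \<longlonglongrightarrow> p' \<theta>" if "\<theta> \<in> space \<mu>" for \<theta>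
      by (rule filterlim_compose[OF mix.f_at_0[OF that] e])
  qed (intro mix.f_meas, simp)
  then have "p' \<in> borel_measurable (restrict_space borel D)" by simp
  then have "p' \<in> borel_measurable (restrict_space borel S)"
    by (rule measurable_restrict_mono) auto
  also have "?this \<longleftrightarrow> ?thesis"
    by (intro measurable_cong) (auto simp: space_restrict_space p'_def)
  finally show ?thesis .
qed

lemma p_inj_S: "inj_on p\<^sub>h S"
  using p_inj by (rule inj_on_subset) auto

section \<open>Transfer to the new parameter\<close>

lemma inverse_p: obtains q where "q \<in> borel_measurable borel" "\<And>\<theta>. \<theta> \<in> S \<Longrightarrow> q (p\<^sub>h \<theta>) = \<theta>" "p\<^sub>h ` S \<in> sets borel"
  using borel_inverse_of_injective[OF S_borel p_measurable p_inj_S] by metis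

lemma Q_p: "\<theta> \<in> S \<Longrightarrow> Q (p\<^sub>h \<theta>) = P\<^sub>\<theta> \<theta>"
  using the_inv_into_f_f[OF p_inj_S] by (simp add: reparam_disintegration_def)

lemma AE_\<Theta>_S: "AE \<omega> in P. \<Theta> \<omega> \<in> S \<and> \<Theta>h \<omega> = p\<^sub>h (\<Theta> \<omega>)"
  using AE_\<Theta>[OF AE_S] AE_space by eventually_elim (use \<Theta>h_eq in auto)

text \<open>Null sets are carried from \<theta> to the new parameter by the Borel inverse
  \<open>q\<close> and back by \<open>p\<^sub>h\<close>; on \<open>S\<close> the two families
  correspond by \<open>Q_p\<close>.\<close>

lemma AE_Q_iff: "(AE x in distr P borel \<Theta>h. \<Phi> (Q x)) \<longleftrightarrow> (AE \<theta> in \<mu>. \<Phi> (P\<^sub>\<theta> \<theta>))"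
proof
  obtain q where q: "q \<in> borel_measurable borel" "\<And>\<theta>. \<theta> \<in> S \<Longrightarrow> q (p\<^sub>h \<theta>) = \<theta>" "p\<^sub>h ` S \<in> sets borel"
    by (rule inverse_p) blast
  assume "AE \<theta> in \<mu>. \<Phi> (P\<^sub>\<theta> \<theta>)"
  \<comment> \<open>\<Phi> need not define a measurable set, so a measurable null superset of its
    failures is transported.\<close>
  then obtain Z where Z: "{\<theta> \<in> space \<mu>. \<not> \<Phi> (P\<^sub>\<theta> \<theta>)} \<subseteq> Z" "emeasure \<mu> Z = 0" "Z \<in> sets \<mu>" by (rule AE_E)
  have Zn: "Z \<in> null_sets \<mu>" using Z by auto
  have Zb: "Z \<in> sets borel" using sets_\<mu>_borel Z(3) by simp
  note [measurable] = q(1,3) Zb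
  have "AE \<omega> in P. \<Theta>h \<omega> \<in> p\<^sub>h ` S \<and> q (\<Theta>h \<omega>) \<notin> Z"
    using AE_\<Theta>_S AE_\<Theta>[OF AE_not_in[OF Zn]] by eventually_elim (use q in auto)
  moreover have "{x \<in> space borel. x \<in> p\<^sub>h ` S \<and> q x \<notin> Z} \<in> sets borel" by measurable
  ultimately have "AE x in distr P borel \<Theta>h. x \<in> p\<^sub>h ` S \<and> q x \<notin> Z"
    using \<Theta>h by (subst AE_distr_iff) auto
  then show "AE x in distr P borel \<Theta>h. \<Phi> (Q x)"
  proof eventually_elim
    fix x assume x: "x \<in> p\<^sub>h ` S \<and> q x \<notin> Z"
    then obtain \<theta> where \<theta>: "\<theta> \<in> S" "x = p\<^sub>h \<theta>" by auto
    then have "\<Phi> (P\<^sub>\<theta> \<theta>)" using x Z(1) q(2) by (auto simp: space_restrict_space)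
    then show "\<Phi> (Q x)" using Q_p[OF \<theta>(1)] \<theta>(2) by simp
  qed
next
  assume "AE x in distr P borel \<Theta>h. \<Phi> (Q x)"
  then obtain Z where Z: "{x \<in> space (distr P borel \<Theta>h). \<not> \<Phi> (Q x)} \<subseteq> Z" "emeasure (distr P borel \<Theta>h) Z = 0"
    "Z \<in> sets (distr P borel \<Theta>h)" by (rule AE_E)
  have Zb: "Z \<in> sets borel" using Z(3) by simp
  have "AE x in distr P borel \<Theta>h. x \<notin> Z" using Z by (intro AE_not_in) auto
  then have "AE \<omega> in P. \<Theta>h \<omega> \<notin> Z" using \<Theta>h by (rule AE_distrD[rotated])
  with AE_\<Theta>_S have "AE \<omega> in P. \<Theta> \<omega> \<in> S - p\<^sub>h -` Z" by eventually_elim auto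
  moreover have "S - p\<^sub>h -` Z \<in> sets (restrict_space borel D)"
  proof -
    have "p\<^sub>h -` (- Z) \<inter> space (restrict_space borel S) \<in> sets (restrict_space borel S)"
      using Zb by (intro measurable_sets[OF p_measurable]) auto
    moreover have "p\<^sub>h -` (- Z) \<inter> space (restrict_space borel S) = S - p\<^sub>h -` Z"
      by (auto simp: space_restrict_space)
    ultimately show ?thesis using S_borel D(1) by (auto simp: sets_restrict_space_iff)
  qed
  moreover have "{\<theta> \<in> space (restrict_space borel D). \<theta> \<in> S - p\<^sub>h -` Z} = S - p\<^sub>h -` Z"
    by (auto simp: space_restrict_space)
  ultimately have "AE \<theta> in \<mu>. \<theta> \<in> S - p\<^sub>h -` Z"
    by (subst AE_distr_iff[OF \<Theta>_restrict]) (simp_all only:)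
  then show "AE \<theta> in \<mu>. \<Phi> (P\<^sub>\<theta> \<theta>)"
  proof eventually_elim
    fix \<theta> assume \<theta>: "\<theta> \<in> S - p\<^sub>h -` Z"
    then have "p\<^sub>h \<theta> \<notin> Z" by simp
    then have "\<Phi> (Q (p\<^sub>h \<theta>))" using Z(1) by fastforce
    moreover have "\<theta> \<in> S" using \<theta> by blast
    ultimately show "\<Phi> (P\<^sub>\<theta> \<theta>)" by (simp only: Q_p)
  qed
qed

lemma Q_prob: "prob_space (Q x)" and Q_sets: "sets (Q x) = sets P"
proof -
  have "prob_space (Q x) \<and> sets (Q x) = sets P"
  proof (cases "x \<in> p\<^sub>h ` S")
    case True
    then obtain \<theta> where \<theta>: "\<theta> \<in> S" "x = p\<^sub>h \<theta>" by auto
    then show ?thesis using Q_p[OF \<theta>(1)] R_prob[of \<theta>] R_sets[of \<theta>] by auto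
  next
    case False
    then show ?thesis using prob_space_axioms by (simp add: reparam_disintegration_def)
  qed
  then show "prob_space (Q x)" "sets (Q x) = sets P" by auto
qed

lemma Q_measurable:
  assumes A: "A \<in> events"
  shows "(\<lambda>x. emeasure (Q x) A) \<in> borel_measurable borel"
proof -
  obtain q where q: "q \<in> borel_measurable borel" "\<And>\<theta>. \<theta> \<in> S \<Longrightarrow> q (p\<^sub>h \<theta>) = \<theta>" "p\<^sub>h ` S \<in> sets borel"
    by (rule inverse_p) blast
  \<comment> \<open>Extended by 0 off \<open>D\<close>, the kernel is Borel on the whole space and
    can be composed with the total function \<open>q\<close>.\<close>
  define e where "e = (\<lambda>\<theta>. if \<theta> \<in> D then emeasure (P\<^sub>\<theta> \<theta>) A else 0)"
  have "(\<lambda>\<theta>. emeasure (P\<^sub>\<theta> \<theta>) A) \<in> borel_measurable (restrict_space borel D)"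
    using emeasure_R_measurable[OF A] by simp
  then have [measurable]: "e \<in> borel_measurable borel"
    unfolding e_def using D(1) by (subst (asm) measurable_restrict_space_iff[where c=0]) auto
  note [measurable] = q(1,3)
  have "emeasure (Q x) A = (if x \<in> p\<^sub>h ` S then e (q x) else emeasure P A)" for x
  proof (cases "x \<in> p\<^sub>h ` S")
    case True
    then obtain \<theta> where \<theta>: "\<theta> \<in> S" "x = p\<^sub>h \<theta>" by auto
    then show ?thesis using Q_p[OF \<theta>(1)] q(2)[OF \<theta>(1)] True by (simp add: e_def)
  qed (simp add: reparam_disintegration_def)
  moreover have "(\<lambda>x. if x \<in> p\<^sub>h ` S then e (q x) else emeasure P A) \<in> borel_measurable borel" by measurable
  ultimately show ?thesis by simp
qed

lemma Q_disintegration: "disintegration P UNIV \<Theta>h Q"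
  unfolding disintegration_def
proof (intro conjI ballI)
  fix A assume A: "A \<in> events"
  show m: "(\<lambda>x. emeasure (Q x) A) \<in> borel_measurable (restrict_space borel UNIV)"
    using Q_measurable[OF A] by simp
  have "(\<integral>\<^sup>+x. emeasure (Q x) A \<partial>distr P (restrict_space borel UNIV) \<Theta>h) = (\<integral>\<^sup>+\<omega>. emeasure (Q (\<Theta>h \<omega>)) A \<partial>P)"
    using m \<Theta>h by (intro nn_integral_distr) auto
  also have "\<dots> = (\<integral>\<^sup>+\<omega>. emeasure (P\<^sub>\<theta> (\<Theta> \<omega>)) A \<partial>P)"
  proof (rule nn_integral_cong_AE)
    show "AE \<omega> in P. emeasure (Q (\<Theta>h \<omega>)) A = emeasure (P\<^sub>\<theta> (\<Theta> \<omega>)) A"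
      using AE_\<Theta>_S
    proof eventually_elim
      case (elim \<omega>)
      then show ?case using Q_p[of "\<Theta> \<omega>"] by simp
    qed
  qed
  also have "\<dots> = (\<integral>\<^sup>+\<theta>. emeasure (P\<^sub>\<theta> \<theta>) A \<partial>\<mu>)"
    using emeasure_R_measurable[OF A] by (intro nn_integral_distr[symmetric]) auto
  also have "\<dots> = emeasure P A" using dis A by (auto simp: disintegration_def)
  finally show "(\<integral>\<^sup>+x. emeasure (Q x) A \<partial>distr P (restrict_space borel UNIV) \<Theta>h) = emeasure P A" .
qed (rule Q_prob Q_sets)+

lemma Q_consistent: "consistent_with P UNIV \<Theta>h Q"
  unfolding consistent_with_def
proof
  fix B :: "real set" assume "B \<in> sets (restrict_space borel UNIV)"
  then have B: "B \<in> sets borel" by simp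
  have A: "\<Theta>h -` B \<inter> space P \<in> events" using measurable_sets[OF \<Theta>h B] .
  \<comment> \<open>If \<Theta> lies in \<open>B'\<close>, then \<open>\<Theta>h\<close> lies in
    \<open>B\<close>; so consistency of the original family at \<open>B'\<close> gives the event for
    \<open>B\<close> full probability.\<close>
  define B' where "B' = p\<^sub>h -` B \<inter> S"
  have B': "B' \<in> sets (restrict_space borel D)"
  proof -
    have "p\<^sub>h -` B \<inter> space (restrict_space borel S) \<in> sets (restrict_space borel S)"
      using B by (intro measurable_sets[OF p_measurable])
    moreover have "p\<^sub>h -` B \<inter> space (restrict_space borel S) = B'"
      by (auto simp: space_restrict_space B'_def)
    ultimately show ?thesis using S_borel D(1) by (auto simp: sets_restrict_space_iff)
  qed
  have "AE \<theta> in \<mu>. \<theta> \<in> B' \<longrightarrow> emeasure (P\<^sub>\<theta> \<theta>) (\<Theta> -` B' \<inter> space P) = 1"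
    using consistent B' by (auto simp: consistent_with_def)
  then have "AE \<theta> in \<mu>. \<theta> \<in> B' \<longrightarrow> emeasure (P\<^sub>\<theta> \<theta>) (\<Theta>h -` B \<inter> space P) = 1"
    using AE_space
  proof eventually_elim
    fix \<theta> assume 1: "\<theta> \<in> B' \<longrightarrow> emeasure (P\<^sub>\<theta> \<theta>) (\<Theta> -` B' \<inter> space P) = 1" and "\<theta> \<in> space \<mu>"
    then have \<theta>: "\<theta> \<in> D" by (simp add: space_restrict_space)
    have sub: "\<Theta> -` B' \<inter> space P \<subseteq> \<Theta>h -` B \<inter> space P" using \<Theta>h_eq by (auto simp: B'_def)
    have "emeasure (P\<^sub>\<theta> \<theta>) (\<Theta> -` B' \<inter> space P) \<le> emeasure (P\<^sub>\<theta> \<theta>) (\<Theta>h -` B \<inter> space P)"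
      using sub A R_sets[OF \<theta>] by (intro emeasure_mono) auto
    moreover have "emeasure (P\<^sub>\<theta> \<theta>) (\<Theta>h -` B \<inter> space P) \<le> 1"
      using prob_space.emeasure_le_1[OF R_prob[OF \<theta>]] .
    ultimately show "\<theta> \<in> B' \<longrightarrow> emeasure (P\<^sub>\<theta> \<theta>) (\<Theta>h -` B \<inter> space P) = 1" using 1 by auto
  qed
  then have "AE \<omega> in P. \<Theta>h \<omega> \<in> B \<longrightarrow> emeasure (Q (\<Theta>h \<omega>)) (\<Theta>h -` B \<inter> space P) = 1"
    using AE_\<Theta>[of "\<lambda>\<theta>. \<theta> \<in> B' \<longrightarrow> emeasure (P\<^sub>\<theta> \<theta>) (\<Theta>h -` B \<inter> space P) = 1"] AE_\<Theta>_S
    by (auto elim!: eventually_elim2 simp: Q_p B'_def)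
  moreover have "{x \<in> space borel. x \<in> B \<longrightarrow> emeasure (Q x) (\<Theta>h -` B \<inter> space P) = 1} \<in> sets borel"
  proof -
    note [measurable] = Q_measurable[OF A] B
    show ?thesis by measurable
  qed
  ultimately have "AE x in distr P borel \<Theta>h. x \<in> B \<longrightarrow> emeasure (Q x) (\<Theta>h -` B \<inter> space P) = 1"
    using \<Theta>h by (subst AE_distr_iff) auto
  then show "AE x in distr P (restrict_space borel UNIV) \<Theta>h. x \<in> B \<longrightarrow> emeasure (Q x) (\<Theta>h -` B \<inter> space P) = 1"
    by (simp only: restrict_borel_UNIV)
qed

section \<open>Equivalence of the three properties\<close>

lemma AE_indep: "AE \<theta> in \<mu>. independent_gaps \<theta>"
  by (rule AE_renewal[OF N eMRP h K law])

lemma gaps_P\<^sub>\<theta>: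
  assumes \<theta>: "\<theta> \<in> D" and ind: "independent_gaps \<theta>"
    and "0 < x" "x < y" "0 < a" "0 < b" "0 < c"
  shows "measure (P\<^sub>\<theta> \<theta>) {\<omega>\<in>space (P\<^sub>\<theta> \<theta>). x < interarrival N 1 \<omega> \<and> interarrival N 1 \<omega> \<le> y \<and> c < interarrival N 2 \<omega> \<and>
          a < interarrival N 3 \<omega> \<and> b < interarrival N 4 \<omega>} =
    ((1 - F (h \<theta>) a) * (1 - F (h \<theta>) b)) * (F (h \<theta>) y - F (h \<theta>) x) * (1 - F (h \<theta>) c)"
  by (rule prob_space.renewal_gaps_prob[OF R_prob[OF \<theta>] ind]) (use assms F in auto)

lemma exponential_imp_multinomial:
  assumes \<theta>: "\<theta> \<in> D - L\<^sub>h" and ind: "independent_gaps \<theta>"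
    and exp: "\<And>t. t > 0 \<Longrightarrow> F (h \<theta>) t = 1 - exp (- (p\<^sub>h \<theta> * t))"
  shows "multinomial_property (P\<^sub>\<theta> \<theta>) N"
proof -
  have \<theta>D: "\<theta> \<in> D" using \<theta> by simp
  interpret R: prob_space "P\<^sub>\<theta> \<theta>" by (rule R_prob[OF \<theta>D])
  have "poisson_arrivals (P\<^sub>\<theta> \<theta>) N (p\<^sub>h \<theta>)"
  proof
    show "counting_process (P\<^sub>\<theta> \<theta>) N" by (rule counting_P\<^sub>\<theta>[OF \<theta>D])
    show "0 < p\<^sub>h \<theta>" by (rule p_pos[OF \<theta>])
    show "R.indep_vars (\<lambda>_. borel) (interarrival N) {1..}" by (rule ind)
    show "distributed (P\<^sub>\<theta> \<theta>) lborel (interarrival N n) (exponential_density (p\<^sub>h \<theta>))" if "n \<ge> 1" for n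
    proof (rule R.exponential_distributed_iff[THEN iffD2])
      \<comment> \<open>The exponential form is given for positive times; \<open>a = 0\<close> is
        covered by \<open>F_0\<close>.\<close>
      have "R.prob {\<omega> \<in> space (P\<^sub>\<theta> \<theta>). interarrival N n \<omega> \<le> a} = 1 - exp (- a * p\<^sub>h \<theta>)" if "0 \<le> a" for a
        using F[OF \<open>n \<ge> 1\<close> \<theta>D that] exp[of a] F_0[OF \<theta>D] that
        by (cases "a = 0") (simp_all add: mult.commute)
      with interarrival_P\<^sub>\<theta>[OF \<theta>D]
      show "interarrival N n \<in> borel_measurable (P\<^sub>\<theta> \<theta>) \<and>
        (\<forall>a\<ge>0. R.prob {\<omega> \<in> space (P\<^sub>\<theta> \<theta>). interarrival N n \<omega> \<le> a} = 1 - exp (- a * p\<^sub>h \<theta>))"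
        by blast
    qed (rule p_pos[OF \<theta>])
  qed
  then interpret poisson_arrivals "P\<^sub>\<theta> \<theta>" N "p\<^sub>h \<theta>" .
  show ?thesis by (rule multinomial)
qed

lemma markov_P_imp_multinomial:
  assumes "markov_property P N"
  shows "AE \<theta> in \<mu>. multinomial_property (P\<^sub>\<theta> \<theta>) N"
proof -
  interpret mix: smooth_mixture \<mu> F' f' C' p' by (rule smooth_mixture_\<mu>)
  have W[measurable]: "interarrival N n \<in> borel_measurable P" for n
    by (rule borel_measurable_interarrival[OF N])
  have "AE \<theta> in \<mu>. \<forall>t>0. F' \<theta> t = 1 - exp (- (p' \<theta> * t))"
  proof (rule mix.markov_imp_exponential[OF prob_space_axioms N assms])
    fix x y a b c :: real assume pos: "0 < x" "x < y" "0 < a" "0 < b" "0 < c"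
    define A where "A = {\<omega>\<in>space P. x < interarrival N 1 \<omega> \<and> interarrival N 1 \<omega> \<le> y \<and> c < interarrival N 2 \<omega> \<and>
          a < interarrival N 3 \<omega> \<and> b < interarrival N 4 \<omega>}"
    have A: "A \<in> events" unfolding A_def by measurable
    have "measure P A = (\<integral>\<theta>. measure (P\<^sub>\<theta> \<theta>) A \<partial>\<mu>)"
      by (rule disintegration_integral[OF prob_space_axioms dis A \<Theta>_restrict])
    \<comment> \<open>Almost every \<theta> has independent gaps and lies off the null sets, so the
      integrand is the product formula of \<open>gaps_P\<^sub>\<theta>\<close>.\<close>
    also have "\<dots> = mix.gain (\<lambda>\<theta>. mix.H \<theta> a * mix.H \<theta> b) x y c"
      unfolding mix.gain_def
    proof (rule integral_cong_AE)
      show "(\<lambda>\<theta>. measure (P\<^sub>\<theta> \<theta>) A) \<in> borel_measurable \<mu>" using disintegration_measurable[OF dis A] by simp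
      show "(\<lambda>\<theta>. (mix.H \<theta> a * mix.H \<theta> b) * (F' \<theta> y - F' \<theta> x) * mix.H \<theta> c) \<in> borel_measurable \<mu>"
        using pos by (intro borel_measurable_times borel_measurable_diff mix.H_meas mix.F_meas) auto
      show "AE \<theta> in \<mu>. measure (P\<^sub>\<theta> \<theta>) A = (mix.H \<theta> a * mix.H \<theta> b) * (F' \<theta> y - F' \<theta> x) * mix.H \<theta> c"
        using AE_S AE_indep
      proof eventually_elim
        fix \<theta> assume \<theta>: "\<theta> \<in> S" and ind: "independent_gaps \<theta>"
        then have "\<theta> \<in> D" by simp
        from gaps_P\<^sub>\<theta>[OF this ind pos] \<theta> show "measure (P\<^sub>\<theta> \<theta>) A = (mix.H \<theta> a * mix.H \<theta> b) * (F' \<theta> y - F' \<theta> x) * mix.H \<theta> c"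
          by (simp add: A_def R_space mix.H_def F'_def)
      qed
    qed
    finally show "measure P {\<omega>\<in>space P. x < interarrival N 1 \<omega> \<and> interarrival N 1 \<omega> \<le> y \<and> c < interarrival N 2 \<omega> \<and>
          a < interarrival N 3 \<omega> \<and> b < interarrival N 4 \<omega>} =
      mix.gain (\<lambda>\<theta>. mix.H \<theta> a * mix.H \<theta> b) x y c" by (simp add: A_def)
  qed
  then show ?thesis using AE_S AE_indep
  proof eventually_elim
    fix \<theta> assume exp: "\<forall>t>0. F' \<theta> t = 1 - exp (- (p' \<theta> * t))" and \<theta>: "\<theta> \<in> S"
      and ind: "independent_gaps \<theta>"
    then have "\<theta> \<in> D - L\<^sub>h" by auto
    then show "multinomial_property (P\<^sub>\<theta> \<theta>) N"
      using exp by (intro exponential_imp_multinomial[OF _ ind]) (auto simp: F'_def p'_def)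
  qed
qed

lemma markov_P\<^sub>\<theta>_imp_multinomial:
  assumes \<theta>: "\<theta> \<in> S" and ind: "independent_gaps \<theta>"
    and markov: "markov_property (P\<^sub>\<theta> \<theta>) N"
  shows "multinomial_property (P\<^sub>\<theta> \<theta>) N"
proof -
  have \<theta>': "\<theta> \<in> D - L\<^sub>h" "\<theta> \<in> D" using \<theta> by auto
  interpret mix: smooth_mixture "P\<^sub>\<theta> \<theta>" "\<lambda>_. F (h \<theta>)" "\<lambda>_. deriv (F (h \<theta>))" "\<lambda>_. C (h \<theta>)" "\<lambda>_. p\<^sub>h \<theta>"
    by (rule smooth_mixture_P\<^sub>\<theta>[OF \<theta>'(1)])
  have "AE \<omega> in P\<^sub>\<theta> \<theta>. \<forall>t>0. F (h \<theta>) t = 1 - exp (- (p\<^sub>h \<theta> * t))"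
    by (rule mix.markov_imp_exponential[OF R_prob[OF \<theta>'(2)] counting_P\<^sub>\<theta>[OF \<theta>'(2)] markov])
      (use gaps_P\<^sub>\<theta>[OF \<theta>'(2) ind] mix.prob_space in \<open>simp add: mix.gain_def mix.H_def\<close>)
  then show ?thesis by (intro exponential_imp_multinomial[OF \<theta>'(1) ind]) simp
qed

text \<open>Statement (iii) is the hub: both Markov statements imply it through the exponential
  form, and it returns to (ii) componentwise and to (i) by integration.\<close>

lemma reparametrized_characterization:
  "disintegration P UNIV \<Theta>h Q \<and> consistent_with P UNIV \<Theta>h Q \<and>
    (markov_property P N \<longleftrightarrow> (AE x in distr P borel \<Theta>h. markov_property (Q x) N)) \<and>
    ((AE x in distr P borel \<Theta>h. markov_property (Q x) N) \<longleftrightarrow>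
      (AE x in distr P borel \<Theta>h. multinomial_property (Q x) N))"
proof -
  note AE_markov = AE_Q_iff[of "\<lambda>R. markov_property R N"]
  note AE_multinomial = AE_Q_iff[of "\<lambda>R. multinomial_property R N"]
  have i_iii: "AE x in distr P borel \<Theta>h. multinomial_property (Q x) N" if "markov_property P N"
    by (rule AE_multinomial[THEN iffD2, OF markov_P_imp_multinomial[OF that]])
  have iii_i: "markov_property P N" if "AE x in distr P borel \<Theta>h. multinomial_property (Q x) N"
    by (rule multinomial_imp_markov[OF prob_space_axioms
          multinomial_mixture[OF prob_space_axioms Q_disintegration \<Theta>h N that] N])
  have iii_ii: "AE x in distr P borel \<Theta>h. markov_property (Q x) N"
    if "AE x in distr P borel \<Theta>h. multinomial_property (Q x) N"
    using that by (rule eventually_mono)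
      (rule multinomial_imp_markov[OF Q_prob _ counting_process_cong_sets[OF N Q_sets]])
  have ii_iii: "AE x in distr P borel \<Theta>h. multinomial_property (Q x) N"
    if "AE x in distr P borel \<Theta>h. markov_property (Q x) N"
  proof -
    have "AE \<theta> in \<mu>. markov_property (P\<^sub>\<theta> \<theta>) N" by (rule AE_markov[THEN iffD1, OF that])
    then have "AE \<theta> in \<mu>. multinomial_property (P\<^sub>\<theta> \<theta>) N"
      using AE_S AE_indep by eventually_elim (rule markov_P\<^sub>\<theta>_imp_multinomial)
    then show ?thesis by (rule AE_multinomial[THEN iffD2])
  qed
  show ?thesis using i_iii iii_i iii_ii ii_iii Q_disintegration Q_consistent by blast
qed

end

theorem corollary2p12:
  fixes P :: "'a measure"
    and \<Theta> :: "'a \<Rightarrow> real ^ 'd"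
    and D L\<^sub>0 L\<^sub>h :: "(real ^ 'd) set"
    and P\<^sub>\<theta> :: "real ^ 'd \<Rightarrow> 'a measure"
    and h :: "real ^ 'd \<Rightarrow> real ^ 'k"
    and K :: "real ^ 'k \<Rightarrow> real measure"
    and N :: "real \<Rightarrow> 'a \<Rightarrow> enat"
    and F :: "real ^ 'k \<Rightarrow> real \<Rightarrow> real"
    and C :: "real ^ 'k \<Rightarrow> real"
    and p\<^sub>h :: "real ^ 'd \<Rightarrow> real"
    and \<Theta>h :: "'a \<Rightarrow> real"
    and Q :: "real \<Rightarrow> 'a measure"
  assumes "prob_space P"
    and "\<Theta> \<in> borel_measurable P"
    and "D \<in> sets borel" and "\<Theta> ` space P \<subseteq> D"
    and "disintegration P D \<Theta> P\<^sub>\<theta>" and "consistent_with P D \<Theta> P\<^sub>\<theta>"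
    and "h \<in> borel_measurable (restrict_space borel D)"
    and "L\<^sub>0 \<in> null_sets (distr P (restrict_space borel D) \<Theta>)" and "inj_on h (D - L\<^sub>0)"
    and "K \<in> measurable borel (prob_algebra borel)"
    and "counting_process P N"
    and "eMRP P N \<Theta> K h"
    and "\<And>n \<theta>. n \<ge> 1 \<Longrightarrow> \<theta> \<in> D \<Longrightarrow> distr (P\<^sub>\<theta> \<theta>) borel (interarrival N n) = K (h \<theta>)"
    and "\<And>n \<theta> t. n \<ge> 1 \<Longrightarrow> \<theta> \<in> D \<Longrightarrow> t \<ge> 0 \<Longrightarrow>
           F (h \<theta>) t = \<P>(\<omega> in P\<^sub>\<theta> \<theta>. interarrival N n \<omega> \<le> t)"
    and "L\<^sub>h \<in> null_sets (distr P (restrict_space borel D) \<Theta>)"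
    and "integrable (distr P borel (\<lambda>\<omega>. h (\<Theta> \<omega>))) C"
    and "\<And>\<theta>. \<theta> \<in> D - L\<^sub>h \<Longrightarrow> F (h \<theta>) C1_differentiable_on {0<..}"
    and "\<And>\<theta> t. \<theta> \<in> D - L\<^sub>h \<Longrightarrow> t > 0 \<Longrightarrow>
           0 < deriv (F (h \<theta>)) t \<and> deriv (F (h \<theta>)) t < C (h \<theta>)"
    and "\<And>\<theta>. \<theta> \<in> D - L\<^sub>h \<Longrightarrow> (deriv (F (h \<theta>)) \<longlongrightarrow> p\<^sub>h \<theta>) (at_right 0)"
    and "\<And>\<theta>. \<theta> \<in> D - L\<^sub>h \<Longrightarrow> p\<^sub>h \<theta> > 0"
    and "inj_on p\<^sub>h (D - L\<^sub>h)"
    and "\<Theta>h \<in> borel_measurable P"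
    and "\<And>\<omega>. \<omega> \<in> space P \<Longrightarrow> \<Theta> \<omega> \<in> D - (L\<^sub>0 \<union> L\<^sub>h) \<Longrightarrow> \<Theta>h \<omega> = p\<^sub>h (\<Theta> \<omega>)"
  defines "Q \<equiv> reparam_disintegration P P\<^sub>\<theta> p\<^sub>h (D - (L\<^sub>0 \<union> L\<^sub>h))"
  shows "disintegration P UNIV \<Theta>h Q \<and> consistent_with P UNIV \<Theta>h Q \<and>
         (markov_property P N \<longleftrightarrow> (AE x in distr P borel \<Theta>h. markov_property (Q x) N)) \<and>
         ((AE x in distr P borel \<Theta>h. markov_property (Q x) N) \<longleftrightarrow>
          (AE x in distr P borel \<Theta>h. multinomial_property (Q x) N))"
proof -
  interpret identifiable_renewal P \<Theta> D P\<^sub>\<theta> L\<^sub>0 L\<^sub>h h K N F C p\<^sub>h \<Theta>h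
    by (intro identifiable_renewal.intro disintegrated.intro disintegrated_axioms.intro
        identifiable_renewal_axioms.intro assms)
  show ?thesis unfolding Q_def by (rule reparametrized_characterization)
qed

end
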